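(* Let $G$ be a countably infinite, residually finite, amenable group, let $(H,\tau)$ be a metric group compactification of $G$ and let $h\in[0,\log2)$. Then there exists an array $x\in\{0,1\}^G$ which is almost automorphic over $H$ such that $h_{\mathrm{top}}(\overline{O_G(x)},G)=h$.
   Context: A metric group compactification $(H,\tau)$ of $G$ consists of a compact metrizable group $H$ and an injective group homomorphism $\tau:G\to H$ with dense range. $H$ is regarded as a dynamical system $(H,\rho,G)$ via $\rho_g(\xi)=\tau(g)\xi$, which is minimal and equicontinuous. $G$ acts on $\{0,1\}^G$ (product topology) by the shift $(gx)(h)=x(hg)$; $O_G(x)=\{gx:g\in G\}$. A factor map between dynamical systems (continuous $G$-actions on compact metric spaces) is a continuous, surjective, $G$-equivariant map; a bijective factor map is a conjugacy. A system $(Y,G)$ with metric $d$ is equicontinuous if for all $\varepsilon>0$ there is $\delta>0$ with $d(y,y')<\delta\Rightarrow d(gy,gy')<\varepsilon$ for all $g\in G$. Every system has a maximal equicontinuous factor, i.e. an equicontinuous factor through which every factor map onto an equicontinuous system factors, unique up to conjugacy. An array $x$ is almost automorphic over $(Y,G)$ if $(Y,G)$ is (up to conjugacy) the maximal equicontinuous factor of $(\overline{O_G(x)},G)$, with factor map $\pi$, and $\pi^{-1}\{\pi(x)\}=\{x\}$; "over $H$" means over $(H,\rho,G)$. Entropy: for $A\subseteq G$, an $A$-word $\mathfrak{W}\in\{0,1\}^A$ occurs in an array $y$ if there is $h\in G$ with $y(gh)=\mathfrak{W}(g)$ for all $g\in A$. For a subshift $X$ let $\mathcal{B}_A(X)$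 be the set of $A$-words occurring in some element of $X$. Then $h_{\mathrm{top}}(X,G)=\lim_{n\to\infty}\frac{\log\#\mathcal{B}_{F_n}(X)}{\#F_n}$ for any Følner sequence $(F_n)$ in $G$ (nonempty finite sets with $\#(gF_n\triangle F_n)/\#F_n\to0$ for all $g\in G$); the limit exists and does not depend on the Følner sequence. $\log$ is the natural logarithm. *)

theory Defs
  imports "HOL-Analysis.Analysis" "HOL-Algebra.Group_Action"
begin

definition residually_finite :: "('g, 'm) monoid_scheme \<Rightarrow> bool" where
  "residually_finite G \<longleftrightarrow>
     (\<forall>g \<in> carrier G - {\<one>\<^bsub>G\<^esub>}. \<exists>N. N \<lhd> G \<and> finite (carrier (G Mod N)) \<and> g \<notin> N)"

definition Folner_sequence :: "('g, 'm) monoid_scheme \<Rightarrow> (nat \<Rightarrow> 'g set) \<Rightarrow> bool" where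
  "Folner_sequence G F \<longleftrightarrow>
     (\<forall>n. finite (F n) \<and> F n \<noteq> {} \<and> F n \<subseteq> carrier G) \<and>
     (\<forall>g \<in> carrier G.
        (\<lambda>n. real (card (sym_diff (g <#\<^bsub>G\<^esub> F n) (F n))) / real (card (F n))) \<longlonglongrightarrow> 0)"

text \<open>Amenability is only used for countable discrete groups, where it means that a Folner
  sequence exists.\<close>

definition amenable :: "('g, 'm) monoid_scheme \<Rightarrow> bool" where
  "amenable G \<longleftrightarrow> (\<exists>F. Folner_sequence G F)"

definition topological_group :: "('h, 'm) monoid_scheme \<Rightarrow> 'h topology \<Rightarrow> bool" where
  "topological_group H T \<longleftrightarrow>
     group H \<and> topspace T = carrier H \<and>
     continuous_map (prod_topology T T) T (\<lambda>(a, b). a \<otimes>\<^bsub>H\<^esub> b) \<and>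
     continuous_map T T (\<lambda>a. inv\<^bsub>H\<^esub> a)"

definition metric_group_compactification ::
  "('g, 'm) monoid_scheme \<Rightarrow> ('h, 'n) monoid_scheme \<Rightarrow> 'h topology \<Rightarrow> ('g \<Rightarrow> 'h) \<Rightarrow> bool" where
  "metric_group_compactification G H T \<tau> \<longleftrightarrow>
     topological_group H T \<and> compact_space T \<and> metrizable_space T \<and>
     \<tau> \<in> hom G H \<and> inj_on \<tau> (carrier G) \<and> T closure_of (\<tau> ` carrier G) = topspace T"

text \<open>The acting group is discrete, so an action is continuous iff each group element acts
  continuously. Following \<^term>\<open>group_action\<close>, the maps by which the group acts are extensional on
  the phase space.\<close>

definition dynamical_system ::
  "('g, 'm) monoid_scheme \<Rightarrow> 'a topology \<Rightarrow> ('g \<Rightarrow> 'a \<Rightarrow> 'a) \<Rightarrow> bool" where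
  "dynamical_system G T \<alpha> \<longleftrightarrow>
     compact_space T \<and> metrizable_space T \<and> group_action G (topspace T) \<alpha> \<and>
     (\<forall>g \<in> carrier G. continuous_map T T (\<alpha> g))"

text \<open>On a compact space any two metrics inducing the topology are uniformly equivalent, so the
  choice of the metric is irrelevant; see \<open>equicontinuous_system_metric\<close> below.\<close>

definition equicontinuous_system ::
  "('g, 'm) monoid_scheme \<Rightarrow> 'a topology \<Rightarrow> ('g \<Rightarrow> 'a \<Rightarrow> 'a) \<Rightarrow> bool" where
  "equicontinuous_system G T \<alpha> \<longleftrightarrow>
     dynamical_system G T \<alpha> \<and>
     (\<exists>d. Metric_space (topspace T) d \<and> Metric_space.mtopology (topspace T) d = T \<and>
        (\<forall>\<epsilon>>0. \<exists>\<delta>>0. \<forall>y \<in> topspace T. \<forall>y' \<in> topspace T.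
           d y y' < \<delta> \<longrightarrow> (\<forall>g \<in> carrier G. d (\<alpha> g y) (\<alpha> g y') < \<epsilon>)))"

lemma equicontinuous_system_metric:
  assumes eq: "equicontinuous_system G T \<alpha>"
    and m: "Metric_space (topspace T) d" "Metric_space.mtopology (topspace T) d = T"
    and "\<epsilon> > 0"
  shows "\<exists>\<delta>>0. \<forall>y \<in> topspace T. \<forall>y' \<in> topspace T.
           d y y' < \<delta> \<longrightarrow> (\<forall>g \<in> carrier G. d (\<alpha> g y) (\<alpha> g y') < \<epsilon>)"
proof -
  obtain e where e: "Metric_space (topspace T) e" "Metric_space.mtopology (topspace T) e = T"
    and eqc: "\<And>\<epsilon>. \<epsilon> > 0 \<Longrightarrow> \<exists>\<delta>>0. \<forall>y \<in> topspace T. \<forall>y' \<in> topspace T.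
           e y y' < \<delta> \<longrightarrow> (\<forall>g \<in> carrier G. e (\<alpha> g y) (\<alpha> g y') < \<epsilon>)"
    using eq unfolding equicontinuous_system_def by metis
  have ds: "dynamical_system G T \<alpha>" using eq by (simp add: equicontinuous_system_def)
  then have inT: "\<alpha> g y \<in> topspace T" if "g \<in> carrier G" "y \<in> topspace T" for g y
    using that unfolding dynamical_system_def by (metis group_action.element_image)
  have unif: "\<exists>\<delta>>0. \<forall>y \<in> topspace T. \<forall>y' \<in> topspace T. d1 y y' < \<delta> \<longrightarrow> d2 y y' < \<eta>"
    if d1: "Metric_space (topspace T) d1" "Metric_space.mtopology (topspace T) d1 = T"
      and d2: "Metric_space (topspace T) d2" "Metric_space.mtopology (topspace T) d2 = T"
      and "\<eta> > 0" for d1 d2 and \<eta> :: real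
  proof -
    have "uniformly_continuous_map (metric (topspace T, d1)) (metric (topspace T, d2)) id"
    proof -
      have 1: "mtopology_of (metric (topspace T, d1)) = T"
          "mtopology_of (metric (topspace T, d2)) = T"
        using d1 d2 by (simp_all add: mtopology_of_def Metric_space.mspace_metric Metric_space.mdist_metric)
      show ?thesis
        by (subst continuous_eq_uniformly_continuous_map[symmetric])
          (use ds 1 in \<open>auto simp: dynamical_system_def\<close>)
    qed
    then show ?thesis using d1 d2 \<open>\<eta> > 0\<close>
      by (auto simp: uniformly_continuous_map_def Metric_space.mspace_metric Metric_space.mdist_metric) metis
  qed
  obtain \<epsilon>1 where 1: "\<epsilon>1 > 0" "\<forall>y \<in> topspace T. \<forall>y' \<in> topspace T. e y y' < \<epsilon>1 \<longrightarrow> d y y' < \<epsilon>"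
    using unif[OF e m \<open>\<epsilon> > 0\<close>] by blast
  obtain \<delta>1 where 2: "\<delta>1 > 0" "\<forall>y \<in> topspace T. \<forall>y' \<in> topspace T.
       e y y' < \<delta>1 \<longrightarrow> (\<forall>g \<in> carrier G. e (\<alpha> g y) (\<alpha> g y') < \<epsilon>1)"
    using eqc[OF 1(1)] by blast
  obtain \<delta> where 3: "\<delta> > 0" "\<forall>y \<in> topspace T. \<forall>y' \<in> topspace T. d y y' < \<delta> \<longrightarrow> e y y' < \<delta>1"
    using unif[OF m e 2(1)] by blast
  show ?thesis using 1 2 3 inT by (intro exI[of _ \<delta>]) blast
qed

definition factor_map ::
  "('g, 'm) monoid_scheme \<Rightarrow> 'a topology \<Rightarrow> ('g \<Rightarrow> 'a \<Rightarrow> 'a) \<Rightarrow>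
     'b topology \<Rightarrow> ('g \<Rightarrow> 'b \<Rightarrow> 'b) \<Rightarrow> ('a \<Rightarrow> 'b) \<Rightarrow> bool" where
  "factor_map G T \<alpha> S \<beta> \<pi> \<longleftrightarrow>
     dynamical_system G T \<alpha> \<and> dynamical_system G S \<beta> \<and>
     continuous_map T S \<pi> \<and> \<pi> ` topspace T = topspace S \<and>
     (\<forall>g \<in> carrier G. \<forall>x \<in> topspace T. \<pi> (\<alpha> g x) = \<beta> g (\<pi> x))"

text \<open>The competing factors range over systems whose points have the same type as those of the
  system itself. This is no restriction: the points of a factor can be replaced by points of the
  system, one from each fibre. The lemma \<open>maximal_equicontinuous_factor_universal\<close> below derives
  the universal property for factors of arbitrary type.\<close>

definition maximal_equicontinuous_factor ::
  "('g, 'm) monoid_scheme \<Rightarrow> 'a topology \<Rightarrow> ('g \<Rightarrow> 'a \<Rightarrow> 'a) \<Rightarrow>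
     'b topology \<Rightarrow> ('g \<Rightarrow> 'b \<Rightarrow> 'b) \<Rightarrow> ('a \<Rightarrow> 'b) \<Rightarrow> bool" where
  "maximal_equicontinuous_factor G T \<alpha> S \<beta> \<pi> \<longleftrightarrow>
     factor_map G T \<alpha> S \<beta> \<pi> \<and> equicontinuous_system G S \<beta> \<and>
     (\<forall>(Z :: 'a topology) \<gamma> \<phi>.
        equicontinuous_system G Z \<gamma> \<and> factor_map G T \<alpha> Z \<gamma> \<phi> \<longrightarrow>
        (\<exists>\<psi>. factor_map G S \<beta> Z \<gamma> \<psi> \<and> (\<forall>x \<in> topspace T. \<phi> x = \<psi> (\<pi> x))))"

lemma group_actionI:
  assumes "group G"
    and ext: "\<And>g. g \<in> carrier G \<Longrightarrow> \<alpha> g \<in> extensional E"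
    and maps: "\<And>g x. g \<in> carrier G \<Longrightarrow> x \<in> E \<Longrightarrow> \<alpha> g x \<in> E"
    and one: "\<And>x. x \<in> E \<Longrightarrow> \<alpha> \<one>\<^bsub>G\<^esub> x = x"
    and mult: "\<And>g h x. g \<in> carrier G \<Longrightarrow> h \<in> carrier G \<Longrightarrow> x \<in> E \<Longrightarrow>
                 \<alpha> (g \<otimes>\<^bsub>G\<^esub> h) x = \<alpha> g (\<alpha> h x)"
  shows "group_action G E \<alpha>"
proof -
  interpret group G by fact
  have bij: "\<alpha> g \<in> Bij E" if g: "g \<in> carrier G" for g
  proof -
    have "bij_betw (\<alpha> g) E E"
      by (rule bij_betw_byWitness[where f' = "\<alpha> (inv\<^bsub>G\<^esub> g)"])
        (use g maps one mult[symmetric] in \<open>auto\<close>)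
    then show ?thesis using ext[OF g] by (simp add: Bij_def)
  qed
  have "\<alpha> (g \<otimes>\<^bsub>G\<^esub> h) = compose E (\<alpha> g) (\<alpha> h)" if "g \<in> carrier G" "h \<in> carrier G" for g h
    by (rule extensionalityI[of _ E]) (use that ext mult in \<open>auto simp: compose_def\<close>)
  then show ?thesis
    unfolding group_action_def group_hom_def group_hom_axioms_def hom_def
    using bij group_BijGroup[of E] is_group by (auto simp: BijGroup_def)
qed

lemma equicontinuous_factor_transfer:
  fixes Z :: "'c topology" and T :: "'a topology"
  assumes Z: "equicontinuous_system G Z \<gamma>" and fm: "factor_map G T \<alpha> Z \<gamma> \<phi>"
  obtains Z' :: "'a topology" and \<gamma>' and s :: "'c \<Rightarrow> 'a" and p :: "'a \<Rightarrow> 'c"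
  where "equicontinuous_system G Z' \<gamma>'" "factor_map G Z \<gamma> Z' \<gamma>' s" "factor_map G Z' \<gamma>' Z \<gamma> p"
    "\<forall>z \<in> topspace Z. p (s z) = z"
proof -
  have dsZ: "dynamical_system G Z \<gamma>" using Z by (simp add: equicontinuous_system_def)
  interpret group_action G "topspace Z" \<gamma> using dsZ by (simp add: dynamical_system_def)
  have G: "group G" using group_hom by (simp add: group_hom_def)
  have surj: "\<phi> ` topspace T = topspace Z" using fm by (simp add: factor_map_def)
  obtain d where d: "Metric_space (topspace Z) d" "Metric_space.mtopology (topspace Z) d = Z"
    and eqc: "\<And>\<epsilon>. \<epsilon> > 0 \<Longrightarrow> \<exists>\<delta>>0. \<forall>y \<in> topspace Z. \<forall>y' \<in> topspace Z.
           d y y' < \<delta> \<longrightarrow> (\<forall>g \<in> carrier G. d (\<gamma> g y) (\<gamma> g y') < \<epsilon>)"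
    using Z unfolding equicontinuous_system_def by metis
  define s where "s = inv_into (topspace T) \<phi>"
  have \<phi>s: "\<phi> (s z) = z" if "z \<in> topspace Z" for z
    using that surj by (simp add: s_def f_inv_into_f)
  define M where "M = s ` topspace Z"
  define d' where "d' x y = d (\<phi> x) (\<phi> y)" for x y
  define \<gamma>' where "\<gamma>' g = (\<lambda>y\<in>M. s (\<gamma> g (\<phi> y)))" for g
  interpret dd: Metric_space "topspace Z" d by fact
  have \<phi>M: "\<phi> y \<in> topspace Z" if "y \<in> M" for y using that \<phi>s by (auto simp: M_def)
  have s\<phi>: "s (\<phi> y) = y" if "y \<in> M" for y using that \<phi>s by (auto simp: M_def)
  have sM: "s z \<in> M" if "z \<in> topspace Z" for z using that by (simp add: M_def)
  have d': "Metric_space M d'"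
  proof
    show "0 \<le> d' x y" for x y by (simp add: d'_def)
    show "d' x y = d' y x" for x y by (simp add: d'_def dd.commute)
    show "(d' x y = 0) = (x = y)" if "x \<in> M" "y \<in> M" for x y
      using that \<phi>M s\<phi> by (metis d'_def dd.zero)
    show "d' x z \<le> d' x y + d' y z" if "x \<in> M" "y \<in> M" "z \<in> M" for x y z
      using that \<phi>M by (simp add: d'_def dd.triangle)
  qed
  interpret d': Metric_space M d' by fact
  define Z' where "Z' = d'.mtopology"
  have top: "topspace Z' = M" by (simp add: Z'_def)
  have cs: "continuous_map Z Z' s"
    unfolding Z'_def using dd.metric_continuous_map[OF d', of s] d(2)
    by (auto simp: sM d'_def \<phi>s)
  have cp: "continuous_map Z' Z \<phi>"
    unfolding Z'_def using d'.metric_continuous_map[OF d(1), of \<phi>] d(2)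
    by (auto simp: \<phi>M d'_def)
  have \<gamma>M: "\<gamma> g z \<in> topspace Z" if "g \<in> carrier G" "z \<in> topspace Z" for g z
    using that element_image by blast
  have act: "group_action G M \<gamma>'"
  proof (rule group_actionI[OF G])
    show "\<gamma>' g \<in> extensional M" for g by (simp add: \<gamma>'_def)
    show "\<gamma>' g x \<in> M" if "g \<in> carrier G" "x \<in> M" for g x
      using that by (simp add: \<gamma>'_def sM \<gamma>M \<phi>M)
    show "\<gamma>' \<one>\<^bsub>G\<^esub> x = x" if "x \<in> M" for x
      using that id_eq_one[symmetric] by (simp add: \<gamma>'_def \<phi>M s\<phi>)
    show "\<gamma>' (g \<otimes>\<^bsub>G\<^esub> h) x = \<gamma>' g (\<gamma>' h x)" if "g \<in> carrier G" "h \<in> carrier G" "x \<in> M" for g h x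
      using that by (simp add: \<gamma>'_def sM \<gamma>M \<phi>M \<phi>s composition_rule)
  qed
  have ds': "dynamical_system G Z' \<gamma>'"
    unfolding dynamical_system_def top
  proof (intro conjI ballI act)
    have "compactin Z' (s ` topspace Z)"
      using dsZ cs by (intro image_compactin[of Z]) (auto simp: dynamical_system_def compact_space_def)
    then show "compact_space Z'" by (simp add: compact_space_def top M_def)
    show "metrizable_space Z'" by (simp add: Z'_def d'.metrizable_space_mtopology)
    fix g assume "g \<in> carrier G"
    then have "continuous_map Z Z (\<gamma> g)" using dsZ by (simp add: dynamical_system_def)
    then have "continuous_map Z' Z' (s \<circ> \<gamma> g \<circ> \<phi>)"
      using cs cp by (blast intro: continuous_map_compose)
    then show "continuous_map Z' Z' (\<gamma>' g)"
      by (rule continuous_map_eq) (simp add: top \<gamma>'_def)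
  qed
  have "equicontinuous_system G Z' \<gamma>'"
    unfolding equicontinuous_system_def
  proof (intro conjI ds' exI[of _ d'] allI impI)
    show "Metric_space (topspace Z') d'" by (simp add: top d')
    show "Metric_space.mtopology (topspace Z') d' = Z'" by (simp add: top, simp add: Z'_def)
    fix \<epsilon> :: real assume "\<epsilon> > 0"
    from eqc[OF this] show "\<exists>\<delta>>0. \<forall>y\<in>topspace Z'. \<forall>y'\<in>topspace Z'.
        d' y y' < \<delta> \<longrightarrow> (\<forall>g\<in>carrier G. d' (\<gamma>' g y) (\<gamma>' g y') < \<epsilon>)"
      by (simp add: top d'_def \<gamma>'_def \<phi>s \<gamma>M \<phi>M) (meson \<phi>M)
  qed
  moreover have "factor_map G Z \<gamma> Z' \<gamma>' s"
    unfolding factor_map_def using dsZ ds' cs by (simp add: top M_def \<gamma>'_def \<phi>s)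
  moreover have "factor_map G Z' \<gamma>' Z \<gamma> \<phi>"
    unfolding factor_map_def using dsZ ds' cp
    by (auto simp: top \<gamma>'_def \<phi>s \<phi>M \<gamma>M) (metis \<phi>s image_eqI sM)
  ultimately show thesis using that \<phi>s by blast
qed

lemma factor_map_compose:
  assumes "factor_map G T \<alpha> S \<beta> \<pi>" "factor_map G S \<beta> Z \<gamma> \<psi>"
  shows "factor_map G T \<alpha> Z \<gamma> (\<psi> \<circ> \<pi>)"
proof -
  have "\<pi> x \<in> topspace S" if "x \<in> topspace T" for x
    using assms(1) that by (auto simp: factor_map_def)
  then show ?thesis
    using assms unfolding factor_map_def
    by (metis comp_apply continuous_map_compose image_comp)
qed

lemma maximal_equicontinuous_factor_universal:
  fixes T :: "'a topology" and Z :: "'c topology"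
  assumes mef: "maximal_equicontinuous_factor G T \<alpha> S \<beta> \<pi>"
    and Z: "equicontinuous_system G Z \<gamma>" and fm: "factor_map G T \<alpha> Z \<gamma> \<phi>"
  shows "\<exists>\<psi>. factor_map G S \<beta> Z \<gamma> \<psi> \<and> (\<forall>x \<in> topspace T. \<phi> x = \<psi> (\<pi> x))"
proof -
  obtain Z' :: "'a topology" and \<gamma>' s p where
    Z': "equicontinuous_system G Z' \<gamma>'" and s: "factor_map G Z \<gamma> Z' \<gamma>' s"
    and p: "factor_map G Z' \<gamma>' Z \<gamma> p" and ps: "\<forall>z \<in> topspace Z. p (s z) = z"
    by (rule equicontinuous_factor_transfer[OF Z fm])
  obtain \<psi> where \<psi>: "factor_map G S \<beta> Z' \<gamma>' \<psi>" "\<forall>x \<in> topspace T. (s \<circ> \<phi>) x = \<psi> (\<pi> x)"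
    using mef[unfolded maximal_equicontinuous_factor_def, THEN conjunct2, THEN conjunct2,
        rule_format, OF conjI, OF Z' factor_map_compose[OF fm s]] by auto
  have "\<phi> x = (p \<circ> \<psi>) (\<pi> x)" if "x \<in> topspace T" for x
  proof -
    have "\<phi> x \<in> topspace Z" using fm that by (auto simp: factor_map_def)
    then show ?thesis using \<psi>(2) ps that by (metis comp_apply)
  qed
  then show ?thesis using factor_map_compose[OF \<psi>(1) p] by blast
qed

definition rotation ::
  "('h, 'n) monoid_scheme \<Rightarrow> ('g \<Rightarrow> 'h) \<Rightarrow> 'g \<Rightarrow> 'h \<Rightarrow> 'h" where
  "rotation H \<tau> g = (\<lambda>\<xi> \<in> carrier H. \<tau> g \<otimes>\<^bsub>H\<^esub> \<xi>)"

definition full_shift :: "('g, 'm) monoid_scheme \<Rightarrow> ('g \<Rightarrow> nat) topology" where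
  "full_shift G = product_topology (\<lambda>_. discrete_topology {0, 1}) (carrier G)"

abbreviation arrays :: "('g, 'm) monoid_scheme \<Rightarrow> ('g \<Rightarrow> nat) set" where
  "arrays G \<equiv> carrier G \<rightarrow>\<^sub>E {0, 1}"

definition shift ::
  "('g, 'm) monoid_scheme \<Rightarrow> ('g \<Rightarrow> nat) set \<Rightarrow> 'g \<Rightarrow> ('g \<Rightarrow> nat) \<Rightarrow> ('g \<Rightarrow> nat)" where
  "shift G X g = (\<lambda>x \<in> X. \<lambda>h \<in> carrier G. x (h \<otimes>\<^bsub>G\<^esub> g))"

definition orbit_closure :: "('g, 'm) monoid_scheme \<Rightarrow> ('g \<Rightarrow> nat) \<Rightarrow> ('g \<Rightarrow> nat) set" where
  "orbit_closure G x = full_shift G closure_of (orbit G (shift G (arrays G)) x)"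

definition almost_automorphic ::
  "('g, 'm) monoid_scheme \<Rightarrow> ('g \<Rightarrow> nat) \<Rightarrow> 'b topology \<Rightarrow> ('g \<Rightarrow> 'b \<Rightarrow> 'b) \<Rightarrow> bool" where
  "almost_automorphic G x S \<beta> \<longleftrightarrow>
     (let X = orbit_closure G x in
      \<exists>\<pi>. maximal_equicontinuous_factor G (subtopology (full_shift G) X) (shift G X) S \<beta> \<pi> \<and>
          {y \<in> X. \<pi> y = \<pi> x} = {x})"

definition occurs_in ::
  "('g, 'm) monoid_scheme \<Rightarrow> 'g set \<Rightarrow> ('g \<Rightarrow> nat) \<Rightarrow> ('g \<Rightarrow> nat) \<Rightarrow> bool" where
  "occurs_in G A w y \<longleftrightarrow> (\<exists>h \<in> carrier G. \<forall>g \<in> A. y (g \<otimes>\<^bsub>G\<^esub> h) = w g)"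

definition words :: "('g, 'm) monoid_scheme \<Rightarrow> 'g set \<Rightarrow> ('g \<Rightarrow> nat) set \<Rightarrow> ('g \<Rightarrow> nat) set" where
  "words G A X = {w \<in> A \<rightarrow>\<^sub>E {0, 1}. \<exists>y \<in> X. occurs_in G A w y}"

text \<open>Entropy is a relation rather than a function, so that the existence of the limit and its
  independence of the Folner sequence are part of the assertion that the entropy equals \<open>c\<close>.
  It is meaningful for amenable groups only.\<close>

definition has_topological_entropy ::
  "('g, 'm) monoid_scheme \<Rightarrow> ('g \<Rightarrow> nat) set \<Rightarrow> real \<Rightarrow> bool" where
  "has_topological_entropy G X c \<longleftrightarrow>
     (\<forall>F. Folner_sequence G F \<longrightarrow>
        (\<lambda>n. ln (real (card (words G (F n) X))) / real (card (F n))) \<longlonglongrightarrow> c)"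

end

theory Submission
  imports Defs
begin

text \<open>The array is the itinerary of the identity of \<open>H\<close> through a window \<open>W\<close>: the entry at \<open>g\<close> is 1 iff
  \<open>\<tau> g \<in> W\<close>. Suppose that membership in \<open>W\<close> is locally constant off a closed set \<open>E\<close> that misses
  \<open>\<tau> ` carrier G\<close>, and that no right translation other than the identity preserves \<open>W\<close> off \<open>E\<close>.
  A point \<open>y\<close> of the orbit closure then has a unique phase \<open>\<xi>\<close>, with \<open>y h = 1\<close> iff \<open>\<tau> h \<xi> \<in> W\<close>
  whenever \<open>\<tau> h \<xi> \<notin> E\<close>. The phase is a factor map onto the rotation, and its fibre through the array
  is a singleton because \<open>E\<close> misses the dense subgroup. Rotating a common phase towards the identity
  drives two points of one fibre together, so every equicontinuous factor identifies them; hence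
  the rotation is the maximal equicontinuous factor (\<open>coded_array_almost_automorphic\<close>).

  The entropy is the size of \<open>E\<close> times \<open>ln 2\<close> (\<open>coded_array_entropy\<close>). Off a neighbourhood of \<open>E\<close> a
  word is determined by a point of a fixed finite net in \<open>H\<close>, so the visits to that neighbourhood
  bound the number of words from above. For the lower bound the window is made free along a closed
  set \<open>D \<subseteq> E\<close> of the same size: along any finite set of simultaneous visits to \<open>D\<close>, every nonzero
  pattern of zeros and ones occurs.

  Size is measured by an upper density: the infimum over finite \<open>F \<subseteq> G\<close> of the greatest
  frequency with which a point visits the set along \<open>F\<close>. It agrees with Haar measure on closed sets,
  but both entropy estimates hold for it almost by definition: every \<open>F\<close> has a point that attains at least the
  density, and along a Folner sequence the density bounds all points uniformly. Amenability makes it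
  subadditive, and compactness makes it continuous along decreasing sequences of closed sets.
  A right Folner set shows that disjoint closed sets cannot all be large, so all but countably many
  levels of a Lipschitz function have density 0. These facts yield a closed set \<open>D\<close> of any
  prescribed density below 1 that misses \<open>\<tau> ` carrier G\<close> (\<open>closed_set_of_density\<close>) and allow the
  boundaries of all balls in the construction of \<open>W\<close> to have density 0.

  The window (\<open>generic_window\<close>) is a union of small balls that accumulate only at \<open>D\<close>. There are
  countably many patterns to realize; the \<open>n\<close>-th one is realized by balls around points \<open>\<tau> (b g)\<close> in
  a thin shell around \<open>D\<close>, where \<open>g\<close> comes from the density of \<open>\<tau> ` carrier G\<close>. In every shell one
  ball is isolated, and the radii are so small that every short translation moves the centre of some
  isolated ball out of \<open>W\<close>. Long translations are excluded by a larger ball, no translate of which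
  can hide in the thin neighbourhood of \<open>D\<close>.\<close>

section \<open>Bi-invariant metrics\<close>

text \<open>Maximize an arbitrary compatible metric over all two-sided translates. Compactness makes the
  translates equicontinuous, which keeps the topology.\<close>

lemma compact_group_bi_invariant_metric:
  fixes H :: "('h, 'n) monoid_scheme"
  assumes tg: "topological_group H T" and comp: "compact_space T" and metr: "metrizable_space T"
  obtains d where "Metric_space (carrier H) d" "Metric_space.mtopology (carrier H) d = T"
    "\<And>a x y. \<lbrakk>a \<in> carrier H; x \<in> carrier H; y \<in> carrier H\<rbrakk> \<Longrightarrow> d (a \<otimes>\<^bsub>H\<^esub> x) (a \<otimes>\<^bsub>H\<^esub> y) = d x y"
    "\<And>a x y. \<lbrakk>a \<in> carrier H; x \<in> carrier H; y \<in> carrier H\<rbrakk> \<Longrightarrow> d (x \<otimes>\<^bsub>H\<^esub> a) (y \<otimes>\<^bsub>H\<^esub> a) = d x y"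
proof -
  have H: "group H" and top: "topspace T = carrier H"
    and mult: "continuous_map (prod_topology T T) T (\<lambda>(a, b). a \<otimes>\<^bsub>H\<^esub> b)"
    using tg by (auto simp: topological_group_def)
  interpret H: group H by fact
  obtain M d0 where "Metric_space M d0" "T = Metric_space.mtopology M d0"
    using metr by (auto simp: metrizable_space_def)
  moreover from this have "M = carrier H" using top by (simp add: Metric_space.topspace_mtopology)
  ultimately have d0: "Metric_space (carrier H) d0" and T: "T = Metric_space.mtopology (carrier H) d0"
    by auto
  interpret d0: Metric_space "carrier H" d0 by fact
  have comp0: "compactin d0.mtopology (carrier H)" using comp top T by (simp add: compact_space_def)
  obtain b where b: "\<And>x y. x \<in> carrier H \<Longrightarrow> y \<in> carrier H \<Longrightarrow> d0 x y \<le> b"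
    using d0.compactin_imp_mbounded[OF comp0] unfolding d0.mbounded_alt by blast
  define D where "D x y = (\<lambda>(p, q). d0 (p \<otimes>\<^bsub>H\<^esub> x \<otimes>\<^bsub>H\<^esub> q) (p \<otimes>\<^bsub>H\<^esub> y \<otimes>\<^bsub>H\<^esub> q)) ` (carrier H \<times> carrier H)" for x y
  \<comment> \<open>The guard keeps \<open>d\<close> nonnegative outside \<open>H\<close>, where the supremum may not exist.\<close>
  define d where "d x y = (if x \<in> carrier H \<and> y \<in> carrier H then Sup (D x y) else 0)" for x y
  have D_I: "d0 (p \<otimes>\<^bsub>H\<^esub> x \<otimes>\<^bsub>H\<^esub> q) (p \<otimes>\<^bsub>H\<^esub> y \<otimes>\<^bsub>H\<^esub> q) \<in> D x y" if "p \<in> carrier H" "q \<in> carrier H" for p q x y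
    unfolding D_def using that by (intro image_eqI[of _ _ "(p, q)"]) auto
  have D_ne: "D x y \<noteq> {}" for x y using D_I[OF H.one_closed H.one_closed] by blast
  have D_bdd: "bdd_above (D x y)" if "x \<in> carrier H" "y \<in> carrier H" for x y
    by (rule bdd_aboveI[of _ b]) (use that b in \<open>auto simp: D_def\<close>)
  have d_ge: "d0 (p \<otimes>\<^bsub>H\<^esub> x \<otimes>\<^bsub>H\<^esub> q) (p \<otimes>\<^bsub>H\<^esub> y \<otimes>\<^bsub>H\<^esub> q) \<le> d x y"
    if "p \<in> carrier H" "q \<in> carrier H" "x \<in> carrier H" "y \<in> carrier H" for p q x y
    using cSup_upper[OF D_I[OF that(1,2)] D_bdd[OF that(3,4)]] that by (simp add: d_def)
  have d_le: "d x y \<le> c" if "x \<in> carrier H" "y \<in> carrier H"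
      "\<And>p q. p \<in> carrier H \<Longrightarrow> q \<in> carrier H \<Longrightarrow> d0 (p \<otimes>\<^bsub>H\<^esub> x \<otimes>\<^bsub>H\<^esub> q) (p \<otimes>\<^bsub>H\<^esub> y \<otimes>\<^bsub>H\<^esub> q) \<le> c" for x y c
  proof -
    have "Sup (D x y) \<le> c" by (rule cSup_least[OF D_ne]) (use that(3) in \<open>auto simp: D_def\<close>)
    then show ?thesis using that by (simp add: d_def)
  qed
  have d0_le: "d0 x y \<le> d x y" if "x \<in> carrier H" "y \<in> carrier H" for x y
    using d_ge[OF H.one_closed H.one_closed that] that by simp
  have left: "d (a \<otimes>\<^bsub>H\<^esub> x) (a \<otimes>\<^bsub>H\<^esub> y) \<le> d x y"
    if "a \<in> carrier H" "x \<in> carrier H" "y \<in> carrier H" for a x y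
  proof (rule d_le)
    fix p q assume "p \<in> carrier H" "q \<in> carrier H"
    then show "d0 (p \<otimes>\<^bsub>H\<^esub> (a \<otimes>\<^bsub>H\<^esub> x) \<otimes>\<^bsub>H\<^esub> q) (p \<otimes>\<^bsub>H\<^esub> (a \<otimes>\<^bsub>H\<^esub> y) \<otimes>\<^bsub>H\<^esub> q) \<le> d x y"
      using d_ge[of "p \<otimes>\<^bsub>H\<^esub> a" q x y] that by (simp add: H.m_assoc)
  qed (use that in auto)
  have right: "d (x \<otimes>\<^bsub>H\<^esub> a) (y \<otimes>\<^bsub>H\<^esub> a) \<le> d x y"
    if "a \<in> carrier H" "x \<in> carrier H" "y \<in> carrier H" for a x y
  proof (rule d_le)
    fix p q assume "p \<in> carrier H" "q \<in> carrier H"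
    then show "d0 (p \<otimes>\<^bsub>H\<^esub> (x \<otimes>\<^bsub>H\<^esub> a) \<otimes>\<^bsub>H\<^esub> q) (p \<otimes>\<^bsub>H\<^esub> (y \<otimes>\<^bsub>H\<^esub> a) \<otimes>\<^bsub>H\<^esub> q) \<le> d x y"
      using d_ge[of p "a \<otimes>\<^bsub>H\<^esub> q" x y] that by (simp add: H.m_assoc)
  qed (use that in auto)
  have d: "Metric_space (carrier H) d"
  proof
    show "0 \<le> d x y" for x y
    proof (cases "x \<in> carrier H \<and> y \<in> carrier H")
      case True
      then show ?thesis using d0_le[of x y] d0.nonneg[of x y] by linarith
    qed (auto simp: d_def)
    show "d x y = d y x" for x y by (simp add: d_def D_def d0.commute)
    show "(d x y = 0) = (x = y)" if xy: "x \<in> carrier H" "y \<in> carrier H" for x y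
    proof
      assume "d x y = 0"
      then have "d0 x y = 0" using d0_le[OF xy] d0.nonneg[of x y] by linarith
      then show "x = y" using xy by simp
    next
      assume "x = y"
      then show "d x y = 0"
        using d_le[OF xy, of 0] d0_le[OF xy] d0.nonneg[of x y] xy by fastforce
    qed
    show "d x z \<le> d x y + d y z" if xyz: "x \<in> carrier H" "y \<in> carrier H" "z \<in> carrier H" for x y z
    proof (rule d_le[OF xyz(1,3)])
      fix p q assume pq: "p \<in> carrier H" "q \<in> carrier H"
      have "d0 (p \<otimes>\<^bsub>H\<^esub> x \<otimes>\<^bsub>H\<^esub> q) (p \<otimes>\<^bsub>H\<^esub> z \<otimes>\<^bsub>H\<^esub> q) \<le>
          d0 (p \<otimes>\<^bsub>H\<^esub> x \<otimes>\<^bsub>H\<^esub> q) (p \<otimes>\<^bsub>H\<^esub> y \<otimes>\<^bsub>H\<^esub> q) + d0 (p \<otimes>\<^bsub>H\<^esub> y \<otimes>\<^bsub>H\<^esub> q) (p \<otimes>\<^bsub>H\<^esub> z \<otimes>\<^bsub>H\<^esub> q)"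
        using pq xyz by (intro d0.triangle) auto
      also have "\<dots> \<le> d x y + d y z" using pq xyz by (intro add_mono d_ge)
      finally show "d0 (p \<otimes>\<^bsub>H\<^esub> x \<otimes>\<^bsub>H\<^esub> q) (p \<otimes>\<^bsub>H\<^esub> z \<otimes>\<^bsub>H\<^esub> q) \<le> d x y + d y z" .
    qed
  qed
  interpret d: Metric_space "carrier H" d by fact
  have mult_lim: "limitin T (\<lambda>n. f n \<otimes>\<^bsub>H\<^esub> g n) (x \<otimes>\<^bsub>H\<^esub> y) sequentially"
    if "limitin T f x sequentially" "limitin T g y sequentially" for f g :: "nat \<Rightarrow> 'h" and x y
  proof -
    have "limitin (prod_topology T T) (\<lambda>n. (f n, g n)) (x, y) sequentially"
      using that by (simp add: limitin_pairwise o_def)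
    from continuous_map_limit[OF mult this] show ?thesis by (simp add: o_def)
  qed
  have subseq: "\<exists>l r. l \<in> carrier H \<and> strict_mono (r :: nat \<Rightarrow> nat) \<and> limitin T (\<sigma> \<circ> r) l sequentially"
    if "\<And>n. \<sigma> n \<in> carrier H" for \<sigma> :: "nat \<Rightarrow> 'h"
    using comp0 that unfolding d0.compactin_sequentially T by (metis image_subsetI)
  have close: "\<exists>r'>0. \<forall>y\<in>carrier H. d0 x y < r' \<longrightarrow> d x y < r" if x: "x \<in> carrier H" and r: "r > 0" for x r
  proof (rule ccontr)
    assume contr: "\<not> ?thesis"
    have "\<exists>y p q. y \<in> carrier H \<and> p \<in> carrier H \<and> q \<in> carrier H \<and> d0 x y < 1 / real (Suc n) \<and>
        r / 2 < d0 (p \<otimes>\<^bsub>H\<^esub> x \<otimes>\<^bsub>H\<^esub> q) (p \<otimes>\<^bsub>H\<^esub> y \<otimes>\<^bsub>H\<^esub> q)" for n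
    proof -
      have "0 < 1 / real (Suc n)" by simp
      then obtain y where y: "y \<in> carrier H" "d0 x y < 1 / real (Suc n)" "\<not> d x y < r" using contr by blast
      then have "\<not> d x y \<le> r / 2" using r by simp
      then show ?thesis using d_le[OF x y(1), of "r/2"] y by (meson not_le)
    qed
    then obtain y p q where ypq: "\<And>n. y n \<in> carrier H" "\<And>n. p n \<in> carrier H" "\<And>n. q n \<in> carrier H"
      "\<And>n. d0 x (y n) < 1 / real (Suc n)"
      "\<And>n. r / 2 < d0 (p n \<otimes>\<^bsub>H\<^esub> x \<otimes>\<^bsub>H\<^esub> q n) (p n \<otimes>\<^bsub>H\<^esub> y n \<otimes>\<^bsub>H\<^esub> q n)" by metis
    obtain p' r1 where p': "p' \<in> carrier H" "strict_mono (r1 :: nat \<Rightarrow> nat)" "limitin T (p \<circ> r1) p' sequentially"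
      using subseq[of p] ypq(2) by blast
    obtain q' r2 where q': "q' \<in> carrier H" "strict_mono (r2 :: nat \<Rightarrow> nat)" "limitin T ((q \<circ> r1) \<circ> r2) q' sequentially"
      using subseq[of "q \<circ> r1"] ypq(3) by auto
    define s where "s n = r1 (r2 n)" for n
    have s: "strict_mono s" using strict_mono_o[OF p'(2) q'(2)] by (simp add: s_def[abs_def] o_def)
    have P: "limitin T (\<lambda>n. p (s n)) p' sequentially"
      using limitin_subsequence[OF q'(2) p'(3)] by (simp add: o_def s_def)
    have Q: "limitin T (\<lambda>n. q (s n)) q' sequentially" using q'(3) by (simp add: o_def s_def)
    have X: "limitin T (\<lambda>n. x) x sequentially" using x top by (simp add: limitin_const_iff)
    have Y0: "(\<lambda>n. d0 (y n) x) \<longlonglongrightarrow> 0"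
    proof (rule tendsto_sandwich[of "\<lambda>_. 0" _ _ "\<lambda>n. 1 / real (Suc n)"])
      show "(\<lambda>n. 1 / real (Suc n)) \<longlonglongrightarrow> 0" by real_asymp
    qed (auto intro!: always_eventually less_imp_le simp: d0.commute[of _ x] ypq(4) simp del: of_nat_Suc)
    have "limitin T y x sequentially"
      unfolding T d0.limitin_metric_dist_null using x ypq(1) Y0 by simp
    then have Y: "limitin T (\<lambda>n. y (s n)) x sequentially"
      using limitin_subsequence[OF s] by (simp add: o_def)
    have "limitin T (\<lambda>n. p (s n) \<otimes>\<^bsub>H\<^esub> x \<otimes>\<^bsub>H\<^esub> q (s n)) (p' \<otimes>\<^bsub>H\<^esub> x \<otimes>\<^bsub>H\<^esub> q') sequentially"
      "limitin T (\<lambda>n. p (s n) \<otimes>\<^bsub>H\<^esub> y (s n) \<otimes>\<^bsub>H\<^esub> q (s n)) (p' \<otimes>\<^bsub>H\<^esub> x \<otimes>\<^bsub>H\<^esub> q') sequentially"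
      by (intro mult_lim P Q X Y)+
    then have "(\<lambda>n. d0 (p (s n) \<otimes>\<^bsub>H\<^esub> x \<otimes>\<^bsub>H\<^esub> q (s n)) (p' \<otimes>\<^bsub>H\<^esub> x \<otimes>\<^bsub>H\<^esub> q')) \<longlonglongrightarrow> 0"
      "(\<lambda>n. d0 (p (s n) \<otimes>\<^bsub>H\<^esub> y (s n) \<otimes>\<^bsub>H\<^esub> q (s n)) (p' \<otimes>\<^bsub>H\<^esub> x \<otimes>\<^bsub>H\<^esub> q')) \<longlonglongrightarrow> 0"
      unfolding T d0.limitin_metric_dist_null by blast+
    then have "\<forall>\<^sub>F n in sequentially. d0 (p (s n) \<otimes>\<^bsub>H\<^esub> x \<otimes>\<^bsub>H\<^esub> q (s n)) (p' \<otimes>\<^bsub>H\<^esub> x \<otimes>\<^bsub>H\<^esub> q') < r / 4 \<and>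
        d0 (p (s n) \<otimes>\<^bsub>H\<^esub> y (s n) \<otimes>\<^bsub>H\<^esub> q (s n)) (p' \<otimes>\<^bsub>H\<^esub> x \<otimes>\<^bsub>H\<^esub> q') < r / 4"
      using r by (intro eventually_conj order_tendstoD(2)[where y = 0]) auto
    then obtain n where n: "d0 (p (s n) \<otimes>\<^bsub>H\<^esub> x \<otimes>\<^bsub>H\<^esub> q (s n)) (p' \<otimes>\<^bsub>H\<^esub> x \<otimes>\<^bsub>H\<^esub> q') < r / 4"
        "d0 (p (s n) \<otimes>\<^bsub>H\<^esub> y (s n) \<otimes>\<^bsub>H\<^esub> q (s n)) (p' \<otimes>\<^bsub>H\<^esub> x \<otimes>\<^bsub>H\<^esub> q') < r / 4"
      using eventually_happens sequentially_bot by blast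
    have "d0 (p (s n) \<otimes>\<^bsub>H\<^esub> x \<otimes>\<^bsub>H\<^esub> q (s n)) (p (s n) \<otimes>\<^bsub>H\<^esub> y (s n) \<otimes>\<^bsub>H\<^esub> q (s n)) \<le>
        d0 (p (s n) \<otimes>\<^bsub>H\<^esub> x \<otimes>\<^bsub>H\<^esub> q (s n)) (p' \<otimes>\<^bsub>H\<^esub> x \<otimes>\<^bsub>H\<^esub> q') + d0 (p' \<otimes>\<^bsub>H\<^esub> x \<otimes>\<^bsub>H\<^esub> q') (p (s n) \<otimes>\<^bsub>H\<^esub> y (s n) \<otimes>\<^bsub>H\<^esub> q (s n))"
      using x ypq(1-3) p' q' by (intro d0.triangle) auto
    then show False using n ypq(5)[of "s n"] by (simp add: d0.commute)
  qed
  have "openin d.mtopology U \<longleftrightarrow> openin d0.mtopology U" for U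
  proof
    assume U: "openin d.mtopology U"
    show "openin d0.mtopology U"
      unfolding d0.openin_mtopology
    proof (intro conjI allI impI)
      show "U \<subseteq> carrier H" using U by (simp add: d.openin_mtopology)
      fix x assume "x \<in> U"
      then have "x \<in> carrier H" "\<exists>r>0. d.mball x r \<subseteq> U" using U unfolding d.openin_mtopology by blast+
      then obtain r where r: "r > 0" "d.mball x r \<subseteq> U" "x \<in> carrier H" by blast
      then obtain r' where "r' > 0" "\<forall>y\<in>carrier H. d0 x y < r' \<longrightarrow> d x y < r" using close by blast
      then show "\<exists>r>0. d0.mball x r \<subseteq> U" using r by (intro exI[of _ r']) auto
    qed
  next
    assume U: "openin d0.mtopology U"
    show "openin d.mtopology U"
      unfolding d.openin_mtopology
    proof (intro conjI allI impI)
      show "U \<subseteq> carrier H" using U by (simp add: d0.openin_mtopology)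
      fix x assume "x \<in> U"
      then have "x \<in> carrier H" "\<exists>r>0. d0.mball x r \<subseteq> U" using U unfolding d0.openin_mtopology by blast+
      then obtain r where r: "r > 0" "d0.mball x r \<subseteq> U" "x \<in> carrier H" by blast
      have "d.mball x r \<subseteq> d0.mball x r"
      proof
        fix y assume "y \<in> d.mball x r"
        then show "y \<in> d0.mball x r" using d0_le[of x y] by simp
      qed
      then show "\<exists>r>0. d.mball x r \<subseteq> U" using r by blast
    qed
  qed
  then have "d.mtopology = T" unfolding T by (simp add: topology_eq)
  moreover have "d (a \<otimes>\<^bsub>H\<^esub> x) (a \<otimes>\<^bsub>H\<^esub> y) = d x y" if "a \<in> carrier H" "x \<in> carrier H" "y \<in> carrier H" for a x y
    using left[of "inv\<^bsub>H\<^esub> a" "a \<otimes>\<^bsub>H\<^esub> x" "a \<otimes>\<^bsub>H\<^esub> y"] left[OF that] that by (simp flip: H.m_assoc)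
  moreover have "d (x \<otimes>\<^bsub>H\<^esub> a) (y \<otimes>\<^bsub>H\<^esub> a) = d x y" if "a \<in> carrier H" "x \<in> carrier H" "y \<in> carrier H" for a x y
    using right[of "inv\<^bsub>H\<^esub> a" "x \<otimes>\<^bsub>H\<^esub> a" "y \<otimes>\<^bsub>H\<^esub> a"] right[OF that] that by (simp add: H.m_assoc)
  ultimately show thesis using that d by blast
qed

section \<open>Dense subgroups of a compact group with a bi-invariant metric\<close>

text \<open>With a bi-invariant metric every continuity statement about multiplication becomes an equality
  of distances, so no topology on the product is needed from here on.\<close>

locale compactified_group =
  G: group G + H: group H + Metric_space "carrier H" d
  for G :: "('g, 'm) monoid_scheme" and H :: "('h, 'n) monoid_scheme" and d :: "'h \<Rightarrow> 'h \<Rightarrow> real" +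
  fixes \<tau> :: "'g \<Rightarrow> 'h"
  assumes H_compact: "compact_space mtopology"
    and d_left: "\<lbrakk>a \<in> carrier H; x \<in> carrier H; y \<in> carrier H\<rbrakk> \<Longrightarrow> d (a \<otimes>\<^bsub>H\<^esub> x) (a \<otimes>\<^bsub>H\<^esub> y) = d x y"
    and d_right: "\<lbrakk>a \<in> carrier H; x \<in> carrier H; y \<in> carrier H\<rbrakk> \<Longrightarrow> d (x \<otimes>\<^bsub>H\<^esub> a) (y \<otimes>\<^bsub>H\<^esub> a) = d x y"
    and tau_hom: "\<tau> \<in> hom G H"
    and tau_inj: "inj_on \<tau> (carrier G)"
    and tau_dense: "\<lbrakk>\<xi> \<in> carrier H; e > 0\<rbrakk> \<Longrightarrow> \<exists>g\<in>carrier G. d (\<tau> g) \<xi> < e"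
    and G_countable: "countable (carrier G)"
    and G_infinite: "infinite (carrier G)"
    and G_amenable: "amenable G"
begin

lemma tau_closed [simp]: "g \<in> carrier G \<Longrightarrow> \<tau> g \<in> carrier H"
  using tau_hom by (auto simp: hom_def)

lemma tau_mult: "\<lbrakk>g \<in> carrier G; h \<in> carrier G\<rbrakk> \<Longrightarrow> \<tau> (g \<otimes>\<^bsub>G\<^esub> h) = \<tau> g \<otimes>\<^bsub>H\<^esub> \<tau> h"
  using tau_hom by (auto simp: hom_def)

lemma tau_one: "\<tau> \<one>\<^bsub>G\<^esub> = \<one>\<^bsub>H\<^esub>"
  using tau_hom G.is_group H.is_group by (simp add: hom_one)

lemma convergent_subsequence:
  fixes \<sigma> :: "nat \<Rightarrow> 'h"
  assumes "\<And>n. \<sigma> n \<in> carrier H"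
  obtains \<xi> r where "\<xi> \<in> carrier H" "strict_mono (r :: nat \<Rightarrow> nat)"
    "(\<lambda>n. d (\<sigma> (r n)) \<xi>) \<longlonglongrightarrow> 0"
proof -
  have "compactin mtopology (carrier H)"
    using H_compact by (simp add: compact_space_def)
  then obtain \<xi> r where *: "\<xi> \<in> carrier H" "strict_mono (r :: nat \<Rightarrow> nat)"
      "limitin mtopology (\<sigma> \<circ> r) \<xi> sequentially"
    using assms unfolding compactin_sequentially by (metis image_subsetI)
  then have "(\<lambda>n. d (\<sigma> (r n)) \<xi>) \<longlonglongrightarrow> 0"
    by (simp add: limitin_metric_dist_null o_def)
  then show thesis using that * by blast
qed

lemma finite_net:
  assumes "e > 0"
  obtains B where "finite B" "B \<subseteq> carrier G" "\<And>\<xi>. \<xi> \<in> carrier H \<Longrightarrow> \<exists>b\<in>B. d (\<tau> b) \<xi> < e"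
proof -
  have "mtotally_bounded (carrier H)"
    using H_compact by (intro compactin_imp_mtotally_bounded) (simp add: compact_space_def)
  then obtain K where K: "finite K" "K \<subseteq> carrier H" "carrier H \<subseteq> (\<Union>x\<in>K. mball x (e/2))"
    using assms unfolding mtotally_bounded_def by (metis half_gt_zero)
  have "\<exists>g\<in>carrier G. d (\<tau> g) k < e/2" if "k \<in> K" for k
    using tau_dense K that assms by (meson half_gt_zero subsetD)
  then obtain b where b: "\<And>k. k \<in> K \<Longrightarrow> b k \<in> carrier G \<and> d (\<tau> (b k)) k < e/2"
    by metis
  show thesis
  proof
    show "finite (b ` K)" "b ` K \<subseteq> carrier G" using K b by auto
    fix \<xi> assume \<xi>: "\<xi> \<in> carrier H"
    then obtain k where k: "k \<in> K" "d k \<xi> < e/2" using K by (auto simp: subset_iff)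
    have "d (\<tau> (b k)) \<xi> \<le> d (\<tau> (b k)) k + d k \<xi>" using k K b \<xi> by (intro triangle) auto
    then show "\<exists>b'\<in>b ` K. d (\<tau> b') \<xi> < e" using k b[OF k(1)] by force
  qed
qed

definition set_dist :: "'h set \<Rightarrow> 'h \<Rightarrow> real" where
  "set_dist A x = (INF a\<in>A. d a x)"

lemma set_dist_le: "a \<in> A \<Longrightarrow> set_dist A x \<le> d a x"
  unfolding set_dist_def by (intro cINF_lower) (auto intro!: bdd_belowI[of _ 0])

lemma set_dist_less_iff: "A \<noteq> {} \<Longrightarrow> set_dist A x < r \<longleftrightarrow> (\<exists>a\<in>A. d a x < r)"
  unfolding set_dist_def by (intro cINF_less_iff) (auto intro!: bdd_belowI[of _ 0])

lemma set_dist_nonneg: "A \<noteq> {} \<Longrightarrow> 0 \<le> set_dist A x"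
  unfolding set_dist_def by (intro cINF_greatest) auto

lemma set_dist_triangle:
  assumes "A \<noteq> {}" "A \<subseteq> carrier H" "x \<in> carrier H" "y \<in> carrier H"
  shows "set_dist A x \<le> set_dist A y + d x y"
proof (rule field_le_epsilon)
  fix e :: real assume "e > 0"
  then obtain a where a: "a \<in> A" "d a y < set_dist A y + e"
    using set_dist_less_iff[OF assms(1), of y "set_dist A y + e"] by auto
  have "d a x \<le> d a y + d y x" using a assms by (intro triangle) auto
  then show "set_dist A x \<le> set_dist A y + d x y + e"
    using a set_dist_le[OF a(1), of x] by (simp add: commute)
qed

lemma set_dist_lipschitz:
  assumes "A \<noteq> {}" "A \<subseteq> carrier H" "x \<in> carrier H" "y \<in> carrier H"
  shows "\<bar>set_dist A x - set_dist A y\<bar> \<le> d x y"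
  using set_dist_triangle[OF assms] set_dist_triangle[OF assms(1,2,4,3)] by (simp add: commute)

lemma set_dist_zero: "\<lbrakk>a \<in> A; a \<in> carrier H\<rbrakk> \<Longrightarrow> set_dist A a = 0"
  using set_dist_le[of a A a] set_dist_nonneg[of A a] by auto

lemma closed_positive_distance:
  assumes "closedin mtopology A" "x \<in> carrier H - A"
  obtains r where "r > 0" "\<And>y. y \<in> carrier H \<Longrightarrow> d y x < r \<Longrightarrow> y \<notin> A"
proof -
  obtain r where r: "r > 0" "disjnt A (mball x r)"
    using assms unfolding closedin_metric by blast
  show thesis
  proof
    show "r > 0" by fact
    show "y \<notin> A" if "y \<in> carrier H" "d y x < r" for y
      using that r assms by (auto simp: disjnt_iff commute)
  qed
qed

lemma set_dist_pos:
  assumes "closedin mtopology A" "A \<noteq> {}" "x \<in> carrier H - A"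
  shows "set_dist A x > 0"
proof -
  obtain r where r: "r > 0" "\<And>y. y \<in> carrier H \<Longrightarrow> d y x < r \<Longrightarrow> y \<notin> A"
    using closed_positive_distance[OF assms(1,3)] by metis
  have "\<not> set_dist A x < r"
    using r(2) set_dist_less_iff[OF assms(2)] closedin_subset[OF assms(1)] by auto
  then show ?thesis using r(1) by linarith
qed

lemma closedI:
  assumes "A \<subseteq> carrier H"
    and "\<And>x. x \<in> carrier H \<Longrightarrow> x \<notin> A \<Longrightarrow> \<exists>r>0. \<forall>y\<in>carrier H. d x y < r \<longrightarrow> y \<notin> A"
  shows "closedin mtopology A"
  unfolding closedin_metric disjnt_iff
proof (intro conjI ballI allI impI assms(1))
  fix x assume "x \<in> carrier H - A"
  then obtain r where "r > 0" "\<forall>y\<in>carrier H. d x y < r \<longrightarrow> y \<notin> A" using assms(2) by blast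
  then show "\<exists>r>0. \<forall>y. \<not> (y \<in> A \<and> y \<in> mball x r)" by (intro exI[of _ r]) auto
qed

lemma closed_sublevel:
  assumes "\<And>x y. x \<in> carrier H \<Longrightarrow> y \<in> carrier H \<Longrightarrow> \<bar>\<phi> x - \<phi> y\<bar> \<le> d x y"
  shows "closedin mtopology {x \<in> carrier H. \<phi> x \<le> (t::real)}"
proof (rule closedI)
  fix x assume x: "x \<in> carrier H" "x \<notin> {x \<in> carrier H. \<phi> x \<le> t}"
  have "y \<notin> {x \<in> carrier H. \<phi> x \<le> t}" if "y \<in> carrier H" "d x y < \<phi> x - t" for y
    using assms[of x y] that x by auto
  then show "\<exists>r>0. \<forall>y\<in>carrier H. d x y < r \<longrightarrow> y \<notin> {x \<in> carrier H. \<phi> x \<le> t}"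
    using x by (intro exI[of _ "\<phi> x - t"]) auto
qed auto

end

lemma finite_positive_lower_bound:
  assumes "finite A" "\<And>a. a \<in> A \<Longrightarrow> a > (0 :: real)"
  shows "\<exists>r>0. \<forall>a\<in>A. r < a"
proof (cases "A = {}")
  case False
  then have "Min A > 0" using assms by (meson Min_in)
  moreover have "Min A / 2 < a" if "a \<in> A" for a
  proof -
    have "Min A \<le> a" using that assms(1) by simp
    then show ?thesis using \<open>Min A > 0\<close> by linarith
  qed
  ultimately show ?thesis by (intro exI[of _ "Min A / 2"]) simp
qed (use zero_less_one in blast)

section \<open>Upper density of subsets of the compact group\<close>

context compactified_group
begin

definition visits :: "'g set \<Rightarrow> 'h set \<Rightarrow> 'h \<Rightarrow> nat" where
  "visits F A \<xi> = card {a \<in> F. \<tau> a \<otimes>\<^bsub>H\<^esub> \<xi> \<in> A}"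

definition upper_density :: "'h set \<Rightarrow> real" where
  "upper_density A =
     Inf {c. \<exists>F. finite F \<and> F \<noteq> {} \<and> F \<subseteq> carrier G \<and>
                 (\<forall>\<xi>\<in>carrier H. real (visits F A \<xi>) \<le> c * real (card F))}"

lemma visits_mono: "finite F \<Longrightarrow> A \<inter> carrier H \<subseteq> B \<Longrightarrow> F \<subseteq> carrier G \<Longrightarrow> \<xi> \<in> carrier H \<Longrightarrow>
    visits F A \<xi> \<le> visits F B \<xi>"
  unfolding visits_def
  by (intro card_mono) (simp, blast intro: H.m_closed tau_closed)

lemma visits_le_card: "finite F \<Longrightarrow> visits F A \<xi> \<le> card F"
  unfolding visits_def by (intro card_mono) auto

lemma visits_Un: "finite F \<Longrightarrow> visits F (A \<union> B) \<xi> \<le> visits F A \<xi> + visits F B \<xi>"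
proof -
  assume "finite F"
  have "{a \<in> F. \<tau> a \<otimes>\<^bsub>H\<^esub> \<xi> \<in> A \<union> B} = {a \<in> F. \<tau> a \<otimes>\<^bsub>H\<^esub> \<xi> \<in> A} \<union> {a \<in> F. \<tau> a \<otimes>\<^bsub>H\<^esub> \<xi> \<in> B}"
    by auto
  then show ?thesis unfolding visits_def by (simp add: card_Un_le)
qed

lemma density_set_nonneg:
  assumes "finite F" "F \<noteq> {}" "\<forall>\<xi>\<in>carrier H. real (visits F A \<xi>) \<le> c * real (card F)"
  shows "c \<ge> 0"
proof -
  have "0 \<le> c * real (card F)"
    using assms(3) H.one_closed by (meson of_nat_0_le_iff order_trans)
  then show ?thesis using assms(1,2) by (simp add: zero_le_mult_iff card_gt_0_iff)
qed

lemma upper_density_le: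
  assumes "finite F" "F \<noteq> {}" "F \<subseteq> carrier G"
    and "\<And>\<xi>. \<xi> \<in> carrier H \<Longrightarrow> real (visits F A \<xi>) \<le> c * real (card F)"
  shows "upper_density A \<le> c"
  unfolding upper_density_def
proof (rule cInf_lower)
  show "bdd_below {c. \<exists>F. finite F \<and> F \<noteq> {} \<and> F \<subseteq> carrier G \<and>
                 (\<forall>\<xi>\<in>carrier H. real (visits F A \<xi>) \<le> c * real (card F))}"
    by (rule bdd_belowI[of _ 0]) (use density_set_nonneg in blast)
qed (use assms in auto)

lemma upper_density_less:
  assumes "upper_density A < c"
  obtains F where "finite F" "F \<noteq> {}" "F \<subseteq> carrier G"
    "\<And>\<xi>. \<xi> \<in> carrier H \<Longrightarrow> real (visits F A \<xi>) \<le> c * real (card F)"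
proof -
  have ne: "{c. \<exists>F. finite F \<and> F \<noteq> {} \<and> F \<subseteq> carrier G \<and>
                 (\<forall>\<xi>\<in>carrier H. real (visits F A \<xi>) \<le> c * real (card F))} \<noteq> {}" (is "?S \<noteq> {}")
  proof -
    have "1 \<in> ?S"
      by (rule CollectI, rule exI[of _ "{\<one>\<^bsub>G\<^esub>}"])
        (use visits_le_card[of "{\<one>\<^bsub>G\<^esub>}" A] in simp)
    then show ?thesis by (rule ex_in_conv[THEN iffD1, OF exI])
  qed
  obtain c' where "c' \<in> ?S" "c' < c"
    using cInf_lessD[OF ne assms[unfolded upper_density_def]] by (elim bexE)
  then obtain F where F': "finite F \<and> F \<noteq> {} \<and> F \<subseteq> carrier G \<and>
      (\<forall>\<xi>\<in>carrier H. real (visits F A \<xi>) \<le> c' * real (card F))"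
    by (elim CollectE exE)
  then have F: "finite F" "F \<noteq> {}" "F \<subseteq> carrier G"
    "\<And>\<xi>. \<xi> \<in> carrier H \<Longrightarrow> real (visits F A \<xi>) \<le> c' * real (card F)" by auto
  have "real (visits F A \<xi>) \<le> c * real (card F)" if "\<xi> \<in> carrier H" for \<xi>
    using F(4)[OF that] \<open>c' < c\<close> by (meson less_imp_le mult_right_mono of_nat_0_le_iff order_trans)
  then show thesis using that F by blast
qed

text \<open>As the density is an infimum over all \<open>F\<close>, every single \<open>F\<close> has such a point, not only those far out in a
  Folner sequence. This is the source of the lower bound on the number of words.\<close>

lemma visits_attain_density:
  assumes F: "finite F" "F \<subseteq> carrier G"
  obtains \<xi> where "\<xi> \<in> carrier H" "upper_density A * real (card F) \<le> real (visits F A \<xi>)"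
proof (cases "F = {}")
  case True
  then show thesis using that[OF H.one_closed] by simp
next
  case False
  define m where "m = Max (visits F A ` carrier H)"
  have fin: "finite (visits F A ` carrier H)"
    by (rule finite_subset[of _ "{..card F}"]) (auto simp: F visits_le_card)
  then have "m \<in> visits F A ` carrier H" unfolding m_def by (intro Max_in) auto
  then obtain \<xi> where \<xi>: "\<xi> \<in> carrier H" "m = visits F A \<xi>" by auto
  have "upper_density A \<le> real m / real (card F)"
  proof (rule upper_density_le[OF F(1) False F(2)])
    fix \<eta> assume "\<eta> \<in> carrier H"
    then have "visits F A \<eta> \<le> m" unfolding m_def using fin by simp
    then show "real (visits F A \<eta>) \<le> real m / real (card F) * real (card F)"
      using F False by simp
  qed
  then show thesis using that \<xi> F False by (simp add: field_simps card_gt_0_iff)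
qed

lemma upper_density_mono:
  assumes "A \<inter> carrier H \<subseteq> B"
  shows "upper_density A \<le> upper_density B"
proof (rule dense_ge)
  fix c assume "upper_density B < c"
  then obtain F where F: "finite F" "F \<noteq> {}" "F \<subseteq> carrier G"
    "\<And>\<xi>. \<xi> \<in> carrier H \<Longrightarrow> real (visits F B \<xi>) \<le> c * real (card F)"
    by (rule upper_density_less) blast
  show "upper_density A \<le> c"
  proof (rule upper_density_le[OF F(1-3)])
    fix \<xi> assume "\<xi> \<in> carrier H"
    then show "real (visits F A \<xi>) \<le> c * real (card F)"
      using F(4)[of \<xi>] visits_mono[OF F(1) assms F(3)] by (meson of_nat_mono order_trans)
  qed
qed

lemma upper_density_nonneg: "0 \<le> upper_density A"
proof (rule dense_ge)
  fix c assume "upper_density A < c"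
  then show "0 \<le> c" using upper_density_less density_set_nonneg by metis
qed

lemma upper_density_empty: "upper_density {} = 0"
  using upper_density_le[of "{\<one>\<^bsub>G\<^esub>}" "{}" 0] upper_density_nonneg[of "{}"]
  by (auto simp: visits_def)

lemma upper_density_carrier: "upper_density (carrier H) = 1"
proof (rule antisym)
  show "upper_density (carrier H) \<le> 1"
    by (rule upper_density_le[of "{\<one>\<^bsub>G\<^esub>}"]) (use visits_le_card[of "{\<one>\<^bsub>G\<^esub>}"] in auto)
  show "1 \<le> upper_density (carrier H)"
  proof (rule dense_ge)
    fix c assume "upper_density (carrier H) < c"
    then obtain F where F: "finite F" "F \<noteq> {}" "F \<subseteq> carrier G"
      "\<And>\<xi>. \<xi> \<in> carrier H \<Longrightarrow> real (visits F (carrier H) \<xi>) \<le> c * real (card F)"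
      by (rule upper_density_less) blast
    have "{a \<in> F. \<tau> a \<otimes>\<^bsub>H\<^esub> \<one>\<^bsub>H\<^esub> \<in> carrier H} = F" using F(3) by auto
    then have "visits F (carrier H) \<one>\<^bsub>H\<^esub> = card F" by (simp add: visits_def)
    then have "real (card F) \<le> c * real (card F)" using F(4)[of "\<one>\<^bsub>H\<^esub>"] by simp
    then show "1 \<le> c" using F by (simp add: card_gt_0_iff)
  qed
qed

text \<open>If \<open>F\<close> witnesses that the density is below \<open>c\<close>, average the visits along \<open>\<Phi> n\<close> over its translates
  by \<open>a \<in> F\<close>. The translates differ little from \<open>\<Phi> n\<close>, and summing over \<open>a\<close> first counts, for each
  \<open>b \<in> \<Phi> n\<close>, the visits of \<open>\<tau> b \<xi>\<close> along \<open>F\<close>.\<close>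

lemma visits_uniform:
  assumes Fol: "Folner_sequence G \<Phi>" and c: "upper_density A < c"
  shows "\<forall>\<^sub>F n in sequentially. \<forall>\<xi>\<in>carrier H. real (visits (\<Phi> n) A \<xi>) \<le> c * real (card (\<Phi> n))"
proof -
  obtain c' where c': "upper_density A < c'" "c' < c" using c by (meson dense)
  obtain F where F: "finite F" "F \<noteq> {}" "F \<subseteq> carrier G"
    "\<And>\<xi>. \<xi> \<in> carrier H \<Longrightarrow> real (visits F A \<xi>) \<le> c' * real (card F)"
    using upper_density_less[OF c'(1)] by blast
  define s where "s n = (\<Sum>a\<in>F. real (card (sym_diff (a <#\<^bsub>G\<^esub> \<Phi> n) (\<Phi> n))) / real (card (\<Phi> n)))" for n
  have \<Phi>: "finite (\<Phi> n)" "\<Phi> n \<noteq> {}" "\<Phi> n \<subseteq> carrier G" for n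
    using Fol by (auto simp: Folner_sequence_def)
  have "s \<longlonglongrightarrow> (\<Sum>a\<in>F. 0)"
    unfolding s_def using Fol F(3) by (intro tendsto_sum) (auto simp: Folner_sequence_def)
  then have "\<forall>\<^sub>F n in sequentially. s n < c - c'"
    using c'(2) by (intro order_tendstoD(2)[where y = 0]) auto
  then show ?thesis
  proof (rule eventually_mono, intro ballI)
    fix n \<xi> assume s: "s n < c - c'" and \<xi>: "\<xi> \<in> carrier H"
    have card\<Phi>: "real (card (\<Phi> n)) > 0" using \<Phi> by (simp add: card_gt_0_iff)
    have one: "visits (\<Phi> n) A \<xi> \<le>
        card {b \<in> \<Phi> n. \<tau> a \<otimes>\<^bsub>H\<^esub> (\<tau> b \<otimes>\<^bsub>H\<^esub> \<xi>) \<in> A} + card (sym_diff (a <#\<^bsub>G\<^esub> \<Phi> n) (\<Phi> n))"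
      if a: "a \<in> F" for a
    proof -
      have aG: "a \<in> carrier G" using a F by auto
      have sub: "{c \<in> \<Phi> n. \<tau> c \<otimes>\<^bsub>H\<^esub> \<xi> \<in> A} \<subseteq>
          (\<lambda>b. a \<otimes>\<^bsub>G\<^esub> b) ` {b \<in> \<Phi> n. \<tau> a \<otimes>\<^bsub>H\<^esub> (\<tau> b \<otimes>\<^bsub>H\<^esub> \<xi>) \<in> A} \<union> sym_diff (a <#\<^bsub>G\<^esub> \<Phi> n) (\<Phi> n)"
        using \<Phi>(3)[of n] aG \<xi> by (auto simp: l_coset_def tau_mult H.m_assoc subset_iff)
      have fin: "finite (a <#\<^bsub>G\<^esub> \<Phi> n)" using \<Phi>(1) by (simp add: l_coset_def)
      have "visits (\<Phi> n) A \<xi> \<le> card ((\<lambda>b. a \<otimes>\<^bsub>G\<^esub> b) ` {b \<in> \<Phi> n. \<tau> a \<otimes>\<^bsub>H\<^esub> (\<tau> b \<otimes>\<^bsub>H\<^esub> \<xi>) \<in> A} \<union> sym_diff (a <#\<^bsub>G\<^esub> \<Phi> n) (\<Phi> n))"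
        unfolding visits_def using \<Phi>(1) fin by (intro card_mono sub) auto
      also have "\<dots> \<le> card ((\<lambda>b. a \<otimes>\<^bsub>G\<^esub> b) ` {b \<in> \<Phi> n. \<tau> a \<otimes>\<^bsub>H\<^esub> (\<tau> b \<otimes>\<^bsub>H\<^esub> \<xi>) \<in> A}) + card (sym_diff (a <#\<^bsub>G\<^esub> \<Phi> n) (\<Phi> n))"
        by (rule card_Un_le)
      also have "\<dots> \<le> card {b \<in> \<Phi> n. \<tau> a \<otimes>\<^bsub>H\<^esub> (\<tau> b \<otimes>\<^bsub>H\<^esub> \<xi>) \<in> A} + card (sym_diff (a <#\<^bsub>G\<^esub> \<Phi> n) (\<Phi> n))"
        using \<Phi>(1) by (intro add_right_mono card_image_le) auto
      finally show ?thesis .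
    qed
    have "real (card F) * real (visits (\<Phi> n) A \<xi>) = (\<Sum>a\<in>F. real (visits (\<Phi> n) A \<xi>))" by simp
    also have "\<dots> \<le> (\<Sum>a\<in>F. real (card {b \<in> \<Phi> n. \<tau> a \<otimes>\<^bsub>H\<^esub> (\<tau> b \<otimes>\<^bsub>H\<^esub> \<xi>) \<in> A}) + real (card (sym_diff (a <#\<^bsub>G\<^esub> \<Phi> n) (\<Phi> n))))"
      using one by (intro sum_mono) (simp flip: of_nat_add)
    also have "\<dots> = (\<Sum>a\<in>F. \<Sum>b\<in>\<Phi> n. of_bool (\<tau> a \<otimes>\<^bsub>H\<^esub> (\<tau> b \<otimes>\<^bsub>H\<^esub> \<xi>) \<in> A)) + s n * real (card (\<Phi> n))"
      using card\<Phi> \<Phi>(1,2) by (simp add: sum.distrib s_def sum_distrib_right Int_def of_bool_def sum.If_cases)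
    also have "(\<Sum>a\<in>F. \<Sum>b\<in>\<Phi> n. of_bool (\<tau> a \<otimes>\<^bsub>H\<^esub> (\<tau> b \<otimes>\<^bsub>H\<^esub> \<xi>) \<in> A)) =
        (\<Sum>b\<in>\<Phi> n. real (visits F A (\<tau> b \<otimes>\<^bsub>H\<^esub> \<xi>)))"
      using F(1) by (subst sum.swap) (simp add: visits_def Int_def of_bool_def sum.If_cases)
    also have "\<dots> \<le> (\<Sum>b\<in>\<Phi> n. c' * real (card F))"
      using \<Phi>(3)[of n] \<xi> by (intro sum_mono F(4)) auto
    also have "(\<Sum>b\<in>\<Phi> n. c' * real (card F)) + s n * real (card (\<Phi> n)) =
        (c' * real (card F) + s n) * real (card (\<Phi> n))" by (simp add: algebra_simps)
    also have "\<dots> \<le> (c * real (card F)) * real (card (\<Phi> n))"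
    proof (rule mult_right_mono)
      have "1 \<le> real (card F)" using F(1,2) by (simp add: Suc_le_eq card_gt_0_iff)
      then have "(c - c') * 1 \<le> (c - c') * real (card F)"
        using c'(2) by (intro mult_left_mono) auto
      then have "s n \<le> (c - c') * real (card F)" using s by (simp only: mult_1_right)
      then show "c' * real (card F) + s n \<le> c * real (card F)" by (simp add: algebra_simps)
    qed simp
    finally have "real (card F) * real (visits (\<Phi> n) A \<xi>) \<le> real (card F) * (c * real (card (\<Phi> n)))"
      by (simp add: algebra_simps)
    then show "real (visits (\<Phi> n) A \<xi>) \<le> c * real (card (\<Phi> n))"
      using F(1,2) by (simp add: card_gt_0_iff)
  qed
qed

lemma upper_density_Un: "upper_density (A \<union> B) \<le> upper_density A + upper_density B"
proof (rule field_le_epsilon)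
  fix e :: real assume "e > 0"
  obtain \<Phi> where \<Phi>: "Folner_sequence G \<Phi>" using G_amenable by (auto simp: amenable_def)
  have "\<forall>\<^sub>F n in sequentially. (\<forall>\<xi>\<in>carrier H. real (visits (\<Phi> n) A \<xi>) \<le> (upper_density A + e/2) * real (card (\<Phi> n))) \<and>
      (\<forall>\<xi>\<in>carrier H. real (visits (\<Phi> n) B \<xi>) \<le> (upper_density B + e/2) * real (card (\<Phi> n)))"
    using \<open>e > 0\<close> by (intro eventually_conj visits_uniform[OF \<Phi>]) auto
  then obtain n where n: "\<forall>\<xi>\<in>carrier H. real (visits (\<Phi> n) A \<xi>) \<le> (upper_density A + e/2) * real (card (\<Phi> n))"
      "\<forall>\<xi>\<in>carrier H. real (visits (\<Phi> n) B \<xi>) \<le> (upper_density B + e/2) * real (card (\<Phi> n))"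
    using eventually_happens sequentially_bot by blast
  show "upper_density (A \<union> B) \<le> upper_density A + upper_density B + e"
  proof (rule upper_density_le[of "\<Phi> n"])
    show "finite (\<Phi> n)" "\<Phi> n \<noteq> {}" "\<Phi> n \<subseteq> carrier G" using \<Phi> by (auto simp: Folner_sequence_def)
    fix \<xi> assume \<xi>: "\<xi> \<in> carrier H"
    have "real (visits (\<Phi> n) (A \<union> B) \<xi>) \<le> real (visits (\<Phi> n) A \<xi>) + real (visits (\<Phi> n) B \<xi>)"
      using visits_Un[OF \<open>finite (\<Phi> n)\<close>] by (simp flip: of_nat_add)
    also have "\<dots> \<le> (upper_density A + e/2) * real (card (\<Phi> n)) + (upper_density B + e/2) * real (card (\<Phi> n))"
      using n \<xi> by (intro add_mono) auto
    finally show "real (visits (\<Phi> n) (A \<union> B) \<xi>) \<le> (upper_density A + upper_density B + e) * real (card (\<Phi> n))"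
      by (simp add: algebra_simps)
  qed
qed

lemma upper_density_UN:
  "finite I \<Longrightarrow> upper_density (\<Union>i\<in>I. A i) \<le> (\<Sum>i\<in>I. upper_density (A i))"
proof (induction I rule: finite_induct)
  case (insert i I)
  then show ?case using upper_density_Un[of "A i" "\<Union>i\<in>I. A i"] by simp
qed (simp add: upper_density_empty)

text \<open>For a fixed \<open>F\<close>, points that visit \<open>A n\<close> too often would accumulate at a point that visits the
  intersection too often.\<close>

lemma upper_density_decreasing:
  fixes A :: "nat \<Rightarrow> 'h set"
  assumes closed: "\<And>n. closedin mtopology (A n)" and dec: "\<And>m n. m \<le> n \<Longrightarrow> A n \<subseteq> A m"
    and c: "upper_density (\<Inter>n. A n) < c"
  obtains n where "upper_density (A n) \<le> c"
proof -
  obtain F where F: "finite F" "F \<noteq> {}" "F \<subseteq> carrier G"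
    "\<And>\<xi>. \<xi> \<in> carrier H \<Longrightarrow> real (visits F (\<Inter>n. A n) \<xi>) \<le> c * real (card F)"
    using upper_density_less[OF c] by blast
  have "\<exists>n. upper_density (A n) \<le> c"
  proof (rule ccontr)
    assume contr: "\<nexists>n. upper_density (A n) \<le> c"
    have "\<exists>\<xi>\<in>carrier H. real (visits F (A n) \<xi>) > c * real (card F)" for n
      using upper_density_le[OF F(1-3), of "A n" c] contr by (meson not_le)
    then obtain \<sigma> where \<sigma>: "\<And>n. \<sigma> n \<in> carrier H" "\<And>n. real (visits F (A n) (\<sigma> n)) > c * real (card F)"
      by metis
    obtain \<xi> r where \<xi>: "\<xi> \<in> carrier H" and r: "strict_mono (r :: nat \<Rightarrow> nat)"
      and lim: "(\<lambda>n. d (\<sigma> (r n)) \<xi>) \<longlonglongrightarrow> 0"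
      using convergent_subsequence \<sigma>(1) by metis
    have "\<forall>\<^sub>F n in sequentially. \<tau> a \<otimes>\<^bsub>H\<^esub> \<sigma> (r n) \<in> A (r n) \<longrightarrow> \<tau> a \<otimes>\<^bsub>H\<^esub> \<xi> \<in> (\<Inter>n. A n)" if a: "a \<in> F" for a
    proof (cases "\<tau> a \<otimes>\<^bsub>H\<^esub> \<xi> \<in> (\<Inter>n. A n)")
      case False
      have aG: "a \<in> carrier G" using a F by auto
      obtain m where m: "\<tau> a \<otimes>\<^bsub>H\<^esub> \<xi> \<notin> A m" using False by auto
      obtain e where e: "e > 0" "\<And>y. y \<in> carrier H \<Longrightarrow> d y (\<tau> a \<otimes>\<^bsub>H\<^esub> \<xi>) < e \<Longrightarrow> y \<notin> A m"
        using closed_positive_distance[OF closed, of "\<tau> a \<otimes>\<^bsub>H\<^esub> \<xi>" m] m aG \<xi> by auto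
      have "\<forall>\<^sub>F n in sequentially. d (\<sigma> (r n)) \<xi> < e \<and> m \<le> n"
        using order_tendstoD(2)[OF lim e(1)] eventually_ge_at_top[of m] by eventually_elim auto
      then show ?thesis
      proof eventually_elim
        case (elim n)
        then have "\<tau> a \<otimes>\<^bsub>H\<^esub> \<sigma> (r n) \<notin> A m" using aG \<xi> \<sigma>(1) by (intro e(2)) (auto simp: d_left)
        moreover have "A (r n) \<subseteq> A m" using elim seq_suble[OF r, of n] by (intro dec) linarith
        ultimately show ?case by auto
      qed
    qed simp
    then have "\<forall>\<^sub>F n in sequentially. \<forall>a\<in>F. \<tau> a \<otimes>\<^bsub>H\<^esub> \<sigma> (r n) \<in> A (r n) \<longrightarrow> \<tau> a \<otimes>\<^bsub>H\<^esub> \<xi> \<in> (\<Inter>n. A n)"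
      using F(1) by (intro eventually_ball_finite) auto
    then obtain n where "\<forall>a\<in>F. \<tau> a \<otimes>\<^bsub>H\<^esub> \<sigma> (r n) \<in> A (r n) \<longrightarrow> \<tau> a \<otimes>\<^bsub>H\<^esub> \<xi> \<in> (\<Inter>n. A n)"
      using eventually_happens sequentially_bot by blast
    then have "visits F (A (r n)) (\<sigma> (r n)) \<le> visits F (\<Inter>n. A n) \<xi>"
      unfolding visits_def using F(1) by (intro card_mono) auto
    then show False using \<sigma>(2)[of "r n"] F(4)[OF \<xi>] by linarith
  qed
  then show thesis using that by blast
qed

text \<open>Finitely many elements of \<open>\<tau> ` carrier G\<close> are separated by some distance \<open>s\<close>. By right invariance
  so are their translates by \<open>\<xi>\<close>, hence at most one of these falls in a ball of radius \<open>s/2\<close>.\<close>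

lemma small_balls:
  assumes "e > 0"
  obtains r where "r > 0" "\<And>p. p \<in> carrier H \<Longrightarrow> upper_density (mcball p r) \<le> e"
proof -
  obtain k :: nat where k: "1 / e \<le> real k" using real_arch_simple by blast
  obtain F where F: "finite F" "card F = Suc k" "F \<subseteq> carrier G"
    using infinite_arbitrarily_large[OF G_infinite] by metis
  have "finite ((\<lambda>(a, b). d (\<tau> a) (\<tau> b)) ` {(a, b) \<in> F \<times> F. a \<noteq> b})" (is "finite ?D")
    by (rule finite_imageI, rule finite_subset[of _ "F \<times> F"]) (use F in auto)
  moreover have "x > 0" if "x \<in> ?D" for x
    using that F tau_inj by (auto simp: subset_iff inj_on_def)
  ultimately have "\<exists>r>0. \<forall>x\<in>?D. r < x" by (rule finite_positive_lower_bound)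
  then obtain s where "s > 0 \<and> (\<forall>x\<in>?D. s < x)" by (rule exE)
  then have s: "s > 0" "\<And>a b. a \<in> F \<Longrightarrow> b \<in> F \<Longrightarrow> a \<noteq> b \<Longrightarrow> s < d (\<tau> a) (\<tau> b)"
    by auto
  show thesis
  proof
    show "s / 2 > 0" using s by simp
    fix p assume p: "p \<in> carrier H"
    show "upper_density (mcball p (s/2)) \<le> e"
    proof (rule upper_density_le[OF F(1) _ F(3)])
      show "F \<noteq> {}" using F by auto
      fix \<xi> assume \<xi>: "\<xi> \<in> carrier H"
      have "a = b" if "a \<in> F" "b \<in> F" "\<tau> a \<otimes>\<^bsub>H\<^esub> \<xi> \<in> mcball p (s/2)" "\<tau> b \<otimes>\<^bsub>H\<^esub> \<xi> \<in> mcball p (s/2)" for a b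
      proof (rule ccontr)
        assume "a \<noteq> b"
        then have "s < d (\<tau> a) (\<tau> b)" using that by (intro s(2)) auto
        also have "d (\<tau> a) (\<tau> b) = d (\<tau> a \<otimes>\<^bsub>H\<^esub> \<xi>) (\<tau> b \<otimes>\<^bsub>H\<^esub> \<xi>)"
          using that F(3) \<xi> by (subst d_right) auto
        also have "\<dots> \<le> d (\<tau> a \<otimes>\<^bsub>H\<^esub> \<xi>) p + d p (\<tau> b \<otimes>\<^bsub>H\<^esub> \<xi>)" using that p by (intro triangle) auto
        also have "\<dots> \<le> s" using that by (simp add: commute)
        finally show False by simp
      qed
      then have "visits F (mcball p (s/2)) \<xi> \<le> 1"
        unfolding visits_def by (subst card_le_Suc0_iff_eq[unfolded One_nat_def[symmetric]]) (use F in auto)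
      moreover have "1 \<le> e * real (card F)" using k assms F(2) by (simp add: field_simps)
      ultimately show "real (visits F (mcball p (s/2)) \<xi>) \<le> e * real (card F)" by linarith
    qed
  qed
qed

text \<open>Inversion exchanges the two sides, so the inverse of a left Folner set is right Folner.\<close>

lemma right_Folner_set:
  assumes "finite B" "B \<subseteq> carrier G" "e > 0"
  obtains F where "finite F" "F \<noteq> {}" "F \<subseteq> carrier G"
    "\<And>b. b \<in> B \<Longrightarrow> real (card ((\<lambda>f. f \<otimes>\<^bsub>G\<^esub> b) ` F - F)) \<le> e * real (card F)"
proof -
  obtain \<Phi> where Fol: "Folner_sequence G \<Phi>" using G_amenable by (auto simp: amenable_def)
  have \<Phi>: "finite (\<Phi> n)" "\<Phi> n \<noteq> {}" "\<Phi> n \<subseteq> carrier G" for n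
    using Fol by (auto simp: Folner_sequence_def)
  have "\<forall>\<^sub>F n in sequentially. \<forall>b\<in>B. real (card (sym_diff (inv\<^bsub>G\<^esub> b <#\<^bsub>G\<^esub> \<Phi> n) (\<Phi> n))) / real (card (\<Phi> n)) < e"
    using assms Fol unfolding Folner_sequence_def
    by (intro eventually_ball_finite ballI order_tendstoD(2)[where y = 0]) auto
  then obtain n where n: "\<forall>b\<in>B. real (card (sym_diff (inv\<^bsub>G\<^esub> b <#\<^bsub>G\<^esub> \<Phi> n) (\<Phi> n))) / real (card (\<Phi> n)) < e"
    using eventually_happens sequentially_bot by blast
  define F where "F = (\<lambda>f. inv\<^bsub>G\<^esub> f) ` \<Phi> n"
  have cardF: "card F = card (\<Phi> n)"
    unfolding F_def using \<Phi>(3) by (intro card_image inj_onI) (metis G.inv_inv subsetD)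
  show thesis
  proof
    show "finite F" "F \<noteq> {}" "F \<subseteq> carrier G" using \<Phi>(1,2)[of n] \<Phi>(3)[of n] by (auto simp: F_def)
    fix b assume b: "b \<in> B"
    then have bG: "b \<in> carrier G" using assms by auto
    have "(\<lambda>f. f \<otimes>\<^bsub>G\<^esub> b) ` F - F \<subseteq> (\<lambda>f. inv\<^bsub>G\<^esub> f) ` (sym_diff (inv\<^bsub>G\<^esub> b <#\<^bsub>G\<^esub> \<Phi> n) (\<Phi> n))"
    proof
      fix x assume x: "x \<in> (\<lambda>f. f \<otimes>\<^bsub>G\<^esub> b) ` F - F"
      then obtain f where f: "f \<in> \<Phi> n" "x = inv\<^bsub>G\<^esub> f \<otimes>\<^bsub>G\<^esub> b" by (auto simp: F_def)
      have fG: "f \<in> carrier G" using f \<Phi>(3) by auto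
      have "x = inv\<^bsub>G\<^esub> (inv\<^bsub>G\<^esub> b \<otimes>\<^bsub>G\<^esub> f)" using f fG bG by (simp add: G.inv_mult_group)
      moreover from this have "inv\<^bsub>G\<^esub> b \<otimes>\<^bsub>G\<^esub> f \<notin> \<Phi> n" using x by (auto simp: F_def)
      moreover have "inv\<^bsub>G\<^esub> b \<otimes>\<^bsub>G\<^esub> f \<in> inv\<^bsub>G\<^esub> b <#\<^bsub>G\<^esub> \<Phi> n" using f by (auto simp: l_coset_def)
      ultimately show "x \<in> (\<lambda>f. inv\<^bsub>G\<^esub> f) ` (sym_diff (inv\<^bsub>G\<^esub> b <#\<^bsub>G\<^esub> \<Phi> n) (\<Phi> n))" by blast
    qed
    then have "card ((\<lambda>f. f \<otimes>\<^bsub>G\<^esub> b) ` F - F) \<le> card (sym_diff (inv\<^bsub>G\<^esub> b <#\<^bsub>G\<^esub> \<Phi> n) (\<Phi> n))"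
      using \<Phi>(1) by (intro surj_card_le) (auto simp: l_coset_def)
    moreover have "real (card (sym_diff (inv\<^bsub>G\<^esub> b <#\<^bsub>G\<^esub> \<Phi> n) (\<Phi> n))) \<le> e * real (card F)"
      using n b \<Phi>(1,2)[of n] by (auto simp: cardF field_simps card_gt_0_iff intro: less_imp_le)
    ultimately show "real (card ((\<lambda>f. f \<otimes>\<^bsub>G\<^esub> b) ` F - F)) \<le> e * real (card F)" by linarith
  qed
qed

text \<open>The points that often visit the various levels depend on the level. If \<open>F\<close> is nearly invariant
  under right multiplication by a finite net \<open>B\<close>, each of them can be replaced by some \<open>\<tau> b\<close> and then by
  the identity of \<open>H\<close>, whose visits to neighbourhoods of distinct levels are disjoint subsets of \<open>F\<close>.\<close>

lemma few_dense_levels: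
  assumes lip: "\<And>x y. x \<in> carrier H \<Longrightarrow> y \<in> carrier H \<Longrightarrow> \<bar>\<phi> x - \<phi> y\<bar> \<le> d x y"
    and S: "finite S" and c: "c > 0"
    and dens: "\<And>t. t \<in> S \<Longrightarrow> c \<le> upper_density {x \<in> carrier H. \<phi> x = (t::real)}"
  shows "real (card S) * c \<le> 2"
proof -
  have "finite ((\<lambda>(s, t). \<bar>s - t\<bar>) ` {(s, t) \<in> S \<times> S. s \<noteq> t})" (is "finite ?D")
    by (rule finite_imageI, rule finite_subset[of _ "S \<times> S"]) (use S in auto)
  moreover have "x > 0" if "x \<in> ?D" for x using that by auto
  ultimately have "\<exists>r>0. \<forall>x\<in>?D. r < x" by (rule finite_positive_lower_bound)
  then obtain r' where "r' > 0 \<and> (\<forall>x\<in>?D. r' < x)" by (rule exE)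
  then have r': "r' > 0" "\<And>s t. s \<in> S \<Longrightarrow> t \<in> S \<Longrightarrow> s \<noteq> t \<Longrightarrow> r' < \<bar>s - t\<bar>"
    by auto
  define r where "r = r' / 2"
  have r: "r > 0" "\<And>s t. s \<in> S \<Longrightarrow> t \<in> S \<Longrightarrow> s \<noteq> t \<Longrightarrow> 2 * r < \<bar>s - t\<bar>"
    using r' unfolding r_def by auto
  obtain B where B: "finite B" "B \<subseteq> carrier G" "\<And>\<xi>. \<xi> \<in> carrier H \<Longrightarrow> \<exists>b\<in>B. d (\<tau> b) \<xi> < r"
    using finite_net[OF r(1)] by blast
  obtain F where F: "finite F" "F \<noteq> {}" "F \<subseteq> carrier G"
    "\<And>b. b \<in> B \<Longrightarrow> real (card ((\<lambda>f. f \<otimes>\<^bsub>G\<^esub> b) ` F - F)) \<le> (c/2) * real (card F)"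
    using right_Folner_set[OF B(1,2), of "c/2"] c by auto
  define N where "N t = {f \<in> F. \<bar>\<phi> (\<tau> f) - t\<bar> < r}" for t
  have N: "(c/2) * real (card F) \<le> real (card (N t))" if t: "t \<in> S" for t
  proof -
    let ?L = "{x \<in> carrier H. \<phi> x = t}"
    obtain \<xi> where \<xi>: "\<xi> \<in> carrier H" "upper_density ?L * real (card F) \<le> real (visits F ?L \<xi>)"
      using visits_attain_density[OF F(1,3)] by blast
    obtain b where b: "b \<in> B" "d (\<tau> b) \<xi> < r" using B(3) \<xi>(1) by blast
    have bG: "b \<in> carrier G" using b B by auto
    have "(\<lambda>f. f \<otimes>\<^bsub>G\<^esub> b) ` {a \<in> F. \<tau> a \<otimes>\<^bsub>H\<^esub> \<xi> \<in> ?L} \<subseteq> N t \<union> ((\<lambda>f. f \<otimes>\<^bsub>G\<^esub> b) ` F - F)"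
    proof
      fix c assume "c \<in> (\<lambda>f. f \<otimes>\<^bsub>G\<^esub> b) ` {a \<in> F. \<tau> a \<otimes>\<^bsub>H\<^esub> \<xi> \<in> ?L}"
      then obtain a where a: "a \<in> F" "\<phi> (\<tau> a \<otimes>\<^bsub>H\<^esub> \<xi>) = t" "c = a \<otimes>\<^bsub>G\<^esub> b" by auto
      have aG: "a \<in> carrier G" using a F by auto
      have "\<bar>\<phi> (\<tau> (a \<otimes>\<^bsub>G\<^esub> b)) - \<phi> (\<tau> a \<otimes>\<^bsub>H\<^esub> \<xi>)\<bar> \<le> d (\<tau> (a \<otimes>\<^bsub>G\<^esub> b)) (\<tau> a \<otimes>\<^bsub>H\<^esub> \<xi>)"
        using aG bG \<xi> by (intro lip) auto
      also have "\<dots> = d (\<tau> b) \<xi>" using aG bG \<xi> by (simp add: tau_mult d_left)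
      finally show "c \<in> N t \<union> ((\<lambda>f. f \<otimes>\<^bsub>G\<^esub> b) ` F - F)" using b a by (auto simp: N_def)
    qed
    then have "card ((\<lambda>f. f \<otimes>\<^bsub>G\<^esub> b) ` {a \<in> F. \<tau> a \<otimes>\<^bsub>H\<^esub> \<xi> \<in> ?L}) \<le> card (N t \<union> ((\<lambda>f. f \<otimes>\<^bsub>G\<^esub> b) ` F - F))"
      using F(1) by (intro card_mono) (auto simp: N_def)
    moreover have "card ((\<lambda>f. f \<otimes>\<^bsub>G\<^esub> b) ` {a \<in> F. \<tau> a \<otimes>\<^bsub>H\<^esub> \<xi> \<in> ?L}) = visits F ?L \<xi>"
      unfolding visits_def using F(3) bG by (intro card_image inj_onI) (auto simp: subset_iff)
    moreover have "card (N t \<union> ((\<lambda>f. f \<otimes>\<^bsub>G\<^esub> b) ` F - F)) \<le> card (N t) + card ((\<lambda>f. f \<otimes>\<^bsub>G\<^esub> b) ` F - F)"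
      by (rule card_Un_le)
    ultimately have "real (visits F ?L \<xi>) \<le> real (card (N t)) + (c/2) * real (card F)"
      using F(4)[OF b(1)] by linarith
    moreover have "c * real (card F) \<le> upper_density ?L * real (card F)"
      using dens[OF t] by (intro mult_right_mono) auto
    ultimately show ?thesis using \<xi>(2) by (simp add: field_simps)
  qed
  have "real (card S) * ((c/2) * real (card F)) \<le> (\<Sum>t\<in>S. real (card (N t)))"
    using sum_mono[of S "\<lambda>_. (c/2) * real (card F)" "\<lambda>t. real (card (N t))"] N by simp
  also have "\<dots> = real (card (\<Union>t\<in>S. N t))"
  proof -
    have "N s \<inter> N t = {}" if "s \<in> S" "t \<in> S" "s \<noteq> t" for s t
      using r(2)[OF that] by (fastforce simp: N_def)
    then show ?thesis using S F(1) by (subst card_UN_disjoint) (auto simp: N_def)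
  qed
  also have "\<dots> \<le> real (card F)" using F(1) by (intro of_nat_mono card_mono) (auto simp: N_def)
  finally show ?thesis using F(1,2) by (simp add: card_gt_0_iff)
qed

text \<open>The supply of radii for the balls of the window.\<close>

lemma null_level:
  assumes lip: "\<And>x y. x \<in> carrier H \<Longrightarrow> y \<in> carrier H \<Longrightarrow> \<bar>\<phi> x - \<phi> y\<bar> \<le> d x y"
    and "a < b"
  obtains t :: real where "a < t" "t < b" "upper_density {x \<in> carrier H. \<phi> x = t} = 0"
    "\<And>g. g \<in> carrier G \<Longrightarrow> \<phi> (\<tau> g) \<noteq> t"
proof -
  define L where "L t = {x \<in> carrier H. \<phi> x = t}" for t
  define T where "T k = {t. upper_density (L t) \<ge> 1 / real (Suc k)}" for k
  have "finite (T k)" for k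
  proof (rule ccontr)
    assume "infinite (T k)"
    then obtain S where S: "S \<subseteq> T k" "finite S" "card S = 2 * Suc k + 1"
      using infinite_arbitrarily_large by metis
    have "real (card S) * (1 / real (Suc k)) \<le> 2"
      by (rule few_dense_levels[OF lip S(2)]) (use S(1) in \<open>auto simp: T_def L_def\<close>)
    then show False using S(3) by (simp add: field_simps)
  qed
  then have "countable ((\<Union>k. T k) \<union> (\<lambda>g. \<phi> (\<tau> g)) ` carrier G)"
    using G_countable by (auto intro: countable_finite)
  then have "\<not> {a<..<b} \<subseteq> (\<Union>k. T k) \<union> (\<lambda>g. \<phi> (\<tau> g)) ` carrier G"
    using uncountable_open_interval[of a b] assms(2) countable_subset by blast
  then obtain t where t: "a < t" "t < b" "\<And>k. t \<notin> T k" "t \<notin> (\<lambda>g. \<phi> (\<tau> g)) ` carrier G"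
    by fastforce
  have "upper_density (L t) \<le> 0"
  proof (rule ccontr)
    assume "\<not> upper_density (L t) \<le> 0"
    then obtain k where "1 / real (Suc k) < upper_density (L t)"
      using nat_approx_posE[of "upper_density (L t)"] by auto
    then show False using t(3)[of k] by (simp add: T_def)
  qed
  then show thesis using that t upper_density_nonneg[of "L t"] by (auto simp: L_def)
qed

section \<open>Closed sets of prescribed density that avoid the dense subgroup\<close>

lemma closed_singleton: "p \<in> carrier H \<Longrightarrow> closedin mtopology {p}"
proof (rule closedI)
  fix x assume "p \<in> carrier H" "x \<in> carrier H" "x \<notin> {p}"
  then show "\<exists>r>0. \<forall>y\<in>carrier H. d x y < r \<longrightarrow> y \<notin> {p}" by (intro exI[of _ "d x p"]) auto
qed auto

lemma upper_density_singleton: "p \<in> carrier H \<Longrightarrow> upper_density {p} = 0"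
proof (rule antisym[OF field_le_epsilon upper_density_nonneg])
  fix e :: real assume p: "p \<in> carrier H" and "e > 0"
  then obtain r where r: "r > 0" "\<And>p. p \<in> carrier H \<Longrightarrow> upper_density (mcball p r) \<le> e"
    using small_balls by blast
  have "upper_density {p} \<le> upper_density (mcball p r)"
    using p r(1) by (intro upper_density_mono) auto
  then show "upper_density {p} \<le> 0 + e" using r(2)[OF p] by simp
qed

text \<open>Remove small open balls around the countably many points of the subgroup, with densities that
  sum to at most \<open>\<eta>\<close>. The removed set is open and dense, so its own upper density is 1: the estimate
  has to be made for finitely many balls and passed to the limit of the closed complements.\<close>

lemma dense_closed_avoiding:
  assumes "\<eta> > 0"
  obtains K where "closedin mtopology K" "K \<inter> \<tau> ` carrier G = {}" "1 - \<eta> \<le> upper_density K"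
proof -
  define e where "e = from_nat_into (carrier G)"
  have e: "e n \<in> carrier G" for n
    unfolding e_def using G.one_closed by (intro from_nat_into) auto
  have "\<exists>r>0. upper_density (mcball (\<tau> (e n)) r) \<le> \<eta> * (1/2) ^ Suc n" for n
    using small_balls[of "\<eta> * (1/2) ^ Suc n"] assms e[of n] by (metis tau_closed half_gt_zero_iff mult_pos_pos zero_less_one zero_less_power)
  then obtain r where r: "\<And>n. r n > 0" "\<And>n. upper_density (mcball (\<tau> (e n)) (r n)) \<le> \<eta> * (1/2) ^ Suc n"
    by metis
  define K where "K n = carrier H - (\<Union>i<n. mball (\<tau> (e i)) (r i))" for n
  have closed: "closedin mtopology (K n)" for n
    unfolding K_def by (intro closedin_diff) (auto intro: openin_Union)
  have dens: "1 - \<eta> \<le> upper_density (K n)" for n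
  proof -
    have "1 \<le> upper_density (K n \<union> (\<Union>i<n. mball (\<tau> (e i)) (r i)))"
      unfolding upper_density_carrier[symmetric] by (intro upper_density_mono) (auto simp: K_def)
    also have "\<dots> \<le> upper_density (K n) + (\<Sum>i<n. upper_density (mball (\<tau> (e i)) (r i)))"
      using upper_density_Un upper_density_UN[of "{..<n}"] by (meson add_left_mono finite_lessThan order_trans)
    also have "(\<Sum>i<n. upper_density (mball (\<tau> (e i)) (r i))) \<le> (\<Sum>i<n. \<eta> * (1/2) ^ Suc i)"
      by (intro sum_mono order_trans[OF upper_density_mono r(2)]) auto
    also have "(\<Sum>i<n. \<eta> * (1/2) ^ Suc i) = \<eta> * (1 - (1/2) ^ n)"
      by (induction n) (auto simp: algebra_simps)
    also have "\<dots> \<le> \<eta>" using assms by simp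
    finally show ?thesis by simp
  qed
  show thesis
  proof
    show "closedin mtopology (\<Inter>n. K n)" using closed by (intro closedin_Inter) auto
    show "(\<Inter>n. K n) \<inter> \<tau> ` carrier G = {}"
    proof (rule equals0I)
      fix x assume x: "x \<in> (\<Inter>n. K n) \<inter> \<tau> ` carrier G"
      then obtain g where g: "g \<in> carrier G" "x = \<tau> g" by auto
      then obtain n where "g = e n"
        unfolding e_def using G_countable from_nat_into_surj by metis
      then have "x \<notin> K (Suc n)" using g r(1) by (auto simp: K_def intro!: bexI[of _ n])
      then show False using x by blast
    qed
    show "1 - \<eta> \<le> upper_density (\<Inter>n. K n)"
    proof (rule dense_ge)
      fix c assume "upper_density (\<Inter>n. K n) < c"
      then obtain n where "upper_density (K n) \<le> c"
        by (rule upper_density_decreasing[rotated 2]) (auto simp: closed K_def)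
      then show "1 - \<eta> \<le> c" using dens[of n] by simp
    qed
  qed
qed

text \<open>Outer regularity: \<open>D\<close> is the intersection of its closed neighbourhoods.\<close>

lemma neighbourhood_density:
  assumes D: "closedin mtopology D" "D \<noteq> {}" and a: "upper_density D < a"
  obtains s where "s > 0" "upper_density {x \<in> carrier H. set_dist D x \<le> s} \<le> a"
proof -
  have DH: "D \<subseteq> carrier H" using closedin_subset[OF D(1)] by simp
  define A where "A n = {x \<in> carrier H. set_dist D x \<le> 1 / real (Suc n)}" for n
  have "(\<Inter>n. A n) = D"
  proof (intro equalityI subsetI)
    fix x assume x: "x \<in> (\<Inter>n. A n)"
    then have xH: "x \<in> carrier H" and le: "\<And>n. set_dist D x \<le> 1 / real (Suc n)" by (auto simp: A_def)
    have "\<not> set_dist D x > 0" using le nat_approx_posE by (meson not_le)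
    then show "x \<in> D" using set_dist_pos[OF D(1,2)] xH by blast
  qed (use DH set_dist_zero in \<open>auto simp: A_def\<close>)
  moreover have "closedin mtopology (A n)" for n
    unfolding A_def by (intro closed_sublevel set_dist_lipschitz D(2) DH)
  moreover have "A n \<subseteq> A m" if "m \<le> n" for m n
  proof -
    have "1 / real (Suc n) \<le> 1 / real (Suc m)" using that by (intro divide_left_mono) auto
    then show ?thesis by (auto simp: A_def)
  qed
  ultimately obtain k where k: "upper_density (A k) \<le> a"
    using upper_density_decreasing[of A a] a by metis
  show thesis by (rule that[of "1 / real (Suc k)"]) (use k in \<open>auto simp: A_def\<close>)
qed

text \<open>Cut \<open>C\<close> by a finite cover of small balls and keep a minimal subfamily that still has density at
  least \<open>\<delta>\<close>; omitting one ball changes the density by at most \<open>e\<close>.\<close>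

lemma trim_density:
  assumes C: "closedin mtopology C" "\<delta> \<le> upper_density C" and "0 \<le> \<delta>" "e > 0"
  obtains C' where "closedin mtopology C'" "C' \<subseteq> C" "\<delta> \<le> upper_density C'" "upper_density C' \<le> \<delta> + e"
proof -
  obtain r where r: "r > 0" "\<And>p. p \<in> carrier H \<Longrightarrow> upper_density (mcball p r) \<le> e"
    using small_balls[OF \<open>e > 0\<close>] by blast
  obtain B where B: "finite B" "B \<subseteq> carrier G" "\<And>\<xi>. \<xi> \<in> carrier H \<Longrightarrow> \<exists>b\<in>B. d (\<tau> b) \<xi> < r"
    using finite_net[OF r(1)] by blast
  define part where "part P = C \<inter> (\<Union>b\<in>P. mcball (\<tau> b) r)" for P
  define S where "S = {P. P \<subseteq> B \<and> \<delta> \<le> upper_density (part P)}"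
  have "C \<subseteq> part B"
  proof
    fix x assume "x \<in> C"
    then have "x \<in> carrier H" using closedin_subset[OF C(1)] by auto
    then obtain b where "b \<in> B" "d (\<tau> b) x < r" using B(3) by blast
    then show "x \<in> part B" using \<open>x \<in> C\<close> \<open>x \<in> carrier H\<close> B(2) by (auto simp: part_def intro!: bexI[of _ b])
  qed
  then have "upper_density C \<le> upper_density (part B)" by (intro upper_density_mono) auto
  then have "B \<in> S" using C(2) by (auto simp: S_def)
  moreover have "finite S" unfolding S_def using B(1) by simp
  ultimately obtain P where P: "P \<in> S" "\<And>P'. P' \<in> S \<Longrightarrow> P' \<subseteq> P \<Longrightarrow> P = P'"
    using finite_has_minimal[of S] by auto
  have PB: "P \<subseteq> B" using P by (auto simp: S_def)
  show thesis
  proof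
    have "finite P" using PB B(1) finite_subset by blast
    then show "closedin mtopology (part P)"
      unfolding part_def by (cases "P = {}") (auto intro!: closedin_Int C(1) closedin_Union)
    show "part P \<subseteq> C" by (auto simp: part_def)
    show "\<delta> \<le> upper_density (part P)" using P by (simp add: S_def)
    show "upper_density (part P) \<le> \<delta> + e"
    proof (cases "P = {}")
      case True
      then show ?thesis using assms by (simp add: part_def upper_density_empty)
    next
      case False
      then obtain b where b: "b \<in> P" by auto
      have "P - {b} \<notin> S" using P(2)[of "P - {b}"] b by auto
      then have "upper_density (part (P - {b})) < \<delta>" using PB by (auto simp: S_def)
      moreover have "upper_density (part P) \<le> upper_density (part (P - {b}) \<union> mcball (\<tau> b) r)"
        by (intro upper_density_mono) (auto simp: part_def)
      moreover have "\<dots> \<le> upper_density (part (P - {b})) + upper_density (mcball (\<tau> b) r)"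
        by (rule upper_density_Un)
      moreover have "upper_density (mcball (\<tau> b) r) \<le> e" using b PB B(2) by (intro r(2)) auto
      ultimately show ?thesis by linarith
    qed
  qed
qed

text \<open>Trimming with errors tending to 0 gives the density \<open>\<delta>\<close> in the limit. One further point, of density 0,
  makes the set nonempty when \<open>\<delta> = 0\<close>.\<close>

proposition closed_set_of_density:
  assumes "0 \<le> \<delta>" "\<delta> < 1"
  obtains D where "closedin mtopology D" "D \<noteq> {}" "D \<inter> \<tau> ` carrier G = {}" "upper_density D = \<delta>"
proof -
  obtain K where K: "closedin mtopology K" "K \<inter> \<tau> ` carrier G = {}" "1 - (1 - \<delta>)/2 \<le> upper_density K"
    using dense_closed_avoiding[of "(1 - \<delta>)/2"] assms by auto
  have K\<delta>: "\<delta> \<le> upper_density K" "0 < upper_density K" using K(3) assms by (auto simp: field_simps)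
  obtain q where q: "q \<in> K" using K\<delta>(2) upper_density_empty by fastforce
  then have qH: "q \<in> carrier H" using closedin_subset[OF K(1)] by auto
  have "\<exists>C. \<forall>n. (closedin mtopology (C n) \<and> C n \<subseteq> K \<and> \<delta> \<le> upper_density (C n)) \<and>
      (C (Suc n) \<subseteq> C n \<and> upper_density (C (Suc n)) \<le> \<delta> + 1 / real (Suc n))"
  proof (rule dependent_nat_choice)
    show "\<exists>C. closedin mtopology C \<and> C \<subseteq> K \<and> \<delta> \<le> upper_density C" using K(1) K\<delta> by blast
    fix C and n :: nat assume C: "closedin mtopology C \<and> C \<subseteq> K \<and> \<delta> \<le> upper_density C"
    obtain C' where "closedin mtopology C'" "C' \<subseteq> C" "\<delta> \<le> upper_density C'"
      "upper_density C' \<le> \<delta> + 1 / real (Suc n)"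
      by (rule trim_density[of C \<delta> "1 / real (Suc n)"]) (use C assms in auto)
    then show "\<exists>C'. (closedin mtopology C' \<and> C' \<subseteq> K \<and> \<delta> \<le> upper_density C') \<and>
        C' \<subseteq> C \<and> upper_density C' \<le> \<delta> + 1 / real (Suc n)" using C by blast
  qed
  then obtain C where C: "\<And>n. closedin mtopology (C n)" "\<And>n. C n \<subseteq> K" "\<And>n. \<delta> \<le> upper_density (C n)"
    "\<And>n. C (Suc n) \<subseteq> C n" "\<And>n. upper_density (C (Suc n)) \<le> \<delta> + 1 / real (Suc n)" by blast
  have dec: "C n \<subseteq> C m" if "m \<le> n" for m n using lift_Suc_antimono_le[of C, OF C(4) that] .
  let ?D = "\<Inter>n. C n"
  have low: "\<delta> \<le> upper_density ?D"
  proof (rule dense_ge)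
    fix c assume "upper_density ?D < c"
    then obtain n where "upper_density (C n) \<le> c"
      by (rule upper_density_decreasing[OF C(1) dec, rotated])
    then show "\<delta> \<le> c" using C(3)[of n] by simp
  qed
  have "upper_density ?D \<le> \<delta> + e" if "e > 0" for e
  proof -
    obtain n where n: "1 / real (Suc n) < e" using nat_approx_posE[OF \<open>e > 0\<close>] by auto
    have "upper_density ?D \<le> upper_density (C (Suc n))" by (intro upper_density_mono) auto
    then show ?thesis using n C(5)[of n] by linarith
  qed
  then have high: "upper_density ?D \<le> \<delta>" by (rule field_le_epsilon)
  show thesis
  proof
    show "closedin mtopology (?D \<union> {q})"
      using C(1) by (intro closedin_Un closed_singleton qH closedin_Inter) auto
    show "?D \<union> {q} \<noteq> {}" by simp
    show "(?D \<union> {q}) \<inter> \<tau> ` carrier G = {}" using C(2) q K(2) by blast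
    have "upper_density (?D \<union> {q}) \<le> upper_density ?D + upper_density {q}" by (rule upper_density_Un)
    moreover have "upper_density ?D \<le> upper_density (?D \<union> {q})" by (intro upper_density_mono) auto
    ultimately show "upper_density (?D \<union> {q}) = \<delta>"
      using low high upper_density_singleton[OF qH] by linarith
  qed
qed

section \<open>An aperiodic window that is free along a closed set\<close>

definition window :: "(nat \<Rightarrow> 'h set) \<Rightarrow> (nat \<Rightarrow> real) \<Rightarrow> 'h set" where
  "window Q c = {x \<in> carrier H. \<exists>n. set_dist (Q n) x < c n}"

definition window_boundary :: "'h set \<Rightarrow> (nat \<Rightarrow> 'h set) \<Rightarrow> (nat \<Rightarrow> real) \<Rightarrow> 'h set" where
  "window_boundary D Q c = D \<union> {x \<in> carrier H. \<exists>n. set_dist (Q n) x = c n}"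

context
  fixes D Q c
  assumes D: "closedin mtopology D" "D \<noteq> {}" "D \<inter> \<tau> ` carrier G = {}"
    and Q: "\<And>n. Q n \<noteq> {}" "\<And>n. Q n \<subseteq> carrier H"
    and shrink: "\<And>s. s > 0 \<Longrightarrow>
        \<forall>\<^sub>F n in sequentially. \<forall>x\<in>carrier H. set_dist (Q n) x \<le> c n \<longrightarrow> set_dist D x < s"
    and null: "\<And>n. upper_density {x \<in> carrier H. set_dist (Q n) x = c n} = 0"
    and miss: "\<And>n g. g \<in> carrier G \<Longrightarrow> set_dist (Q n) (\<tau> g) \<noteq> c n"
begin

lemma D_subset: "D \<subseteq> carrier H" using closedin_subset[OF D(1)] by simp

text \<open>Near a point off \<open>D\<close> only finitely many of the balls matter, by the shrinking condition.\<close>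

lemma window_locally_constant:
  assumes x: "x \<in> carrier H - window_boundary D Q c"
  shows "\<exists>e>0. \<forall>y\<in>carrier H. d x y < e \<longrightarrow>
           y \<notin> window_boundary D Q c \<and> (y \<in> window Q c \<longleftrightarrow> x \<in> window Q c)"
proof -
  have xH: "x \<in> carrier H" and pos: "set_dist D x > 0"
    using x set_dist_pos[OF D(1,2)] by (auto simp: window_boundary_def)
  obtain N where N: "\<And>n y. n \<ge> N \<Longrightarrow> y \<in> carrier H \<Longrightarrow> set_dist (Q n) y \<le> c n \<Longrightarrow> set_dist D y < set_dist D x / 2"
    using shrink[of "set_dist D x / 2"] pos by (auto simp: eventually_sequentially)
  have "\<exists>r>0. \<forall>a\<in>(\<lambda>n. \<bar>set_dist (Q n) x - c n\<bar>) ` {..<N}. r < a"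
    by (rule finite_positive_lower_bound) (use x xH in \<open>auto simp: window_boundary_def\<close>)
  then obtain r where r: "r > 0" "\<And>n. n < N \<Longrightarrow> r < \<bar>set_dist (Q n) x - c n\<bar>" by auto
  define e where "e = min r (set_dist D x / 2)"
  have "y \<notin> window_boundary D Q c \<and> (y \<in> window Q c \<longleftrightarrow> x \<in> window Q c)"
    if y: "y \<in> carrier H" "d x y < e" for y
  proof -
    have *: "\<bar>set_dist (Q n) x - set_dist (Q n) y\<bar> \<le> d x y" for n
      using set_dist_lipschitz[OF Q xH y(1)] .
    have D': "\<bar>set_dist D x - set_dist D y\<bar> \<le> d x y"
      using set_dist_lipschitz[OF D(2) D_subset xH y(1)] .
    have posy: "set_dist D y > set_dist D x / 2" using D' y(2) unfolding e_def by linarith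
    have big: "set_dist (Q n) y > c n \<and> set_dist (Q n) x > c n" if "n \<ge> N" for n
      using N[OF that y(1)] N[OF that xH] posy pos by linarith
    have small: "set_dist (Q n) y \<noteq> c n \<and> (set_dist (Q n) y < c n \<longleftrightarrow> set_dist (Q n) x < c n)"
      if "n < N" for n
      using r(2)[OF that] *[of n] y(2) unfolding e_def by linarith
    have all: "set_dist (Q n) y \<noteq> c n \<and> (set_dist (Q n) y < c n \<longleftrightarrow> set_dist (Q n) x < c n)" for n
      using big[of n] small[of n] by (cases "n < N") auto
    have "y \<notin> D" using posy pos set_dist_zero[of y D] y(1) by auto
    then show ?thesis using all y xH by (auto simp: window_def window_boundary_def)
  qed
  then show ?thesis using r(1) pos by (intro exI[of _ e]) (auto simp: e_def)
qed

lemma window_boundary_closed: "closedin mtopology (window_boundary D Q c)"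
proof (rule closedI)
  show "window_boundary D Q c \<subseteq> carrier H" using D_subset by (auto simp: window_boundary_def)
  show "\<exists>r>0. \<forall>y\<in>carrier H. d x y < r \<longrightarrow> y \<notin> window_boundary D Q c"
    if "x \<in> carrier H" "x \<notin> window_boundary D Q c" for x
    using window_locally_constant[of x] that by blast
qed

lemma window_boundary_misses: "window_boundary D Q c \<inter> \<tau> ` carrier G = {}"
  using D(3) miss by (auto simp: window_boundary_def)

text \<open>All but finitely many boundary levels lie in a small neighbourhood of \<open>D\<close>, and the others are null.\<close>

lemma window_boundary_density: "upper_density (window_boundary D Q c) \<le> upper_density D"
proof (rule dense_ge)
  fix a assume a: "upper_density D < a"
  obtain s where s: "s > 0" "upper_density {x \<in> carrier H. set_dist D x \<le> s} \<le> a"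
    using neighbourhood_density[OF D(1,2) a] by blast
  obtain N where N: "\<And>n y. n \<ge> N \<Longrightarrow> y \<in> carrier H \<Longrightarrow> set_dist (Q n) y \<le> c n \<Longrightarrow> set_dist D y < s"
    using shrink[OF s(1)] by (auto simp: eventually_sequentially)
  let ?L = "\<lambda>n. {x \<in> carrier H. set_dist (Q n) x = c n}"
  let ?A = "{x \<in> carrier H. set_dist D x \<le> s}"
  have "window_boundary D Q c \<subseteq> ?A \<union> (\<Union>n<N. ?L n)"
  proof
    fix x assume x: "x \<in> window_boundary D Q c"
    show "x \<in> ?A \<union> (\<Union>n<N. ?L n)"
    proof (cases "x \<in> D")
      case True
      then show ?thesis using D_subset set_dist_zero[of x D] s(1) by auto
    next
      case False
      then obtain n where n: "x \<in> carrier H" "set_dist (Q n) x = c n"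
        using x by (auto simp: window_boundary_def)
      then show ?thesis using N[of n x] by (cases "n < N") auto
    qed
  qed
  then have "upper_density (window_boundary D Q c) \<le> upper_density (?A \<union> (\<Union>n<N. ?L n))"
    by (intro upper_density_mono) auto
  also have "\<dots> \<le> upper_density (?A) + upper_density (\<Union>n<N. ?L n)" by (rule upper_density_Un)
  also have "upper_density (\<Union>n<N. ?L n) \<le> (\<Sum>n<N. upper_density (?L n))"
    by (rule upper_density_UN) auto
  also have "\<dots> = 0" by (simp add: null)
  finally show "upper_density (window_boundary D Q c) \<le> a" using s(2) by simp
qed

end

text \<open>By the pigeonhole principle on a finite net, \<open>\<tau>\<close> takes some \<open>k \<noteq> \<one>\<close> arbitrarily close to the identity.
  Hence every ball contains two points \<open>\<tau> h\<close> and \<open>\<tau> (h k)\<close> of the subgroup.\<close>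

lemma dense_avoiding_point:
  assumes x: "x \<in> carrier H" and "e > 0"
  obtains g where "g \<in> carrier G" "d (\<tau> g) x < e" "\<tau> g \<noteq> p"
proof -
  obtain B where B: "finite B" "B \<subseteq> carrier G" "\<And>\<xi>. \<xi> \<in> carrier H \<Longrightarrow> \<exists>b\<in>B. d (\<tau> b) \<xi> < e/4"
    using finite_net[of "e/4"] \<open>e > 0\<close> by auto
  have "\<forall>g\<in>carrier G. \<exists>b. b \<in> B \<and> d (\<tau> b) (\<tau> g) < e/4" using B(3) by (meson tau_closed)
  then obtain f where f: "\<And>g. g \<in> carrier G \<Longrightarrow> f g \<in> B \<and> d (\<tau> (f g)) (\<tau> g) < e/4" by metis
  have "\<not> inj_on f (carrier G)"
    using G_infinite B(1) f by (metis finite_imageD finite_subset image_subsetI)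
  then obtain g g' where g: "g \<in> carrier G" "g' \<in> carrier G" "g \<noteq> g'" "f g = f g'"
    by (auto simp: inj_on_def)
  define k where "k = inv\<^bsub>G\<^esub> g \<otimes>\<^bsub>G\<^esub> g'"
  have k: "k \<in> carrier G" "g' = g \<otimes>\<^bsub>G\<^esub> k" using g by (auto simp: k_def simp flip: G.m_assoc)
  obtain h where h: "h \<in> carrier G" "d (\<tau> h) x < e/2" using tau_dense x \<open>e > 0\<close> by (meson half_gt_zero)
  have "d (\<tau> (h \<otimes>\<^bsub>G\<^esub> k)) (\<tau> h) = d (\<tau> k) \<one>\<^bsub>H\<^esub>"
    using h k d_left[of "\<tau> h" "\<tau> k" "\<one>\<^bsub>H\<^esub>"] by (simp add: tau_mult)
  also have "\<dots> = d (\<tau> g') (\<tau> g)"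
    using g k d_left[of "\<tau> g" "\<tau> k" "\<one>\<^bsub>H\<^esub>"] by (simp add: tau_mult)
  also have "\<dots> < e/2"
    using triangle[of "\<tau> g'" "\<tau> (f g)" "\<tau> g"] f[OF g(1)] f[OF g(2)] g B(2) by (auto simp: commute subset_iff)
  finally have "d (\<tau> (h \<otimes>\<^bsub>G\<^esub> k)) x < e"
    using triangle[of "\<tau> (h \<otimes>\<^bsub>G\<^esub> k)" "\<tau> h" x] h k x by auto
  moreover have "\<tau> (h \<otimes>\<^bsub>G\<^esub> k) \<noteq> \<tau> h"
  proof
    assume "\<tau> (h \<otimes>\<^bsub>G\<^esub> k) = \<tau> h"
    then have "h \<otimes>\<^bsub>G\<^esub> k = h" using tau_inj h k by (auto simp: inj_on_def)
    then have "k = \<one>\<^bsub>G\<^esub>" using h k by simp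
    then show False using g k by simp
  qed
  ultimately show thesis
    using that[of h] that[of "h \<otimes>\<^bsub>G\<^esub> k"] h k \<open>e > 0\<close> by fastforce
qed

text \<open>A translation by \<open>\<kappa>\<close> of length at least \<open>R > u\<close> carries \<open>p'\<close> out of the ball of radius \<open>u\<close> around \<open>p'\<close>.
  The set \<open>D \<union> {p}\<close> has empty interior, so a point near \<open>p'\<close> can be chosen whose translate
  also avoids this set. By compactness the distance from it has a positive lower bound \<open>\<sigma>\<close> that does not
  depend on \<open>\<kappa>\<close>; thus the window stays aperiodic under these \<open>\<kappa>\<close> whatever is later added
  within \<open>\<sigma>\<close> of \<open>D \<union> {p}\<close>.\<close>

lemma large_translations:
  assumes D: "closedin mtopology D" "D \<inter> \<tau> ` carrier G = {}"
    and p: "p \<in> carrier H" "p' \<in> carrier H" and u: "0 < u" "u < R"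
  obtains \<sigma> where "\<sigma> > 0"
    "\<And>\<kappa>. \<kappa> \<in> carrier H \<Longrightarrow> R \<le> d \<one>\<^bsub>H\<^esub> \<kappa> \<Longrightarrow>
        \<exists>z\<in>carrier H. d p' z < u \<and> u < d p' (z \<otimes>\<^bsub>H\<^esub> \<kappa>) \<and> \<sigma> < set_dist (D \<union> {p}) (z \<otimes>\<^bsub>H\<^esub> \<kappa>)"
proof -
  let ?D = "D \<union> {p}"
  have closed: "closedin mtopology ?D" using D(1) p by (intro closedin_Un closed_singleton)
  then have DH: "?D \<subseteq> carrier H" using closedin_subset by fastforce
  define good where "good \<sigma> \<kappa> \<longleftrightarrow> (\<exists>z\<in>carrier H. d p' z < u \<and> u < d p' (z \<otimes>\<^bsub>H\<^esub> \<kappa>) \<and> \<sigma> < set_dist ?D (z \<otimes>\<^bsub>H\<^esub> \<kappa>))"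
    for \<sigma> \<kappa>
  have "\<exists>n. \<forall>\<kappa>\<in>carrier H. R \<le> d \<one>\<^bsub>H\<^esub> \<kappa> \<longrightarrow> good (1 / real (Suc n)) \<kappa>"
  proof (rule ccontr)
    assume "\<nexists>n. \<forall>\<kappa>\<in>carrier H. R \<le> d \<one>\<^bsub>H\<^esub> \<kappa> \<longrightarrow> good (1 / real (Suc n)) \<kappa>"
    then obtain k where k: "\<And>n. k n \<in> carrier H" "\<And>n. R \<le> d \<one>\<^bsub>H\<^esub> (k n)" "\<And>n. \<not> good (1 / real (Suc n)) (k n)"
      by metis
    obtain \<kappa> r where \<kappa>: "\<kappa> \<in> carrier H" and r: "strict_mono (r :: nat \<Rightarrow> nat)"
      and lim: "(\<lambda>n. d (k (r n)) \<kappa>) \<longlonglongrightarrow> 0"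
      using convergent_subsequence k(1) by metis
    have R\<kappa>: "R \<le> d \<one>\<^bsub>H\<^esub> \<kappa>"
    proof (rule ccontr)
      assume "\<not> R \<le> d \<one>\<^bsub>H\<^esub> \<kappa>"
      then have "\<forall>\<^sub>F n in sequentially. d (k (r n)) \<kappa> < R - d \<one>\<^bsub>H\<^esub> \<kappa>"
        by (intro order_tendstoD(2)[OF lim]) simp
      then obtain n where "d (k (r n)) \<kappa> < R - d \<one>\<^bsub>H\<^esub> \<kappa>"
        using eventually_happens sequentially_bot by blast
      then show False
        using triangle[of "\<one>\<^bsub>H\<^esub>" \<kappa> "k (r n)"] k \<kappa> by (smt (verit) H.one_closed commute)
    qed
    obtain g where g: "g \<in> carrier G" "d (\<tau> g) (p' \<otimes>\<^bsub>H\<^esub> \<kappa>) < min u (R - u)" "\<tau> g \<noteq> p"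
      using dense_avoiding_point[of "p' \<otimes>\<^bsub>H\<^esub> \<kappa>" "min u (R - u)"] p \<kappa> u by auto
    define z where "z = \<tau> g \<otimes>\<^bsub>H\<^esub> inv\<^bsub>H\<^esub> \<kappa>"
    have z: "z \<in> carrier H" "z \<otimes>\<^bsub>H\<^esub> \<kappa> = \<tau> g" using g(1) \<kappa> by (auto simp: z_def H.m_assoc)
    have "d p' z = d (p' \<otimes>\<^bsub>H\<^esub> \<kappa>) (\<tau> g)" using d_right[of \<kappa> p' z] z p \<kappa> by simp
    then have near: "d p' z < u" using g(2) by (simp add: commute)
    have "d p' (p' \<otimes>\<^bsub>H\<^esub> \<kappa>) = d \<one>\<^bsub>H\<^esub> \<kappa>" using d_left[of p' "\<one>\<^bsub>H\<^esub>" \<kappa>] p \<kappa> by simp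
    moreover have "d p' (p' \<otimes>\<^bsub>H\<^esub> \<kappa>) \<le> d p' (\<tau> g) + d (\<tau> g) (p' \<otimes>\<^bsub>H\<^esub> \<kappa>)"
      using p \<kappa> g by (intro triangle) auto
    ultimately have far: "u < d p' (\<tau> g)" using g(2) R\<kappa> by linarith
    define s where "s = set_dist ?D (\<tau> g)"
    have s: "s > 0" unfolding s_def using g D(2) by (intro set_dist_pos[OF closed]) auto
    have "\<forall>\<^sub>F n in sequentially. d (k (r n)) \<kappa> < min (d p' (\<tau> g) - u) (s / 2)"
      using far s by (intro order_tendstoD(2)[OF lim]) simp
    moreover have "\<forall>\<^sub>F n in sequentially. 1 / real (Suc n) < s / 2"
      using s by real_asymp
    ultimately have "\<forall>\<^sub>F n in sequentially. good (1 / real (Suc (r n))) (k (r n))"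
    proof eventually_elim
      case (elim n)
      define y where "y = z \<otimes>\<^bsub>H\<^esub> k (r n)"
      have y: "y \<in> carrier H" using z k by (simp add: y_def)
      have dy: "d y (\<tau> g) < min (d p' (\<tau> g) - u) (s / 2)"
        using d_left[of z "k (r n)" \<kappa>] z k \<kappa> elim(1) by (simp add: y_def)
      have "u < d p' y" using triangle[of p' y "\<tau> g"] dy y p g by auto
      moreover have "s - d y (\<tau> g) \<le> set_dist ?D y"
        using set_dist_triangle[of ?D "\<tau> g" y] DH y g by (simp add: s_def commute)
      moreover have "1 / real (Suc (r n)) \<le> 1 / real (Suc n)"
        using seq_suble[OF r, of n] by (intro divide_left_mono) auto
      ultimately show ?case
        unfolding good_def using z near elim(2) dy by (intro bexI[of _ z]) (auto simp: y_def)
    qed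
    then obtain n where "good (1 / real (Suc (r n))) (k (r n))"
      using eventually_happens sequentially_bot by blast
    then show False using k(3) by blast
  qed
  then obtain n where "\<forall>\<kappa>\<in>carrier H. R \<le> d \<one>\<^bsub>H\<^esub> \<kappa> \<longrightarrow> good (1 / real (Suc n)) \<kappa>" by blast
  then show thesis by (intro that[of "1 / real (Suc n)"]) (auto simp: good_def)
qed

text \<open>A pair \<open>(A, B)\<close> asks for an element \<open>g\<close> such that, among the points \<open>\<tau> (a g)\<close> with \<open>a \<in> A\<close>, exactly those
  with \<open>a \<in> B\<close> lie in the window. It has to be met whenever some \<open>\<xi>\<close> visits \<open>D\<close> along all of \<open>A\<close>;
  an element \<open>g\<close> with \<open>\<tau> g\<close> close to \<open>\<xi>\<close> puts all these points close to \<open>D\<close>, but not into \<open>D\<close>.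
  The pairs are countably many, and the \<open>n\<close>-th one is met in the shell where the distance from \<open>D\<close> lies
  between \<open>t (Suc n)\<close> and \<open>t n\<close>. The set \<open>P n\<close> collects the points that should lie in the window;
  it is nonempty because \<open>B\<close> is, and balls of radius \<open>R n\<close> around its points respect the shell and the
  other points of the pattern.\<close>

lemma pattern_stages:
  assumes D: "closedin mtopology D" "D \<noteq> {}" "D \<inter> \<tau> ` carrier G = {}" and "t0 > 0"
  obtains t :: "nat \<Rightarrow> real" and P q and R :: "nat \<Rightarrow> real" where
    "t 0 = t0" "\<And>n. 0 < t n" "\<And>n. t (Suc n) \<le> t n" "t \<longlonglongrightarrow> 0"
    "\<And>n. P n \<subseteq> carrier H" "\<And>n. q n \<in> P n" "\<And>n. 0 < R n" "\<And>n. R n < t n"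
    "\<And>n x y. x \<in> P n \<Longrightarrow> y \<in> carrier H \<Longrightarrow> d x y < R n \<Longrightarrow> t (Suc n) < set_dist D y \<and> set_dist D y < t n"
    "\<And>n x. x \<in> P n \<Longrightarrow> x \<noteq> q n \<Longrightarrow> 2 * R n \<le> d x (q n)"
    "\<And>A B \<xi>. finite A \<Longrightarrow> A \<subseteq> carrier G \<Longrightarrow> B \<subseteq> A \<Longrightarrow> B \<noteq> {} \<Longrightarrow> \<xi> \<in> carrier H \<Longrightarrow>
        (\<And>a. a \<in> A \<Longrightarrow> \<tau> a \<otimes>\<^bsub>H\<^esub> \<xi> \<in> D) \<Longrightarrow>
        \<exists>n. \<exists>g\<in>carrier G. \<forall>a\<in>A. t (Suc n) < set_dist D (\<tau> (a \<otimes>\<^bsub>G\<^esub> g)) \<and> set_dist D (\<tau> (a \<otimes>\<^bsub>G\<^esub> g)) < t n \<and>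
            (if a \<in> B then \<tau> (a \<otimes>\<^bsub>G\<^esub> g) \<in> P n else \<forall>x\<in>P n. 2 * R n \<le> d x (\<tau> (a \<otimes>\<^bsub>G\<^esub> g)))"
proof -
  have DH: "D \<subseteq> carrier H" using closedin_subset[OF D(1)] by simp
  let ?\<rho> = "set_dist D"
  have \<rho>pos: "0 < ?\<rho> (\<tau> g)" if "g \<in> carrier G" for g
    using that D(3) by (intro set_dist_pos[OF D(1,2)]) auto
  define Req where "Req = {(A, B). finite A \<and> A \<subseteq> carrier G \<and> B \<subseteq> A \<and> B \<noteq> {} \<and>
      (\<exists>\<xi>\<in>carrier H. \<forall>a\<in>A. \<tau> a \<otimes>\<^bsub>H\<^esub> \<xi> \<in> D)}"
  have "Req \<subseteq> {A. finite A \<and> A \<subseteq> carrier G} \<times> {A. finite A \<and> A \<subseteq> carrier G}"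
    by (auto simp: Req_def intro: finite_subset)
  then have Req_countable: "countable Req"
    by (rule countable_subset) (intro countable_SIGMA countable_Collect_finite_subset G_countable)
  obtain x where "x \<in> D" using D(2) by auto
  then have "({\<one>\<^bsub>G\<^esub>}, {\<one>\<^bsub>G\<^esub>}) \<in> Req" using DH by (auto simp: Req_def tau_one intro!: bexI[of _ x])
  then have Req_ne: "Req \<noteq> {}" by auto
  define A where "A n = fst (from_nat_into Req n)" for n
  define B where "B n = snd (from_nat_into Req n)" for n
  have "(A n, B n) \<in> Req" for n using from_nat_into[OF Req_ne] by (simp add: A_def B_def)
  then have AB: "finite (A n)" "A n \<subseteq> carrier G" "B n \<subseteq> A n" "B n \<noteq> {}"
      "\<exists>\<xi>\<in>carrier H. \<forall>a\<in>A n. \<tau> a \<otimes>\<^bsub>H\<^esub> \<xi> \<in> D" for n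
    by (simp_all add: Req_def)
  have "\<exists>t. \<forall>n. (0 < t n \<and> (n = 0 \<longrightarrow> t n = t0)) \<and>
      (0 < t (Suc n) \<and> t (Suc n) \<le> t n / 2 \<and>
        (\<exists>g\<in>carrier G. \<forall>a\<in>A n. t (Suc n) < ?\<rho> (\<tau> (a \<otimes>\<^bsub>G\<^esub> g)) \<and> ?\<rho> (\<tau> (a \<otimes>\<^bsub>G\<^esub> g)) < t n))"
  proof (rule dependent_nat_choice)
    show "\<exists>t. 0 < t \<and> (0 = (0::nat) \<longrightarrow> t = t0)" using \<open>t0 > 0\<close> by auto
    fix s :: real and n :: nat assume "0 < s \<and> (n = 0 \<longrightarrow> s = t0)"
    then have s: "0 < s" by simp
    obtain \<xi> where \<xi>: "\<xi> \<in> carrier H" "\<forall>a\<in>A n. \<tau> a \<otimes>\<^bsub>H\<^esub> \<xi> \<in> D" using AB(5) by blast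
    obtain g where g: "g \<in> carrier G" "d (\<tau> g) \<xi> < s" using tau_dense[OF \<xi>(1) s] by blast
    have close: "?\<rho> (\<tau> (a \<otimes>\<^bsub>G\<^esub> g)) < s" if a: "a \<in> A n" for a
    proof -
      have aG: "a \<in> carrier G" using a AB(2) by auto
      have "?\<rho> (\<tau> (a \<otimes>\<^bsub>G\<^esub> g)) \<le> d (\<tau> a \<otimes>\<^bsub>H\<^esub> \<xi>) (\<tau> (a \<otimes>\<^bsub>G\<^esub> g))" using \<xi>(2) a by (intro set_dist_le) auto
      also have "\<dots> = d \<xi> (\<tau> g)" using aG g \<xi> by (simp add: tau_mult d_left)
      finally show ?thesis using g(2) by (simp add: commute)
    qed
    have "\<exists>r>0. \<forall>b\<in>(\<lambda>a. ?\<rho> (\<tau> (a \<otimes>\<^bsub>G\<^esub> g))) ` A n. r < b"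
      using AB(1,2) g(1) by (intro finite_positive_lower_bound) (auto intro!: \<rho>pos)
    then obtain r where r: "r > 0" "\<And>a. a \<in> A n \<Longrightarrow> r < ?\<rho> (\<tau> (a \<otimes>\<^bsub>G\<^esub> g))" by auto
    show "\<exists>t'. (0 < t' \<and> (Suc n = 0 \<longrightarrow> t' = t0)) \<and> 0 < t' \<and> t' \<le> s / 2 \<and>
        (\<exists>g\<in>carrier G. \<forall>a\<in>A n. t' < ?\<rho> (\<tau> (a \<otimes>\<^bsub>G\<^esub> g)) \<and> ?\<rho> (\<tau> (a \<otimes>\<^bsub>G\<^esub> g)) < s)"
      using r s close g(1) by (intro exI[of _ "min r (s/2)"]) (auto intro!: bexI[of _ g] simp: min_less_iff_disj)
  qed
  then obtain t where t: "\<And>n. 0 < t n" "t 0 = t0" "\<And>n. t (Suc n) \<le> t n / 2"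
    and "\<And>n. \<exists>g\<in>carrier G. \<forall>a\<in>A n. t (Suc n) < ?\<rho> (\<tau> (a \<otimes>\<^bsub>G\<^esub> g)) \<and> ?\<rho> (\<tau> (a \<otimes>\<^bsub>G\<^esub> g)) < t n"
    by blast
  then obtain g where g: "\<And>n. g n \<in> carrier G"
    "\<And>n a. a \<in> A n \<Longrightarrow> t (Suc n) < ?\<rho> (\<tau> (a \<otimes>\<^bsub>G\<^esub> g n)) \<and> ?\<rho> (\<tau> (a \<otimes>\<^bsub>G\<^esub> g n)) < t n"
    by metis
  define S where "S n = (\<lambda>a. \<tau> (a \<otimes>\<^bsub>G\<^esub> g n)) ` A n" for n
  define P where "P n = (\<lambda>a. \<tau> (a \<otimes>\<^bsub>G\<^esub> g n)) ` B n" for n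
  have SH: "S n \<subseteq> carrier H" for n using AB(2) g(1) by (auto simp: S_def subset_iff)
  have PS: "P n \<subseteq> S n" for n using AB(3) by (auto simp: S_def P_def)
  have "\<exists>r>0. (\<forall>x\<in>S n. \<forall>y\<in>S n. x \<noteq> y \<longrightarrow> 2 * r < d x y) \<and>
      (\<forall>x\<in>S n. ?\<rho> x + r < t n \<and> t (Suc n) + r < ?\<rho> x)" for n
  proof -
    let ?X = "(\<lambda>(x, y). d x y / 2) ` {(x, y) \<in> S n \<times> S n. x \<noteq> y} \<union>
        (\<lambda>x. t n - ?\<rho> x) ` S n \<union> (\<lambda>x. ?\<rho> x - t (Suc n)) ` S n"
    have finS: "finite (S n)" using AB(1) by (simp add: S_def)
    have "finite {(x, y) \<in> S n \<times> S n. x \<noteq> y}"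
      by (rule finite_subset[of _ "S n \<times> S n"]) (use finS in auto)
    then have "finite ?X" using finS by simp
    moreover have "\<And>z. z \<in> ?X \<Longrightarrow> z > 0" using SH[of n] g(2) by (auto simp: S_def image_subset_iff)
    ultimately have "\<exists>r>0. \<forall>z\<in>?X. r < z" by (rule finite_positive_lower_bound)
    then obtain r where r0: "r > 0 \<and> (\<forall>z\<in>?X. r < z)" by (rule exE)
    have "?\<rho> x + r < t n \<and> t (Suc n) + r < ?\<rho> x" if "x \<in> S n" for x
    proof -
      have "t n - ?\<rho> x \<in> ?X" "?\<rho> x - t (Suc n) \<in> ?X" using that by blast+
      then have "r < t n - ?\<rho> x" "r < ?\<rho> x - t (Suc n)" using r0 by blast+
      then show ?thesis by linarith
    qed
    moreover have "2 * r < d x y" if "x \<in> S n" "y \<in> S n" "x \<noteq> y" for x y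
    proof -
      have "d x y / 2 \<in> ?X" using that by (intro UnI1 image_eqI[of _ _ "(x, y)"]) auto
      then have "r < d x y / 2" using r0 by blast
      then show ?thesis by linarith
    qed
    ultimately show ?thesis using r0 by (intro exI[of _ r]) simp
  qed
  then obtain R where R: "\<And>n. R n > 0" "\<And>n x y. x \<in> S n \<Longrightarrow> y \<in> S n \<Longrightarrow> x \<noteq> y \<Longrightarrow> 2 * R n < d x y"
      "\<And>n x. x \<in> S n \<Longrightarrow> ?\<rho> x + R n < t n \<and> t (Suc n) + R n < ?\<rho> x"
    by metis
  have "\<exists>x. x \<in> P n" for n using AB(4)[of n] by (simp add: P_def ex_in_conv)
  then obtain q where q: "\<And>n. q n \<in> P n" by metis
  show thesis
  proof (rule that[of t P q R])
    show "t 0 = t0" "0 < t n" "0 < R n" "q n \<in> P n" for n by (fact t R q)+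
    show "t (Suc n) \<le> t n" for n using t(1,3)[of n] by linarith
    have "t n \<le> t0 * (1/2) ^ n" for n
      by (induction n) (use t(2,3) in \<open>auto intro: order_trans\<close>)
    moreover have "(\<lambda>n. t0 * (1/2) ^ n) \<longlonglongrightarrow> 0" by real_asymp
    ultimately show "t \<longlonglongrightarrow> 0"
      using t(1) by (intro tendsto_sandwich[of "\<lambda>_. 0" t]) (auto intro: less_imp_le always_eventually)
    show "P n \<subseteq> carrier H" for n using PS SH by blast
    show "R n < t n" for n
    proof -
      have "q n \<in> S n" using q PS by blast
      then show ?thesis using R(3)[of "q n" n] set_dist_nonneg[OF D(2), of "q n"] by linarith
    qed
    show "t (Suc n) < ?\<rho> y \<and> ?\<rho> y < t n" if "x \<in> P n" "y \<in> carrier H" "d x y < R n" for n x y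
    proof -
      have x: "x \<in> S n" using that PS by blast
      have "x \<in> carrier H" using x SH by blast
      then show ?thesis using R(3)[OF x] set_dist_lipschitz[OF D(2) DH _ that(2), of x] that(3) by linarith
    qed
    show "2 * R n \<le> d x (q n)" if "x \<in> P n" "x \<noteq> q n" for n x
    proof -
      have "x \<in> S n" "q n \<in> S n" using that q PS by blast+
      then show ?thesis using R(2)[OF _ _ that(2)] by (simp add: less_imp_le)
    qed
    fix A' B' \<xi> assume *: "finite A'" "A' \<subseteq> carrier G" "B' \<subseteq> A'" "B' \<noteq> {}" "\<xi> \<in> carrier H"
      "\<And>a. a \<in> A' \<Longrightarrow> \<tau> a \<otimes>\<^bsub>H\<^esub> \<xi> \<in> D"
    then have "(A', B') \<in> Req" by (auto simp: Req_def intro!: bexI[of _ \<xi>])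
    then obtain n where "from_nat_into Req n = (A', B')"
      using from_nat_into_surj[OF Req_countable] by metis
    then have n: "A n = A'" "B n = B'" by (simp_all add: A_def B_def)
    have "2 * R n \<le> d x (\<tau> (a \<otimes>\<^bsub>G\<^esub> g n))" if a: "a \<in> A'" "a \<notin> B'" "x \<in> P n" for a x
    proof -
      obtain b where b: "b \<in> B'" "x = \<tau> (b \<otimes>\<^bsub>G\<^esub> g n)" using a(3) n by (auto simp: P_def)
      have "\<tau> (b \<otimes>\<^bsub>G\<^esub> g n) \<noteq> \<tau> (a \<otimes>\<^bsub>G\<^esub> g n)"
      proof
        have ab: "a \<in> carrier G" "b \<in> carrier G" using a b * by auto
        assume "\<tau> (b \<otimes>\<^bsub>G\<^esub> g n) = \<tau> (a \<otimes>\<^bsub>G\<^esub> g n)"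
        then have "b \<otimes>\<^bsub>G\<^esub> g n = a \<otimes>\<^bsub>G\<^esub> g n" using ab g(1) tau_inj by (auto simp: inj_on_def)
        then show False using ab g(1)[of n] a b by simp
      qed
      then have "2 * R n < d x (\<tau> (a \<otimes>\<^bsub>G\<^esub> g n))"
        using a b n * by (intro R(2)) (auto simp: S_def)
      then show ?thesis by simp
    qed
    then show "\<exists>n. \<exists>g\<in>carrier G. \<forall>a\<in>A'. t (Suc n) < ?\<rho> (\<tau> (a \<otimes>\<^bsub>G\<^esub> g)) \<and> ?\<rho> (\<tau> (a \<otimes>\<^bsub>G\<^esub> g)) < t n \<and>
            (if a \<in> B' then \<tau> (a \<otimes>\<^bsub>G\<^esub> g) \<in> P n else \<forall>x\<in>P n. 2 * R n \<le> d x (\<tau> (a \<otimes>\<^bsub>G\<^esub> g)))"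
      using g n by (intro exI[of _ n] bexI[of _ "g n"]) (auto simp: P_def)
  qed
qed

text \<open>The window consists of a ball of radius \<open>u\<close> around \<open>p'\<close>, a ball around \<open>p\<close>, and the balls around the
  points of \<open>P n\<close> for all stages \<open>n\<close>. The sets \<open>Z n\<close> are disjoint zones that contain them.
  An isolated centre with clearance \<open>R' n\<close> and ball radius \<open>c' n\<close> is moved out of the window by every
  translation whose length \<open>d \<one> \<kappa>\<close> lies strictly between \<open>c' n\<close> and \<open>R' n\<close>. The clearances are known before any
  \<open>c' n\<close> is chosen, so \<open>c' n < R' (Suc n)\<close> can be arranged; then these ranges overlap and, as \<open>c' n\<close> tends
  to 0, they exhaust all lengths between 0 and \<open>r\<close>. Lengths from \<open>r\<close> on are the business of the ball
  around \<open>p'\<close>.\<close>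

proposition generic_window:
  assumes D: "closedin mtopology D" "D \<noteq> {}" "D \<inter> \<tau> ` carrier G = {}"
  obtains W E where
    "closedin mtopology E" "D \<subseteq> E" "E \<inter> \<tau> ` carrier G = {}" "upper_density E \<le> upper_density D"
    "\<And>x. x \<in> carrier H - E \<Longrightarrow> \<exists>e>0. \<forall>y\<in>carrier H. d x y < e \<longrightarrow> y \<notin> E \<and> (y \<in> W \<longleftrightarrow> x \<in> W)"
    "\<And>A B \<xi>. finite A \<Longrightarrow> A \<subseteq> carrier G \<Longrightarrow> B \<subseteq> A \<Longrightarrow> B \<noteq> {} \<Longrightarrow> \<xi> \<in> carrier H \<Longrightarrow>
        (\<And>a. a \<in> A \<Longrightarrow> \<tau> a \<otimes>\<^bsub>H\<^esub> \<xi> \<in> D) \<Longrightarrow>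
        \<exists>g\<in>carrier G. \<forall>a\<in>A. \<tau> (a \<otimes>\<^bsub>G\<^esub> g) \<in> W \<longleftrightarrow> a \<in> B"
    "\<And>\<kappa>. \<kappa> \<in> carrier H \<Longrightarrow> \<kappa> \<noteq> \<one>\<^bsub>H\<^esub> \<Longrightarrow>
        \<exists>z\<in>carrier H. z \<notin> E \<and> z \<otimes>\<^bsub>H\<^esub> \<kappa> \<notin> E \<and> (z \<in> W \<longleftrightarrow> z \<otimes>\<^bsub>H\<^esub> \<kappa> \<notin> W)"
proof -
  let ?\<rho> = "set_dist D"
  have DH: "D \<subseteq> carrier H" using closedin_subset[OF D(1)] by simp
  have \<rho>pos: "0 < ?\<rho> (\<tau> g)" if "g \<in> carrier G" for g
    using that D(3) by (intro set_dist_pos[OF D(1,2)]) auto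
  define p where "p = \<tau> \<one>\<^bsub>G\<^esub>"
  obtain g' where g': "g' \<in> carrier G" "\<tau> g' \<noteq> p"
    using dense_avoiding_point[OF H.one_closed zero_less_one] by blast
  define p' where "p' = \<tau> g'"
  have pH: "p \<in> carrier H" "p' \<in> carrier H" using g' by (auto simp: p_def p'_def)
  \<comment> \<open>Balls of radius \<open>r\<close> around \<open>p\<close> and \<open>p'\<close> are disjoint and stay away from \<open>D\<close>.\<close>
  define r where "r = min (min (?\<rho> p) (?\<rho> p')) (d p p') / 4"
  have r: "0 < r" "4 * r \<le> ?\<rho> p" "4 * r \<le> ?\<rho> p'" "4 * r \<le> d p p'"
    using \<rho>pos[of "\<one>\<^bsub>G\<^esub>"] \<rho>pos[of g'] g' pH by (auto simp: r_def p_def p'_def)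
  obtain u where u: "0 < u" "u < r" "upper_density {x \<in> carrier H. set_dist {p'} x = u} = 0"
      "\<And>g. g \<in> carrier G \<Longrightarrow> set_dist {p'} (\<tau> g) \<noteq> u"
    using null_level[of "set_dist {p'}" 0 r, OF set_dist_lipschitz r(1)] pH by auto
  obtain \<sigma> where \<sigma>: "\<sigma> > 0"
    "\<And>\<kappa>. \<kappa> \<in> carrier H \<Longrightarrow> r \<le> d \<one>\<^bsub>H\<^esub> \<kappa> \<Longrightarrow>
        \<exists>z\<in>carrier H. d p' z < u \<and> u < d p' (z \<otimes>\<^bsub>H\<^esub> \<kappa>) \<and> \<sigma> < set_dist (D \<union> {p}) (z \<otimes>\<^bsub>H\<^esub> \<kappa>)"
    using large_translations[OF D(1,3) pH u(1,2)] by blast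
  have pos: "0 < min r \<sigma>" using r \<sigma> by simp
  show thesis
  proof (rule pattern_stages[OF D pos])
    fix t P q R assume t: "t 0 = min r \<sigma>" "\<And>n. 0 < t n" "\<And>n. t (Suc n) \<le> t n" "t \<longlonglongrightarrow> 0"
      and P: "\<And>n. P n \<subseteq> carrier H" "\<And>n. q n \<in> P n" "\<And>n. 0 < R n" "\<And>n. R n < t n"
      and shell: "\<And>n x y. x \<in> P n \<Longrightarrow> y \<in> carrier H \<Longrightarrow> d x y < R n \<Longrightarrow> t (Suc n) < ?\<rho> y \<and> ?\<rho> y < t n"
      and isolated: "\<And>n x. x \<in> P n \<Longrightarrow> x \<noteq> q n \<Longrightarrow> 2 * R n \<le> d x (q n)"
      and patterns: "\<And>A B \<xi>. finite A \<Longrightarrow> A \<subseteq> carrier G \<Longrightarrow> B \<subseteq> A \<Longrightarrow> B \<noteq> {} \<Longrightarrow> \<xi> \<in> carrier H \<Longrightarrow>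
          (\<And>a. a \<in> A \<Longrightarrow> \<tau> a \<otimes>\<^bsub>H\<^esub> \<xi> \<in> D) \<Longrightarrow>
          \<exists>n. \<exists>g\<in>carrier G. \<forall>a\<in>A. t (Suc n) < ?\<rho> (\<tau> (a \<otimes>\<^bsub>G\<^esub> g)) \<and> ?\<rho> (\<tau> (a \<otimes>\<^bsub>G\<^esub> g)) < t n \<and>
              (if a \<in> B then \<tau> (a \<otimes>\<^bsub>G\<^esub> g) \<in> P n else \<forall>x\<in>P n. 2 * R n \<le> d x (\<tau> (a \<otimes>\<^bsub>G\<^esub> g)))"
    define Q' where "Q' = case_nat {p} P"
    define q' where "q' = case_nat p q"
    define R' where "R' = case_nat r R"
    have Q': "Q' n \<subseteq> carrier H" "q' n \<in> Q' n" "0 < R' n" for n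
      using P pH r by (auto simp: Q'_def q'_def R'_def split: nat.split)
    have isolated': "2 * R' n \<le> d x (q' n)" if "x \<in> Q' n" "x \<noteq> q' n" for n x
      using that isolated by (auto simp: Q'_def q'_def R'_def split: nat.splits)
    \<comment> \<open>The bound by \<open>\<sigma>\<close> matters for the ball around \<open>p\<close>, the others lie within \<open>t 0 \<le> \<sigma>\<close> of \<open>D\<close>.\<close>
    define \<beta> where "\<beta> n = min (min (R' n) (R' (Suc n))) \<sigma>" for n
    have "\<forall>n. \<exists>s. 0 < s \<and> s < \<beta> n \<and> upper_density {x \<in> carrier H. set_dist (Q' n) x = s} = 0 \<and>
        (\<forall>g\<in>carrier G. set_dist (Q' n) (\<tau> g) \<noteq> s)"
    proof
      fix n
      have "0 < \<beta> n" using Q'(3) \<sigma>(1) by (simp add: \<beta>_def)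
      moreover have "Q' n \<noteq> {}" using Q'(2)[of n] by auto
      ultimately obtain s where "0 < s" "s < \<beta> n" "upper_density {x \<in> carrier H. set_dist (Q' n) x = s} = 0"
          "\<And>g. g \<in> carrier G \<Longrightarrow> set_dist (Q' n) (\<tau> g) \<noteq> s"
        using null_level[of "set_dist (Q' n)" 0 "\<beta> n", OF set_dist_lipschitz] Q'(1) by blast
      then show "\<exists>s. 0 < s \<and> s < \<beta> n \<and> upper_density {x \<in> carrier H. set_dist (Q' n) x = s} = 0 \<and>
        (\<forall>g\<in>carrier G. set_dist (Q' n) (\<tau> g) \<noteq> s)" by (intro exI[of _ s]) simp
    qed
    from choice[OF this] obtain c' where "\<forall>n. 0 < c' n \<and> c' n < \<beta> n \<and>
        upper_density {x \<in> carrier H. set_dist (Q' n) x = c' n} = 0 \<and>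
        (\<forall>g\<in>carrier G. set_dist (Q' n) (\<tau> g) \<noteq> c' n)" by (rule exE)
    then have c'0: "\<And>n. 0 < c' n" "\<And>n. c' n < \<beta> n"
        "\<And>n. upper_density {x \<in> carrier H. set_dist (Q' n) x = c' n} = 0"
        "\<And>n g. g \<in> carrier G \<Longrightarrow> set_dist (Q' n) (\<tau> g) \<noteq> c' n"
      by auto
    have c': "c' n < R' n" "c' n < R' (Suc n)" "c' n < \<sigma>" for n
      using c'0(2)[of n] by (auto simp: \<beta>_def)
    define Q where "Q = case_nat {p'} Q'"
    define c where "c = case_nat u c'"
    have Q0: "Q 0 = {p'}" "c 0 = u" and QSuc: "Q (Suc n) = Q' n" "c (Suc n) = c' n" for n
      by (simp_all add: Q_def c_def)
    have Q: "Q n \<noteq> {}" "Q n \<subseteq> carrier H" for n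
      using Q' pH by (cases n; auto simp: Q0 QSuc)+
    have cpos: "0 < c n" for n using u c'0(1) by (cases n) (auto simp: Q0 QSuc)

    define Z where "Z = case_nat {x. d p' x \<le> u} (case_nat {x. d p x < r} (\<lambda>n. {x. t (Suc n) < ?\<rho> x \<and> ?\<rho> x < t n}))"
    have Z0: "Z 0 = {x. d p' x \<le> u}" and Z1: "Z (Suc 0) = {x. d p x < r}"
      and Z2: "Z (Suc (Suc n)) = {x. t (Suc n) < ?\<rho> x \<and> ?\<rho> x < t n}" for n
      by (simp_all add: Z_def)
    have tdec: "t n \<le> t m" if "m \<le> n" for m n using lift_Suc_antimono_le[of t, OF t(3) that] .
    have singleton_dist: "set_dist {z} x = d z x" for z x by (simp add: set_dist_def)
    have ball_zone: "x \<in> Z (Suc n)" if "z \<in> Q' n" "x \<in> carrier H" "d z x < R' n" for n x z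
      using that shell by (cases n) (auto simp: Q'_def R'_def Z1 Z2)
    have zone: "x \<in> Z n" if "x \<in> carrier H" "set_dist (Q n) x \<le> c n" for n x
    proof (cases n)
      case 0
      then show ?thesis using that by (simp add: Q0 Z0 singleton_dist)
    next
      case (Suc k)
      then have "set_dist (Q' k) x < R' k" using that c'(1)[of k] by (simp add: QSuc)
      then obtain z where "z \<in> Q' k" "d z x < R' k" using set_dist_less_iff Q'(2) by blast
      then show ?thesis using ball_zone that(1) Suc by blast
    qed
    have high: "t 0 < ?\<rho> x" if "x \<in> carrier H" "x \<in> Z 0 \<union> Z (Suc 0)" for x
    proof -
      have "?\<rho> p \<le> ?\<rho> x + d p x" "?\<rho> p' \<le> ?\<rho> x + d p' x"
        using that pH by (auto intro!: set_dist_triangle[OF D(2) DH])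
      then show ?thesis using that(2) r u t(1) by (auto simp: Z0 Z1)
    qed
    have disjoint: "m = n" if "x \<in> carrier H" "x \<in> Z m" "x \<in> Z n" for x m n
    proof -
      have 01: "\<not> (x \<in> Z 0 \<and> x \<in> Z (Suc 0))"
        using triangle[of p x p'] that(1) pH r u by (auto simp: Z0 Z1 commute)
      have low: "?\<rho> x < t 0" if "x \<in> Z (Suc (Suc k))" for k
        using that tdec[of 0 k] by (auto simp: Z2)
      have shells: "\<not> (x \<in> Z (Suc (Suc j)) \<and> x \<in> Z (Suc (Suc k)))" if "j < k" for j k
        using tdec[of "Suc j" k] that by (auto simp: Z2)
      have "\<not> (x \<in> Z m \<and> x \<in> Z n)" if "m < n" for m n
      proof
        assume *: "x \<in> Z m \<and> x \<in> Z n"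
        consider "m = 0" "n = Suc 0" | k where "m \<in> {0, Suc 0}" "n = Suc (Suc k)"
          | j k where "m = Suc (Suc j)" "n = Suc (Suc k)" "j < k"
          using \<open>m < n\<close> by (cases m; cases n; cases "m - 1"; cases "n - 1") auto
        then show False
        proof cases
          case 2
          then show False using * low[of k] high[of x] \<open>x \<in> carrier H\<close> by auto
        qed (use * 01 shells in auto)
      qed
      then show ?thesis using that by (metis linorder_neqE_nat)
    qed
    have shrink: "\<forall>\<^sub>F n in sequentially. \<forall>x\<in>carrier H. set_dist (Q n) x \<le> c n \<longrightarrow> ?\<rho> x < s" if s: "s > 0" for s
    proof -
      obtain N where N: "\<And>n. n \<ge> N \<Longrightarrow> t n < s"
        using order_tendstoD(2)[OF t(4) s] by (auto simp: eventually_sequentially)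
      have "?\<rho> x < s" if n: "n \<ge> Suc (Suc N)" and x: "x \<in> carrier H" "set_dist (Q n) x \<le> c n" for n x
      proof -
        obtain k where k: "n = Suc (Suc k)" "k \<ge> N" using n by (metis Suc_le_D Suc_le_mono)
        have "?\<rho> x < t k" using zone[OF x] by (simp add: k Z2)
        then show ?thesis using N[OF k(2)] by simp
      qed
      then show ?thesis unfolding eventually_sequentially by blast
    qed
    have null: "upper_density {x \<in> carrier H. set_dist (Q n) x = c n} = 0" for n
      using u(3) c'0(3) by (cases n) (simp_all add: Q0 QSuc)
    have miss: "set_dist (Q n) (\<tau> g) \<noteq> c n" if "g \<in> carrier G" for n g
      using u(4) c'0(4) that by (cases n) (simp_all add: Q0 QSuc)

    define W where "W = window Q c"
    define E where "E = window_boundary D Q c"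
    note facts = D Q shrink null miss
    have W_zone: "x \<in> W \<longleftrightarrow> set_dist (Q n) x < c n" if "x \<in> carrier H" "x \<in> Z n" for n x
      using that zone disjoint unfolding W_def window_def by (auto intro: less_imp_le) (metis less_imp_le)
    have E_zone: "x \<in> E \<longleftrightarrow> set_dist (Q n) x = c n" if "x \<in> carrier H" "x \<in> Z n" "x \<notin> D" for n x
      using that zone disjoint unfolding E_def window_boundary_def by auto (metis order_refl)
    have W_none: "x \<notin> W \<and> x \<notin> E" if "x \<in> carrier H" "x \<notin> D" "\<And>n. c n < set_dist (Q n) x" for x
      using that unfolding W_def E_def window_def window_boundary_def by (auto simp: not_less less_imp_le) (metis less_irrefl)
    have Z_notD: "x \<notin> D" if "x \<in> carrier H" "x \<in> Z n" for n x
    proof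
      assume "x \<in> D"
      then have "?\<rho> x = 0" using that(1) by (rule set_dist_zero)
      moreover have "0 < ?\<rho> x"
      proof (cases "n < 2")
        case True
        then show ?thesis using high[OF that(1)] that(2) t(2)[of 0] by (cases n) auto
      next
        case False
        then obtain k where "n = Suc (Suc k)" by (metis One_nat_def Suc_1 not_less_less_Suc_eq not0_implies_Suc less_Suc_eq_0_disj)
        then show ?thesis using that(2) t(2)[of "Suc k"] by (simp add: Z2)
      qed
      ultimately show False by simp
    qed

    show ?thesis
    proof (rule that[of E W])
      show "closedin mtopology E" unfolding E_def by (rule window_boundary_closed[OF facts])
      show "D \<subseteq> E" by (simp add: E_def window_boundary_def)
      show "E \<inter> \<tau> ` carrier G = {}" unfolding E_def by (rule window_boundary_misses[OF facts])
      show "upper_density E \<le> upper_density D" unfolding E_def by (rule window_boundary_density[OF facts])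
      show "\<exists>e>0. \<forall>y\<in>carrier H. d x y < e \<longrightarrow> y \<notin> E \<and> (y \<in> W \<longleftrightarrow> x \<in> W)" if "x \<in> carrier H - E" for x
        using window_locally_constant[OF facts] that unfolding E_def W_def by blast
    next
      fix A B \<xi> assume *: "finite A" "A \<subseteq> carrier G" "B \<subseteq> A" "B \<noteq> {}" "\<xi> \<in> carrier H"
        "\<And>a. a \<in> A \<Longrightarrow> \<tau> a \<otimes>\<^bsub>H\<^esub> \<xi> \<in> D"
      obtain n g where g: "g \<in> carrier G"
        and ng: "\<And>a. a \<in> A \<Longrightarrow> t (Suc n) < ?\<rho> (\<tau> (a \<otimes>\<^bsub>G\<^esub> g)) \<and> ?\<rho> (\<tau> (a \<otimes>\<^bsub>G\<^esub> g)) < t n \<and>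
              (if a \<in> B then \<tau> (a \<otimes>\<^bsub>G\<^esub> g) \<in> P n else \<forall>x\<in>P n. 2 * R n \<le> d x (\<tau> (a \<otimes>\<^bsub>G\<^esub> g)))"
        using patterns[OF *] by blast
      have "\<tau> (a \<otimes>\<^bsub>G\<^esub> g) \<in> W \<longleftrightarrow> a \<in> B" if a: "a \<in> A" for a
      proof -
        have xH: "\<tau> (a \<otimes>\<^bsub>G\<^esub> g) \<in> carrier H" using a g * by auto
        moreover have "\<tau> (a \<otimes>\<^bsub>G\<^esub> g) \<in> Z (Suc (Suc n))" using ng[OF a] by (simp add: Z2)
        ultimately have W: "\<tau> (a \<otimes>\<^bsub>G\<^esub> g) \<in> W \<longleftrightarrow> set_dist (P n) (\<tau> (a \<otimes>\<^bsub>G\<^esub> g)) < c' (Suc n)"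
          using W_zone[of _ "Suc (Suc n)"] by (simp add: QSuc Q'_def)
        show ?thesis
        proof (cases "a \<in> B")
          case True
          then have "set_dist (P n) (\<tau> (a \<otimes>\<^bsub>G\<^esub> g)) = 0" using ng[OF a] xH by (intro set_dist_zero) auto
          then show ?thesis using W True c'0(1)[of "Suc n"] by simp
        next
          case False
          have "c' (Suc n) < R n" using c'(1)[of "Suc n"] by (simp add: R'_def)
          then have "c' (Suc n) < d x (\<tau> (a \<otimes>\<^bsub>G\<^esub> g))" if "x \<in> P n" for x
            using ng[OF a] False that P(3)[of n] by fastforce
          then have "\<not> set_dist (P n) (\<tau> (a \<otimes>\<^bsub>G\<^esub> g)) < c' (Suc n)"
            using set_dist_less_iff[of "P n"] P(2)[of n] by force
          then show ?thesis using W False by simp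
        qed
      qed
      then show "\<exists>g\<in>carrier G. \<forall>a\<in>A. \<tau> (a \<otimes>\<^bsub>G\<^esub> g) \<in> W \<longleftrightarrow> a \<in> B" using g by blast
    next
      fix \<kappa> assume \<kappa>: "\<kappa> \<in> carrier H" "\<kappa> \<noteq> \<one>\<^bsub>H\<^esub>"
      have pos: "0 < d \<one>\<^bsub>H\<^esub> \<kappa>" using \<kappa> by auto
      show "\<exists>z\<in>carrier H. z \<notin> E \<and> z \<otimes>\<^bsub>H\<^esub> \<kappa> \<notin> E \<and> (z \<in> W \<longleftrightarrow> z \<otimes>\<^bsub>H\<^esub> \<kappa> \<notin> W)"
      proof (cases "r \<le> d \<one>\<^bsub>H\<^esub> \<kappa>")
        case True
        obtain z where z: "z \<in> carrier H" "d p' z < u" "u < d p' (z \<otimes>\<^bsub>H\<^esub> \<kappa>)" "\<sigma> < set_dist (D \<union> {p}) (z \<otimes>\<^bsub>H\<^esub> \<kappa>)"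
          using \<sigma>(2)[OF \<kappa>(1) True] by blast
        define y where "y = z \<otimes>\<^bsub>H\<^esub> \<kappa>"
        have y: "y \<in> carrier H" using z \<kappa> by (simp add: y_def)
        have "z \<in> Z 0" using z by (simp add: Z0)
        then have zW: "z \<in> W" "z \<notin> E"
          using W_zone[of z 0] E_zone[of z 0] Z_notD[of z 0] z by (auto simp: Q0 singleton_dist)
        have far: "\<sigma> < d x y" if "x \<in> D \<union> {p}" for x
          using z(4) set_dist_le[OF that, of y] by (simp add: y_def)
        have "\<not> ?\<rho> y < \<sigma>"
          using far set_dist_less_iff[OF D(2), of y \<sigma>] by force
        then have \<rho>y: "t n \<le> ?\<rho> y" for n using t(1) tdec[of 0 n] by linarith
        have yD: "y \<notin> D" using far[of y] \<sigma>(1) y by auto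
        have "c n < set_dist (Q n) y" for n
        proof (cases n)
          case 0
          then show ?thesis using z(3) by (simp add: Q0 singleton_dist y_def)
        next
          case (Suc k)
          show ?thesis
          proof (cases k)
            case 0
            then show ?thesis using Suc far[of p] c'(3)[of 0] by (simp add: QSuc Q'_def singleton_dist)
          next
            case (Suc j)
            then have "y \<notin> Z n" using \<open>n = Suc k\<close> \<rho>y[of j] by (simp add: Z2)
            then show ?thesis using zone[OF y, of n] by force
          qed
        qed
        then have "y \<notin> W" "y \<notin> E" using W_none[OF y yD] by blast+
        then show ?thesis using z zW by (intro bexI[of _ z]) (auto simp: y_def)
      next
        case False
        have "\<exists>n. c' n < d \<one>\<^bsub>H\<^esub> \<kappa>"
        proof -
          obtain n where "t n < d \<one>\<^bsub>H\<^esub> \<kappa>"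
            using order_tendstoD(2)[OF t(4) pos] by (auto simp: eventually_sequentially)
          then have "c' (Suc n) < d \<one>\<^bsub>H\<^esub> \<kappa>" using P(4)[of n] c'(1)[of "Suc n"] by (simp add: R'_def)
          then show ?thesis by blast
        qed
        then obtain n where n: "c' n < d \<one>\<^bsub>H\<^esub> \<kappa>" "\<And>m. m < n \<Longrightarrow> \<not> c' m < d \<one>\<^bsub>H\<^esub> \<kappa>"
          using exists_least_iff[of "\<lambda>n. c' n < d \<one>\<^bsub>H\<^esub> \<kappa>"] by blast
        have nR: "d \<one>\<^bsub>H\<^esub> \<kappa> < R' n"
        proof (cases n)
          case 0
          then show ?thesis using False by (simp add: R'_def)
        next
          case (Suc m)
          then show ?thesis using n(2)[of m] c'(2)[of m] by simp
        qed
        define z where "z = q' n"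
        define y where "y = z \<otimes>\<^bsub>H\<^esub> \<kappa>"
        have z: "z \<in> carrier H" "z \<in> Q' n" using Q' by (auto simp: z_def)
        have y: "y \<in> carrier H" using z \<kappa> by (simp add: y_def)
        have zy: "d z y = d \<one>\<^bsub>H\<^esub> \<kappa>" using d_left[of z "\<one>\<^bsub>H\<^esub>" \<kappa>] z \<kappa> by (simp add: y_def)
        have zZ: "z \<in> Z (Suc n)" using ball_zone[OF z(2,1)] z Q'(3) by simp
        have yZ: "y \<in> Z (Suc n)" using ball_zone[OF z(2) y] nR by (simp add: zy)
        have "set_dist (Q' n) z = 0" using z by (intro set_dist_zero)
        then have zW: "z \<in> W" "z \<notin> E"
          using W_zone[OF z(1) zZ] E_zone[OF z(1) zZ Z_notD[OF z(1) zZ]] c'0(1)[of n] by (auto simp: QSuc)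
        have "min (d \<one>\<^bsub>H\<^esub> \<kappa>) (R' n) \<le> d x y" if x: "x \<in> Q' n" for x
        proof (cases "x = z")
          case False
          then have "2 * R' n \<le> d x z" using isolated'[OF x] by (simp add: z_def)
          moreover have "d x z \<le> d x y + d y z" using x y z Q'(1) by (intro triangle) auto
          ultimately show ?thesis using nR zy by (simp add: commute)
        qed (simp add: zy)
        then have "\<not> set_dist (Q' n) y < min (d \<one>\<^bsub>H\<^esub> \<kappa>) (R' n)"
          using set_dist_less_iff[of "Q' n" y "min (d \<one>\<^bsub>H\<^esub> \<kappa>) (R' n)"] z(2)
          by (metis empty_iff not_less)
        then have "c' n < set_dist (Q' n) y" using n(1) c'(1)[of n] by linarith
        then have "y \<notin> W" "y \<notin> E"
          using W_zone[OF y yZ] E_zone[OF y yZ Z_notD[OF y yZ]] by (auto simp: QSuc)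
        then show ?thesis using z zW by (intro bexI[of _ z]) (auto simp: y_def)
      qed
    qed
  qed
qed

end

section \<open>Subshifts\<close>

lemma topspace_full_shift [simp]: "topspace (full_shift G) = arrays G"
  by (simp add: full_shift_def)

lemma cylinder_open:
  assumes "finite A" "A \<subseteq> carrier G"
  shows "openin (full_shift G) {z \<in> arrays G. \<forall>a\<in>A. z a = w a}"
proof -
  have "{z \<in> arrays G. \<forall>a\<in>A. z a = w a} = (\<Pi>\<^sub>E i\<in>carrier G. if i \<in> A then {w i} \<inter> {0, 1} else {0, 1})"
    (is "_ = Pi\<^sub>E _ ?V")
  proof (intro equalityI subsetI)
    fix z assume "z \<in> {z \<in> arrays G. \<forall>a\<in>A. z a = w a}"
    then have z: "z \<in> arrays G" "\<And>a. a \<in> A \<Longrightarrow> w a = z a" by auto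
    then show "z \<in> Pi\<^sub>E (carrier G) ?V" by (simp add: PiE_iff)
  next
    fix z assume z: "z \<in> Pi\<^sub>E (carrier G) ?V"
    have "z i \<in> {0, 1} \<and> (i \<in> A \<longrightarrow> z i = w i)" if "i \<in> carrier G" for i
      using PiE_mem[OF z that] by (auto split: if_splits)
    then show "z \<in> {z \<in> arrays G. \<forall>a\<in>A. z a = w a}"
      using z assms(2) by (simp add: PiE_iff subset_iff)
  qed
  moreover have "finite {i \<in> carrier G. (if i \<in> A then {w i} \<inter> {0, 1} else {0, 1}) \<noteq> {0, 1}}"
    by (rule finite_subset[OF _ assms(1)]) auto
  ultimately show ?thesis
    unfolding full_shift_def by (simp add: openin_PiE_gen)
qed

lemma open_contains_cylinder:
  assumes "openin (full_shift G) U" "y \<in> U"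
  obtains A where "finite A" "A \<subseteq> carrier G"
    "\<And>z. z \<in> arrays G \<Longrightarrow> (\<And>a. a \<in> A \<Longrightarrow> z a = y a) \<Longrightarrow> z \<in> U"
proof -
  obtain V where V: "finite {i \<in> carrier G. V i \<noteq> {0, 1}}" "y \<in> Pi\<^sub>E (carrier G) V" "Pi\<^sub>E (carrier G) V \<subseteq> U"
    using assms unfolding full_shift_def openin_product_topology_alt by auto
  show thesis
  proof (rule that[OF V(1)])
    fix z assume z: "z \<in> arrays G" "\<And>a. a \<in> {i \<in> carrier G. V i \<noteq> {0, 1}} \<Longrightarrow> z a = y a"
    have "z i \<in> V i" if "i \<in> carrier G" for i
    proof (cases "V i = {0, 1}")
      case True
      then show ?thesis using z(1) that by (auto simp: PiE_iff)
    next
      case False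
      then show ?thesis using z(2)[of i] that V(2) by (auto simp: PiE_iff)
    qed
    then have "z \<in> Pi\<^sub>E (carrier G) V" using z(1) by (auto simp: PiE_iff)
    then show "z \<in> U" using V(3) by auto
  qed auto
qed

context group
begin

lemma shift_apply: "\<lbrakk>x \<in> X; h \<in> carrier G\<rbrakk> \<Longrightarrow> shift G X g x h = x (h \<otimes> g)"
  by (simp add: shift_def)

lemma shift_array: "\<lbrakk>x \<in> X; X \<subseteq> arrays G; g \<in> carrier G\<rbrakk> \<Longrightarrow> shift G X g x \<in> arrays G"
  by (auto simp: shift_def PiE_iff subset_iff)

lemma array_eqI: "\<lbrakk>y \<in> arrays G; z \<in> arrays G; \<And>h. h \<in> carrier G \<Longrightarrow> y h = z h\<rbrakk> \<Longrightarrow> y = z"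
  by (auto intro!: extensionalityI[of y "carrier G" z] simp: PiE_iff)

lemma in_orbit_closure_iff:
  assumes x: "x \<in> arrays G"
  shows "y \<in> orbit_closure G x \<longleftrightarrow> y \<in> arrays G \<and>
    (\<forall>A. finite A \<and> A \<subseteq> carrier G \<longrightarrow> (\<exists>g\<in>carrier G. \<forall>a\<in>A. y a = x (a \<otimes> g)))"
proof (intro iffI conjI allI impI)
  assume y: "y \<in> orbit_closure G x"
  then show yA: "y \<in> arrays G" by (simp add: orbit_closure_def in_closure_of)
  fix A assume A: "finite A \<and> A \<subseteq> carrier G"
  have "\<exists>z. z \<in> orbit G (shift G (arrays G)) x \<and> z \<in> {z \<in> arrays G. \<forall>a\<in>A. z a = y a}"
  proof -
    have "y \<in> {z \<in> arrays G. \<forall>a\<in>A. z a = y a}" using yA by simp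
    moreover have "openin (full_shift G) {z \<in> arrays G. \<forall>a\<in>A. z a = y a}"
      using A by (intro cylinder_open) auto
    ultimately show ?thesis using y unfolding orbit_closure_def in_closure_of by meson
  qed
  then obtain g where g: "g \<in> carrier G" "\<forall>a\<in>A. shift G (arrays G) g x a = y a"
    by (auto simp: orbit_def)
  have "y a = x (a \<otimes> g)" if "a \<in> A" for a
    using g(2) that A shift_apply[OF x, of a g] by auto
  then show "\<exists>g\<in>carrier G. \<forall>a\<in>A. y a = x (a \<otimes> g)" using g(1) by blast
next
  assume y: "y \<in> arrays G \<and> (\<forall>A. finite A \<and> A \<subseteq> carrier G \<longrightarrow> (\<exists>g\<in>carrier G. \<forall>a\<in>A. y a = x (a \<otimes> g)))"
  have key: "\<exists>z. z \<in> orbit G (shift G (arrays G)) x \<and> z \<in> U" if U: "y \<in> U" "openin (full_shift G) U" for U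
  proof -
    obtain A where A: "finite A" "A \<subseteq> carrier G"
      "\<And>z. z \<in> arrays G \<Longrightarrow> (\<And>a. a \<in> A \<Longrightarrow> z a = y a) \<Longrightarrow> z \<in> U"
      using open_contains_cylinder[OF U(2,1)] by metis
    obtain g where g: "g \<in> carrier G" "\<forall>a\<in>A. y a = x (a \<otimes> g)" using y A by blast
    have "shift G (arrays G) g x \<in> U"
    proof (rule A(3))
      show "shift G (arrays G) g x \<in> arrays G" by (rule shift_array[OF x order_refl g(1)])
      show "shift G (arrays G) g x a = y a" if "a \<in> A" for a
        using g(2) that A(2) shift_apply[OF x, of a g] by auto
    qed
    then show ?thesis using g(1) by (auto simp: orbit_def)
  qed
  show "y \<in> orbit_closure G x"
    unfolding orbit_closure_def in_closure_of topspace_full_shift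
  proof (intro conjI allI impI)
    show "y \<in> arrays G" by (rule conjunct1[OF y])
    show "\<exists>z. z \<in> orbit G (shift G (arrays G)) x \<and> z \<in> U" if "y \<in> U \<and> openin (full_shift G) U" for U
      using that by (intro key) simp_all
  qed
qed

lemma orbit_closure_arrays: "orbit_closure G x \<subseteq> arrays G"
  unfolding orbit_closure_def using closure_of_subset_topspace[of "full_shift G"] by simp

lemma shift_in_orbit_closure:
  assumes x: "x \<in> arrays G" and y: "y \<in> orbit_closure G x" and g: "g \<in> carrier G"
  shows "shift G (orbit_closure G x) g y \<in> orbit_closure G x"
  unfolding in_orbit_closure_iff[OF x]
proof (intro conjI allI impI)
  show "shift G (orbit_closure G x) g y \<in> arrays G"
    by (rule shift_array[OF y orbit_closure_arrays g])
  fix A assume A: "finite A \<and> A \<subseteq> carrier G"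
  then have "finite ((\<lambda>a. a \<otimes> g) ` A)" "(\<lambda>a. a \<otimes> g) ` A \<subseteq> carrier G" using g by auto
  then obtain h where h: "h \<in> carrier G" "\<forall>a\<in>(\<lambda>a. a \<otimes> g) ` A. y a = x (a \<otimes> h)"
    using y unfolding in_orbit_closure_iff[OF x] by meson
  have "shift G (orbit_closure G x) g y a = x (a \<otimes> (g \<otimes> h))" if "a \<in> A" for a
  proof -
    have aG: "a \<in> carrier G" using that A by auto
    then have "shift G (orbit_closure G x) g y a = y (a \<otimes> g)" by (rule shift_apply[OF y])
    also have "\<dots> = x (a \<otimes> g \<otimes> h)" using h(2) that by auto
    finally show ?thesis using aG g h(1) by (simp add: m_assoc)
  qed
  then show "\<exists>k\<in>carrier G. \<forall>a\<in>A. shift G (orbit_closure G x) g y a = x (a \<otimes> k)"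
    using g h(1) by (intro bexI[of _ "g \<otimes> h"]) auto
qed

lemma self_in_orbit_closure: "x \<in> arrays G \<Longrightarrow> x \<in> orbit_closure G x"
  unfolding in_orbit_closure_iff by (auto intro!: bexI[of _ \<one>] simp: subset_iff)

lemma orbit_closure_system:
  assumes count: "countable (carrier G)" and x: "x \<in> arrays G"
  shows "dynamical_system G (subtopology (full_shift G) (orbit_closure G x)) (shift G (orbit_closure G x))"
proof -
  let ?X = "orbit_closure G x"
  have XA: "?X \<subseteq> arrays G" by (rule orbit_closure_arrays)
  have top: "topspace (subtopology (full_shift G) ?X) = ?X" using XA by (simp add: inf.absorb2)
  have fs: "compact_space (full_shift G)" "metrizable_space (full_shift G)"
    unfolding full_shift_def compact_space_product_topology metrizable_space_product_topology
    using count by (auto simp: compact_space_discrete_topology metrizable_space_discrete_topology intro: countable_subset[of _ "carrier G"])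
  show ?thesis
    unfolding dynamical_system_def top
  proof (intro conjI ballI)
    have "closedin (full_shift G) ?X" unfolding orbit_closure_def by (rule closedin_closure_of)
    then show "compact_space (subtopology (full_shift G) ?X)"
      using fs(1) by (intro compact_space_subtopology closedin_compact_space)
    show "metrizable_space (subtopology (full_shift G) ?X)" using fs(2) by (rule metrizable_space_subtopology)
    show "group_action G ?X (shift G ?X)"
    proof (rule group_actionI[OF is_group])
      show "shift G ?X g \<in> extensional ?X" for g by (simp add: shift_def)
      show "shift G ?X g y \<in> ?X" if "g \<in> carrier G" "y \<in> ?X" for g y
        by (rule shift_in_orbit_closure[OF x that(2,1)])
      show "shift G ?X \<one> y = y" if y: "y \<in> ?X" for y
      proof (rule array_eqI)
        show "shift G ?X \<one> y \<in> arrays G" by (rule subsetD[OF XA shift_in_orbit_closure[OF x y one_closed]])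
        show "y \<in> arrays G" by (rule subsetD[OF XA y])
        show "shift G ?X \<one> y h = y h" if "h \<in> carrier G" for h using shift_apply[OF y that] that by simp
      qed
      show "shift G ?X (g \<otimes> h) y = shift G ?X g (shift G ?X h y)"
        if gh: "g \<in> carrier G" "h \<in> carrier G" and y: "y \<in> ?X" for g h y
      proof (rule array_eqI)
        have hy: "shift G ?X h y \<in> ?X" by (rule shift_in_orbit_closure[OF x y gh(2)])
        show "shift G ?X (g \<otimes> h) y \<in> arrays G"
          using gh by (intro subsetD[OF XA shift_in_orbit_closure[OF x y]]) simp
        show "shift G ?X g (shift G ?X h y) \<in> arrays G"
          by (rule subsetD[OF XA shift_in_orbit_closure[OF x hy gh(1)]])
        show "shift G ?X (g \<otimes> h) y k = shift G ?X g (shift G ?X h y) k" if k: "k \<in> carrier G" for k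
          using k gh by (simp add: shift_apply[OF y] shift_apply[OF hy] m_assoc)
      qed
    qed
    fix g assume g: "g \<in> carrier G"
    have "continuous_map (subtopology (full_shift G) ?X) (full_shift G) (\<lambda>y. \<lambda>h\<in>carrier G. y (h \<otimes> g))"
      unfolding full_shift_def continuous_map_componentwise
    proof (intro conjI ballI)
      fix k assume k: "k \<in> carrier G"
      have "continuous_map (subtopology (product_topology (\<lambda>_. discrete_topology {0, 1}) (carrier G)) ?X)
          (discrete_topology {0, 1}) (\<lambda>y. y (k \<otimes> g))"
        using k g by (intro continuous_map_from_subtopology continuous_map_product_projection) auto
      then show "continuous_map (subtopology (product_topology (\<lambda>_. discrete_topology {0, 1}) (carrier G)) ?X)
          (discrete_topology {0, 1}) (\<lambda>y. (\<lambda>h\<in>carrier G. y (h \<otimes> g)) k)"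
        using k by simp
    qed auto
    then have "continuous_map (subtopology (full_shift G) ?X) (full_shift G) (shift G ?X g)"
      by (rule continuous_map_eq) (simp add: top shift_def)
    then show "continuous_map (subtopology (full_shift G) ?X) (subtopology (full_shift G) ?X) (shift G ?X g)"
      using shift_in_orbit_closure[OF x _ g] by (auto simp: continuous_map_in_subtopology top)
  qed
qed

lemma words_orbit_closure:
  assumes x: "x \<in> arrays G" and F: "finite F" "F \<subseteq> carrier G"
  shows "words G F (orbit_closure G x) = (\<lambda>g. \<lambda>a\<in>F. x (a \<otimes> g)) ` carrier G"
proof (intro equalityI subsetI)
  fix w assume "w \<in> words G F (orbit_closure G x)"
  then obtain y h where w: "w \<in> F \<rightarrow>\<^sub>E {0, 1}" and y: "y \<in> orbit_closure G x"
    and h: "h \<in> carrier G" "\<forall>g\<in>F. y (g \<otimes> h) = w g"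
    by (auto simp: words_def occurs_in_def)
  have "finite ((\<lambda>a. a \<otimes> h) ` F)" "(\<lambda>a. a \<otimes> h) ` F \<subseteq> carrier G" using F h(1) by auto
  then obtain g where g: "g \<in> carrier G" "\<forall>a\<in>(\<lambda>a. a \<otimes> h) ` F. y a = x (a \<otimes> g)"
    using y unfolding in_orbit_closure_iff[OF x] by meson
  have "w = (\<lambda>a\<in>F. x (a \<otimes> (h \<otimes> g)))"
  proof (rule extensionalityI[of _ F])
    fix a assume a: "a \<in> F"
    then have "w a = x (a \<otimes> h \<otimes> g)" using h(2) g(2) by force
    then show "w a = (\<lambda>a\<in>F. x (a \<otimes> (h \<otimes> g))) a" using a F(2) h(1) g(1) by (auto simp: m_assoc)
  qed (use w in \<open>auto simp: PiE_iff\<close>)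
  then show "w \<in> (\<lambda>g. \<lambda>a\<in>F. x (a \<otimes> g)) ` carrier G" using h(1) g(1) by blast
next
  fix w assume "w \<in> (\<lambda>g. \<lambda>a\<in>F. x (a \<otimes> g)) ` carrier G"
  then obtain g where g: "g \<in> carrier G" "w = (\<lambda>a\<in>F. x (a \<otimes> g))" by auto
  have "x (a \<otimes> g) \<in> {0, 1}" if "a \<in> F" for a using x F(2) g(1) that by (auto simp: PiE_iff)
  then have "w \<in> F \<rightarrow>\<^sub>E {0, 1}" using g(2) by (auto simp: PiE_iff)
  moreover have "occurs_in G F w x" using g by (auto simp: occurs_in_def)
  ultimately show "w \<in> words G F (orbit_closure G x)"
    using self_in_orbit_closure[OF x] by (auto simp: words_def)
qed

end

section \<open>Maximal equicontinuous factors\<close>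

text \<open>Let \<open>\<phi>\<close> be a factor map onto an equicontinuous system and \<open>\<pi> y = \<pi> y'\<close>. Some \<open>g\<close> brings the common
  image close to \<open>\<pi> x\<close>. Since the fibre through \<open>x\<close> is a singleton and \<open>\<pi>\<close> is closed, both \<open>g y\<close> and
  \<open>g y'\<close> are then close to \<open>x\<close>, so \<open>\<phi> (g y)\<close> and \<open>\<phi> (g y')\<close> are close. Applying the inverse of \<open>g\<close>,
  equicontinuity makes \<open>\<phi> y\<close> and \<open>\<phi> y'\<close> arbitrarily close. Thus \<open>\<phi>\<close> factors through \<open>\<pi>\<close>.\<close>

lemma singleton_fibre_imp_maximal_equicontinuous_factor:
  fixes T :: "'a topology"
  assumes fm: "factor_map G T \<alpha> S \<beta> \<pi>" and eqS: "equicontinuous_system G S \<beta>"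
    and x: "x \<in> topspace T" and fibre: "\<And>y. y \<in> topspace T \<Longrightarrow> \<pi> y = \<pi> x \<Longrightarrow> y = x"
    and recurrent: "\<And>s U. s \<in> topspace S \<Longrightarrow> openin S U \<Longrightarrow> \<pi> x \<in> U \<Longrightarrow> \<exists>g\<in>carrier G. \<beta> g s \<in> U"
  shows "maximal_equicontinuous_factor G T \<alpha> S \<beta> \<pi>"
  unfolding maximal_equicontinuous_factor_def
proof (intro conjI allI impI fm eqS)
  fix Z :: "'a topology" and \<gamma> \<phi>
  assume Z: "equicontinuous_system G Z \<gamma> \<and> factor_map G T \<alpha> Z \<gamma> \<phi>"
  have dsT: "dynamical_system G T \<alpha>" and dsS: "dynamical_system G S \<beta>" and dsZ: "dynamical_system G Z \<gamma>"
    and \<pi>: "continuous_map T S \<pi>" "\<pi> ` topspace T = topspace S"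
    and \<pi>eq: "\<And>g y. g \<in> carrier G \<Longrightarrow> y \<in> topspace T \<Longrightarrow> \<pi> (\<alpha> g y) = \<beta> g (\<pi> y)"
    and \<phi>: "continuous_map T Z \<phi>" "\<phi> ` topspace T = topspace Z"
    and \<phi>eq: "\<And>g y. g \<in> carrier G \<Longrightarrow> y \<in> topspace T \<Longrightarrow> \<phi> (\<alpha> g y) = \<gamma> g (\<phi> y)"
    using fm Z by (auto simp: factor_map_def)
  interpret aT: group_action G "topspace T" \<alpha> using dsT by (simp add: dynamical_system_def)
  interpret aZ: group_action G "topspace Z" \<gamma> using dsZ by (simp add: dynamical_system_def)
  interpret G: group G using aT.group_hom by (simp add: group_hom_def)
  obtain d where d: "Metric_space (topspace Z) d" "Metric_space.mtopology (topspace Z) d = Z"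
    and eqc: "\<And>\<epsilon>. \<epsilon> > 0 \<Longrightarrow> \<exists>\<delta>>0. \<forall>y \<in> topspace Z. \<forall>y' \<in> topspace Z.
           d y y' < \<delta> \<longrightarrow> (\<forall>g \<in> carrier G. d (\<gamma> g y) (\<gamma> g y') < \<epsilon>)"
    using Z unfolding equicontinuous_system_def by metis
  interpret dZ: Metric_space "topspace Z" d by fact
  have closed_\<pi>: "closed_map T S \<pi>"
    using dsT dsS \<pi>(1) by (intro T1_Spaces.continuous_imp_closed_map metrizable_imp_Hausdorff_space)
      (auto simp: dynamical_system_def)
  have \<phi>Z: "\<phi> y \<in> topspace Z" if "y \<in> topspace T" for y using \<phi>(2) that by auto
  have collapse: "\<phi> y = \<phi> y'" if y: "y \<in> topspace T" "y' \<in> topspace T" "\<pi> y = \<pi> y'" for y y'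
  proof (rule ccontr)
    assume "\<phi> y \<noteq> \<phi> y'"
    then have "d (\<phi> y) (\<phi> y') > 0" using \<phi>Z y by auto
    then obtain \<delta> where \<delta>: "\<delta> > 0" "\<And>z z' g. z \<in> topspace Z \<Longrightarrow> z' \<in> topspace Z \<Longrightarrow> d z z' < \<delta> \<Longrightarrow>
        g \<in> carrier G \<Longrightarrow> d (\<gamma> g z) (\<gamma> g z') < d (\<phi> y) (\<phi> y')"
      using eqc by metis
    define V where "V = {v \<in> topspace T. \<phi> v \<in> dZ.mball (\<phi> x) (\<delta>/2)}"
    have V: "openin T V"
      unfolding V_def using \<phi>(1) d(2) dZ.openin_mball by (intro openin_continuous_map_preimage[of T Z]) metis+
    have xV: "x \<in> V" using x \<phi>Z \<delta>(1) by (auto simp: V_def)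
    define O' where "O' = topspace S - \<pi> ` (topspace T - V)"
    have "closedin S (\<pi> ` (topspace T - V))"
      using closed_\<pi> V by (auto simp: closed_map_def)
    then have "openin S O'" unfolding O'_def by (rule openin_diff[OF openin_topspace])
    moreover have "\<pi> x \<in> O'" unfolding O'_def using x \<pi>(2) fibre xV by (auto dest: sym)
    moreover have "\<pi> y \<in> topspace S" using y \<pi>(2) by auto
    ultimately obtain g where g: "g \<in> carrier G" "\<beta> g (\<pi> y) \<in> O'" using recurrent by blast
    have inV: "\<alpha> g v \<in> V" if v: "v \<in> topspace T" "\<pi> v = \<pi> y" for v
    proof (rule ccontr)
      assume "\<alpha> g v \<notin> V"
      moreover have "\<alpha> g v \<in> topspace T" using aT.element_image[OF g(1) v(1)] by blast
      ultimately have "\<pi> (\<alpha> g v) \<notin> O'" by (auto simp: O'_def)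
      then show False using g \<pi>eq[OF g(1) v(1)] v(2) by simp
    qed
    have "d (\<gamma> g (\<phi> y)) (\<phi> x) < \<delta>/2" "d (\<gamma> g (\<phi> y')) (\<phi> x) < \<delta>/2"
      and Z2: "\<gamma> g (\<phi> y) \<in> topspace Z" "\<gamma> g (\<phi> y') \<in> topspace Z"
      using inV[of y] inV[of y'] y \<phi>eq[OF g(1)] by (auto simp: V_def dZ.commute)
    then have "d (\<gamma> g (\<phi> y)) (\<gamma> g (\<phi> y')) < \<delta>"
      using dZ.triangle[of "\<gamma> g (\<phi> y)" "\<phi> x" "\<gamma> g (\<phi> y')"] \<phi>Z[OF x] by (simp add: dZ.commute)
    then have "d (\<gamma> (inv\<^bsub>G\<^esub> g) (\<gamma> g (\<phi> y))) (\<gamma> (inv\<^bsub>G\<^esub> g) (\<gamma> g (\<phi> y'))) < d (\<phi> y) (\<phi> y')"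
      using g(1) Z2 by (intro \<delta>(2)) auto
    moreover have "\<gamma> (inv\<^bsub>G\<^esub> g) (\<gamma> g z) = z" if "z \<in> topspace Z" for z
      using aZ.orbit_sym_aux[OF g(1) that refl] .
    ultimately show False using \<phi>Z y by simp
  qed
  have quot: "quotient_map T S \<pi>"
    using closed_\<pi> \<pi> by (intro continuous_closed_imp_quotient_map)
  obtain \<psi> where \<psi>: "continuous_map S Z \<psi>" "\<psi> ` topspace S = \<phi> ` topspace T"
      "\<And>y. y \<in> topspace T \<Longrightarrow> \<psi> (\<pi> y) = \<phi> y"
    by (rule quotient_map_lift_exists[OF quot \<phi>(1)]) (erule (2) collapse, blast intro: that)
  have "\<psi> (\<beta> g s) = \<gamma> g (\<psi> s)" if g: "g \<in> carrier G" and s: "s \<in> topspace S" for g s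
  proof -
    obtain y where y: "y \<in> topspace T" "s = \<pi> y" using s \<pi>(2) by auto
    have "\<alpha> g y \<in> topspace T" using aT.element_image[OF g y(1)] by blast
    then show ?thesis using y \<psi>(3) \<pi>eq[OF g y(1)] \<phi>eq[OF g y(1)] by metis
  qed
  then have "factor_map G S \<beta> Z \<gamma> \<psi>"
    using dsS dsZ \<psi> \<phi>(2) by (simp add: factor_map_def)
  then show "\<exists>\<psi>. factor_map G S \<beta> Z \<gamma> \<psi> \<and> (\<forall>x\<in>topspace T. \<phi> x = \<psi> (\<pi> x))"
    using \<psi>(3) by auto
qed

section \<open>The array coded by an aperiodic window\<close>

locale aperiodic_window = compactified_group G H d \<tau>
  for G :: "('g, 'm) monoid_scheme" and H :: "('h, 'n) monoid_scheme" and d \<tau> +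
  fixes W E :: "'h set"
  assumes E_closed: "closedin mtopology E"
    and E_misses: "E \<inter> \<tau> ` carrier G = {}"
    and locally_constant: "x \<in> carrier H - E \<Longrightarrow>
        \<exists>e>0. \<forall>y\<in>carrier H. d x y < e \<longrightarrow> y \<notin> E \<and> (y \<in> W \<longleftrightarrow> x \<in> W)"
    and aperiodic: "\<lbrakk>\<kappa> \<in> carrier H; \<kappa> \<noteq> \<one>\<^bsub>H\<^esub>\<rbrakk> \<Longrightarrow>
        \<exists>z\<in>carrier H. z \<notin> E \<and> z \<otimes>\<^bsub>H\<^esub> \<kappa> \<notin> E \<and> (z \<in> W \<longleftrightarrow> z \<otimes>\<^bsub>H\<^esub> \<kappa> \<notin> W)"
begin

definition coded_array :: "'g \<Rightarrow> nat" where
  "coded_array = (\<lambda>g\<in>carrier G. of_bool (\<tau> g \<in> W))"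

abbreviation X where "X \<equiv> orbit_closure G coded_array"

lemma coded_array_apply: "g \<in> carrier G \<Longrightarrow> coded_array g = of_bool (\<tau> g \<in> W)"
  by (simp add: coded_array_def)

lemma coded_array: "coded_array \<in> arrays G"
  by (auto simp: coded_array_def PiE_iff)

text \<open>The entries at the times when the orbit of \<open>\<xi>\<close> meets \<open>E\<close> are left open. This makes the relation closed.\<close>

definition fits :: "('g \<Rightarrow> nat) \<Rightarrow> 'h \<Rightarrow> bool" where
  "fits y \<xi> \<longleftrightarrow> \<xi> \<in> carrier H \<and>
     (\<forall>h\<in>carrier G. \<tau> h \<otimes>\<^bsub>H\<^esub> \<xi> \<notin> E \<longrightarrow> y h = of_bool (\<tau> h \<otimes>\<^bsub>H\<^esub> \<xi> \<in> W))"

lemma fits_translate: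
  assumes "\<And>h. h \<in> carrier G \<Longrightarrow> z h = y (h \<otimes>\<^bsub>G\<^esub> g)" "fits y \<xi>" "g \<in> carrier G"
  shows "fits z (\<tau> g \<otimes>\<^bsub>H\<^esub> \<xi>)"
  using assms by (auto simp: fits_def tau_mult H.m_assoc)

lemma fits_coded_array: "fits coded_array \<one>\<^bsub>H\<^esub>"
  by (auto simp: fits_def coded_array_apply)

lemma fits_limit:
  assumes fits: "\<And>n. fits (y n) (\<xi> n)" and lim: "(\<lambda>n. d (\<xi> n) \<eta>) \<longlonglongrightarrow> 0" and \<eta>: "\<eta> \<in> carrier H"
    and y: "\<And>h. h \<in> carrier G \<Longrightarrow> \<forall>\<^sub>F n in sequentially. y n h = z h"
  shows "fits z \<eta>"
  unfolding fits_def
proof (intro conjI ballI impI \<eta>)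
  fix h assume h: "h \<in> carrier G" "\<tau> h \<otimes>\<^bsub>H\<^esub> \<eta> \<notin> E"
  have \<xi>: "\<xi> n \<in> carrier H" for n using fits by (simp add: fits_def)
  obtain e where e: "e > 0" "\<And>v. v \<in> carrier H \<Longrightarrow> d (\<tau> h \<otimes>\<^bsub>H\<^esub> \<eta>) v < e \<Longrightarrow>
      v \<notin> E \<and> (v \<in> W \<longleftrightarrow> \<tau> h \<otimes>\<^bsub>H\<^esub> \<eta> \<in> W)"
    using locally_constant[of "\<tau> h \<otimes>\<^bsub>H\<^esub> \<eta>"] h \<eta> by auto
  have "\<forall>\<^sub>F n in sequentially. z h = of_bool (\<tau> h \<otimes>\<^bsub>H\<^esub> \<eta> \<in> W)"
    using y[OF h(1)] order_tendstoD(2)[OF lim e(1)]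
  proof eventually_elim
    case (elim n)
    have "d (\<tau> h \<otimes>\<^bsub>H\<^esub> \<eta>) (\<tau> h \<otimes>\<^bsub>H\<^esub> \<xi> n) < e"
      using elim(2) h(1) \<xi> \<eta> by (simp add: d_left commute)
    then have "\<tau> h \<otimes>\<^bsub>H\<^esub> \<xi> n \<notin> E" "\<tau> h \<otimes>\<^bsub>H\<^esub> \<xi> n \<in> W \<longleftrightarrow> \<tau> h \<otimes>\<^bsub>H\<^esub> \<eta> \<in> W"
      using e(2)[of "\<tau> h \<otimes>\<^bsub>H\<^esub> \<xi> n"] h(1) \<xi> by auto
    then show ?case using fits[of n] h(1) elim(1) by (simp add: fits_def)
  qed
  then show "z h = of_bool (\<tau> h \<otimes>\<^bsub>H\<^esub> \<eta> \<in> W)" by simp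
qed

text \<open>The point \<open>z\<close> provided by aperiodicity for the quotient of \<open>\<xi>\<close> and \<open>\<eta>\<close> is approximated by \<open>\<tau> h \<xi>\<close>; then
  \<open>\<tau> h \<eta>\<close> approximates its translate, and the two prescribe different entries at \<open>h\<close>.\<close>

lemma fits_unique:
  assumes "fits y \<xi>" "fits y \<eta>"
  shows "\<xi> = \<eta>"
proof (rule ccontr)
  assume "\<xi> \<noteq> \<eta>"
  have H: "\<xi> \<in> carrier H" "\<eta> \<in> carrier H" using assms by (auto simp: fits_def)
  define \<kappa> where "\<kappa> = inv\<^bsub>H\<^esub> \<xi> \<otimes>\<^bsub>H\<^esub> \<eta>"
  have \<kappa>: "\<kappa> \<in> carrier H" "\<eta> = \<xi> \<otimes>\<^bsub>H\<^esub> \<kappa>" using H by (auto simp: \<kappa>_def simp flip: H.m_assoc)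
  then have "\<kappa> \<noteq> \<one>\<^bsub>H\<^esub>" using \<open>\<xi> \<noteq> \<eta>\<close> H by auto
  then obtain z where z: "z \<in> carrier H" "z \<notin> E" "z \<otimes>\<^bsub>H\<^esub> \<kappa> \<notin> E" "z \<in> W \<longleftrightarrow> z \<otimes>\<^bsub>H\<^esub> \<kappa> \<notin> W"
    using aperiodic[OF \<kappa>(1)] by blast
  obtain e1 where e1: "e1 > 0" "\<And>v. v \<in> carrier H \<Longrightarrow> d z v < e1 \<Longrightarrow> v \<notin> E \<and> (v \<in> W \<longleftrightarrow> z \<in> W)"
    using locally_constant[of z] z by auto
  obtain e2 where e2: "e2 > 0" "\<And>v. v \<in> carrier H \<Longrightarrow> d (z \<otimes>\<^bsub>H\<^esub> \<kappa>) v < e2 \<Longrightarrow>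
      v \<notin> E \<and> (v \<in> W \<longleftrightarrow> z \<otimes>\<^bsub>H\<^esub> \<kappa> \<in> W)"
    using locally_constant[of "z \<otimes>\<^bsub>H\<^esub> \<kappa>"] z \<kappa> by auto
  obtain h where h: "h \<in> carrier G" "d (\<tau> h) (z \<otimes>\<^bsub>H\<^esub> inv\<^bsub>H\<^esub> \<xi>) < min e1 e2"
    using tau_dense[of "z \<otimes>\<^bsub>H\<^esub> inv\<^bsub>H\<^esub> \<xi>" "min e1 e2"] z H e1(1) e2(1) by auto
  have hH: "\<tau> h \<otimes>\<^bsub>H\<^esub> \<xi> \<in> carrier H" "\<tau> h \<otimes>\<^bsub>H\<^esub> \<eta> \<in> carrier H" using h H by auto
  have z\<xi>: "d z (\<tau> h \<otimes>\<^bsub>H\<^esub> \<xi>) < min e1 e2"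
    using d_right[of \<xi> "\<tau> h" "z \<otimes>\<^bsub>H\<^esub> inv\<^bsub>H\<^esub> \<xi>"] h z H by (simp add: H.m_assoc commute)
  have "\<tau> h \<otimes>\<^bsub>H\<^esub> \<eta> = (\<tau> h \<otimes>\<^bsub>H\<^esub> \<xi>) \<otimes>\<^bsub>H\<^esub> \<kappa>" using \<kappa> H h by (simp add: H.m_assoc)
  then have z\<eta>: "d (z \<otimes>\<^bsub>H\<^esub> \<kappa>) (\<tau> h \<otimes>\<^bsub>H\<^esub> \<eta>) < min e1 e2"
    using z\<xi> d_right[of \<kappa> z "\<tau> h \<otimes>\<^bsub>H\<^esub> \<xi>"] hH z \<kappa> by simp
  have "y h = of_bool (z \<in> W)" "y h = of_bool (z \<otimes>\<^bsub>H\<^esub> \<kappa> \<in> W)"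
    using assms e1(2)[OF hH(1)] e2(2)[OF hH(2)] z\<xi> z\<eta> h(1) by (auto simp: fits_def)
  then show False using z(4) by (cases "z \<in> W") auto
qed

text \<open>Approximate \<open>y\<close> on longer and longer parts of \<open>G\<close> by translates of the array and take a limit of their
  phases.\<close>

lemma fits_exists:
  assumes y: "y \<in> X"
  shows "\<exists>\<xi>. fits y \<xi>"
proof -
  define e where "e = from_nat_into (carrier G)"
  have e: "e n \<in> carrier G" for n
    unfolding e_def using G.one_closed by (intro from_nat_into) auto
  have "\<exists>g\<in>carrier G. \<forall>a\<in>e ` {..n}. y a = coded_array (a \<otimes>\<^bsub>G\<^esub> g)" for n
  proof -
    have "finite (e ` {..n}) \<and> e ` {..n} \<subseteq> carrier G" using e by auto
    then show ?thesis using y unfolding G.in_orbit_closure_iff[OF coded_array] by blast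
  qed
  then obtain g where g: "\<And>n. g n \<in> carrier G" "\<And>n k. k \<le> n \<Longrightarrow> y (e k) = coded_array (e k \<otimes>\<^bsub>G\<^esub> g n)"
    by (metis atMost_iff imageI)
  obtain \<xi> r where \<xi>: "\<xi> \<in> carrier H" and r: "strict_mono (r :: nat \<Rightarrow> nat)"
    and lim: "(\<lambda>n. d (\<tau> (g (r n))) \<xi>) \<longlonglongrightarrow> 0"
    using convergent_subsequence[of "\<lambda>n. \<tau> (g n)"] g(1) by auto
  have "fits y \<xi>"
  proof (rule fits_limit[OF _ lim \<xi>])
    show "fits (\<lambda>h\<in>carrier G. coded_array (h \<otimes>\<^bsub>G\<^esub> g (r n))) (\<tau> (g (r n)))" for n
      using fits_translate[OF _ fits_coded_array g(1)[of "r n"],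
          of "\<lambda>h\<in>carrier G. coded_array (h \<otimes>\<^bsub>G\<^esub> g (r n))"] g(1)[of "r n"] by simp
    fix h assume h: "h \<in> carrier G"
    then obtain k where k: "h = e k" unfolding e_def using G_countable from_nat_into_surj by metis
    have "\<forall>\<^sub>F n in sequentially. k \<le> n" by (rule eventually_ge_at_top)
    then show "\<forall>\<^sub>F n in sequentially. (\<lambda>h\<in>carrier G. coded_array (h \<otimes>\<^bsub>G\<^esub> g (r n))) h = y h"
    proof eventually_elim
      case (elim n)
      then have "k \<le> r n" using seq_suble[OF r, of n] by simp
      then show ?case using g(2) h k by simp
    qed
  qed
  then show ?thesis by blast
qed

definition phase :: "('g \<Rightarrow> nat) \<Rightarrow> 'h" where
  "phase y = (THE \<xi>. fits y \<xi>)"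

lemma phase_eqI: "fits y \<xi> \<Longrightarrow> phase y = \<xi>"
  unfolding phase_def using fits_unique by (intro the_equality)

lemma fits_phase: "y \<in> X \<Longrightarrow> fits y (phase y)"
  using fits_exists phase_eqI by metis

lemma phase_closed: "y \<in> X \<Longrightarrow> phase y \<in> carrier H"
  using fits_phase by (simp add: fits_def)

lemma phase_coded_array: "phase coded_array = \<one>\<^bsub>H\<^esub>"
  by (rule phase_eqI[OF fits_coded_array])

lemma phase_shift:
  assumes "y \<in> X" "g \<in> carrier G"
  shows "phase (shift G X g y) = \<tau> g \<otimes>\<^bsub>H\<^esub> phase y"
  by (rule phase_eqI, rule fits_translate[OF _ fits_phase]) (use assms G.shift_apply[OF assms(1)] in auto)

lemma phase_fibre:
  assumes y: "y \<in> X" "phase y = \<one>\<^bsub>H\<^esub>"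
  shows "y = coded_array"
proof (rule G.array_eqI)
  show "y \<in> arrays G" using y(1) by (rule subsetD[OF G.orbit_closure_arrays])
  show "coded_array \<in> arrays G" by (rule coded_array)
  show "y h = coded_array h" if h: "h \<in> carrier G" for h
  proof -
    have "\<tau> h \<notin> E" using E_misses h by auto
    then show ?thesis using fits_phase[OF y(1)] h y(2) by (simp add: fits_def coded_array_apply)
  qed
qed

text \<open>Closedness of the relation and uniqueness of the phase give continuity, as for a closed graph in a
  compact space.\<close>

lemma phase_locally_determined:
  assumes y: "y \<in> X" and "\<epsilon> > 0"
  shows "\<exists>A. finite A \<and> A \<subseteq> carrier G \<and> (\<forall>z\<in>X. (\<forall>a\<in>A. z a = y a) \<longrightarrow> d (phase y) (phase z) < \<epsilon>)"
proof (rule ccontr)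
  assume contr: "\<not> ?thesis"
  define e where "e = from_nat_into (carrier G)"
  have e: "e n \<in> carrier G" for n
    unfolding e_def using G.one_closed by (intro from_nat_into) auto
  have "\<exists>z\<in>X. (\<forall>a\<in>e ` {..n}. z a = y a) \<and> \<epsilon> \<le> d (phase y) (phase z)" for n
  proof -
    have "finite (e ` {..n})" "e ` {..n} \<subseteq> carrier G" using e by auto
    then show ?thesis using contr by (meson not_le)
  qed
  then obtain z where z: "\<And>n. z n \<in> X" "\<And>n k. k \<le> n \<Longrightarrow> z n (e k) = y (e k)"
      "\<And>n. \<epsilon> \<le> d (phase y) (phase (z n))"
    by (metis atMost_iff imageI)
  obtain \<xi> r where \<xi>: "\<xi> \<in> carrier H" and r: "strict_mono (r :: nat \<Rightarrow> nat)"
    and lim: "(\<lambda>n. d (phase (z (r n))) \<xi>) \<longlonglongrightarrow> 0"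
    using convergent_subsequence[of "\<lambda>n. phase (z n)"] phase_closed[OF z(1)] by auto
  have "fits y \<xi>"
  proof (rule fits_limit[OF fits_phase[OF z(1)] lim \<xi>])
    fix h assume h: "h \<in> carrier G"
    then obtain k where k: "h = e k" unfolding e_def using G_countable from_nat_into_surj by metis
    have "\<forall>\<^sub>F n in sequentially. k \<le> n" by (rule eventually_ge_at_top)
    then show "\<forall>\<^sub>F n in sequentially. z (r n) h = y h"
    proof eventually_elim
      case (elim n)
      then have "k \<le> r n" using seq_suble[OF r, of n] by simp
      then show ?case using z(2) k by simp
    qed
  qed
  then have "phase y = \<xi>" by (rule phase_eqI)
  obtain n where "d (phase (z (r n))) \<xi> < \<epsilon>"
    using order_tendstoD(2)[OF lim \<open>\<epsilon> > 0\<close>] by (auto simp: eventually_sequentially)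
  then show False using z(3)[of "r n"] \<open>phase y = \<xi>\<close> by (simp add: commute)
qed

lemma topspace_X: "topspace (subtopology (full_shift G) X) = X"
  using G.orbit_closure_arrays by (simp add: inf.absorb2)

lemma phase_continuous: "continuous_map (subtopology (full_shift G) X) mtopology phase"
  unfolding continuous_map_to_metric topspace_X
proof (intro ballI allI impI)
  fix y and \<epsilon> :: real assume y: "y \<in> X" and "\<epsilon> > 0"
  obtain A where A: "finite A" "A \<subseteq> carrier G"
    "\<forall>z\<in>X. (\<forall>a\<in>A. z a = y a) \<longrightarrow> d (phase y) (phase z) < \<epsilon>"
    using phase_locally_determined[OF y \<open>\<epsilon> > 0\<close>] by blast
  let ?U = "{z \<in> arrays G. \<forall>a\<in>A. z a = y a} \<inter> X"
  have "openin (subtopology (full_shift G) X) ?U"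
    by (intro openin_subtopology_Int cylinder_open A)
  moreover have "y \<in> ?U" using y subsetD[OF G.orbit_closure_arrays y] by simp
  moreover have "\<forall>z\<in>?U. phase z \<in> mball (phase y) \<epsilon>" using A(3) y phase_closed by simp
  ultimately show "\<exists>U. openin (subtopology (full_shift G) X) U \<and> y \<in> U \<and> (\<forall>z\<in>U. phase z \<in> mball (phase y) \<epsilon>)"
    by blast
qed

lemma rotation_equicontinuous: "equicontinuous_system G mtopology (rotation H \<tau>)"
proof -
  have lip: "d (rotation H \<tau> g \<xi>) (rotation H \<tau> g \<eta>) = d \<xi> \<eta>"
    if "g \<in> carrier G" "\<xi> \<in> carrier H" "\<eta> \<in> carrier H" for g \<xi> \<eta>
    using that by (simp add: rotation_def d_left)
  have "dynamical_system G mtopology (rotation H \<tau>)"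
    unfolding dynamical_system_def topspace_mtopology
  proof (intro conjI ballI H_compact metrizable_space_mtopology)
    show "group_action G (carrier H) (rotation H \<tau>)"
      by (rule group_actionI[OF G.is_group]) (auto simp: rotation_def tau_one tau_mult H.m_assoc)
    fix g assume g: "g \<in> carrier G"
    show "continuous_map mtopology mtopology (rotation H \<tau> g)"
      unfolding continuous_map_to_metric topspace_mtopology
    proof (intro ballI allI impI)
      fix \<xi> and \<epsilon> :: real assume \<xi>: "\<xi> \<in> carrier H" and "\<epsilon> > 0"
      have "rotation H \<tau> g \<eta> \<in> mball (rotation H \<tau> g \<xi>) \<epsilon>" if "\<eta> \<in> mball \<xi> \<epsilon>" for \<eta>
        using that g lip[OF g] by (auto simp: rotation_def)
      then show "\<exists>U. openin mtopology U \<and> \<xi> \<in> U \<and> (\<forall>\<eta>\<in>U. rotation H \<tau> g \<eta> \<in> mball (rotation H \<tau> g \<xi>) \<epsilon>)"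
        using \<xi> \<open>\<epsilon> > 0\<close> by (intro exI[of _ "mball \<xi> \<epsilon>"]) auto
    qed
  qed
  then show ?thesis
    unfolding equicontinuous_system_def topspace_mtopology using lip Metric_space_axioms
    by (intro conjI exI[of _ d]) auto
qed

lemma phase_factor_map:
  "factor_map G (subtopology (full_shift G) X) (shift G X) mtopology (rotation H \<tau>) phase"
  unfolding factor_map_def topspace_X topspace_mtopology
proof (intro conjI ballI)
  show ds: "dynamical_system G (subtopology (full_shift G) X) (shift G X)"
    by (rule G.orbit_closure_system[OF G_countable coded_array])
  show "dynamical_system G mtopology (rotation H \<tau>)"
    using rotation_equicontinuous by (simp add: equicontinuous_system_def)
  show "continuous_map (subtopology (full_shift G) X) mtopology phase" by (rule phase_continuous)
  show "phase (shift G X g y) = rotation H \<tau> g (phase y)" if "g \<in> carrier G" "y \<in> X" for g y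
    using phase_shift[OF that(2,1)] phase_closed[OF that(2)] by (simp add: rotation_def)
  have "compactin mtopology (phase ` X)"
    using image_compactin[of "subtopology (full_shift G) X" X, OF _ phase_continuous] ds
    by (simp add: dynamical_system_def compact_space_def topspace_X[simplified])
  then have closed: "closedin mtopology (phase ` X)"
    using compactin_imp_closedin Hausdorff_space_mtopology by blast
  show "phase ` X = carrier H"
  proof (intro equalityI subsetI)
    fix \<xi> assume \<xi>: "\<xi> \<in> carrier H"
    show "\<xi> \<in> phase ` X"
    proof (rule ccontr)
      assume "\<xi> \<notin> phase ` X"
      then obtain r where r: "r > 0" "\<And>y. y \<in> carrier H \<Longrightarrow> d y \<xi> < r \<Longrightarrow> y \<notin> phase ` X"
        using closed_positive_distance[OF closed, of \<xi>] \<xi> by auto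
      obtain g where g: "g \<in> carrier G" "d (\<tau> g) \<xi> < r" using tau_dense[OF \<xi> r(1)] by blast
      have xX: "coded_array \<in> X" by (rule G.self_in_orbit_closure[OF coded_array])
      have "phase (shift G X g coded_array) = \<tau> g"
        using phase_shift[OF xX g(1)] g by (simp add: phase_coded_array)
      moreover have "shift G X g coded_array \<in> X"
        by (rule G.shift_in_orbit_closure[OF coded_array xX g(1)])
      ultimately show False using r(2)[of "\<tau> g"] g by (metis imageI tau_closed)
    qed
  qed (use phase_closed in auto)
qed

theorem coded_array_almost_automorphic:
  "almost_automorphic G coded_array mtopology (rotation H \<tau>)"
proof -
  have xX: "coded_array \<in> X" by (rule G.self_in_orbit_closure[OF coded_array])
  have "maximal_equicontinuous_factor G (subtopology (full_shift G) X) (shift G X) mtopology (rotation H \<tau>) phase"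
  proof (rule singleton_fibre_imp_maximal_equicontinuous_factor[OF phase_factor_map rotation_equicontinuous, of coded_array])
    show "coded_array \<in> topspace (subtopology (full_shift G) X)" unfolding topspace_X by (rule xX)
    show "y = coded_array" if "y \<in> topspace (subtopology (full_shift G) X)" "phase y = phase coded_array" for y
      using that phase_fibre unfolding topspace_X phase_coded_array by blast
    fix \<xi> U assume \<xi>: "\<xi> \<in> topspace mtopology" and U: "openin mtopology U" "phase coded_array \<in> U"
    obtain r where r: "r > 0" "mball \<one>\<^bsub>H\<^esub> r \<subseteq> U"
      using U unfolding openin_mtopology phase_coded_array by blast
    have \<xi>H: "\<xi> \<in> carrier H" using \<xi> by simp
    obtain g where g: "g \<in> carrier G" "d (\<tau> g) (inv\<^bsub>H\<^esub> \<xi>) < r"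
      using tau_dense[of "inv\<^bsub>H\<^esub> \<xi>" r] \<xi>H r(1) by auto
    have "d \<one>\<^bsub>H\<^esub> (\<tau> g \<otimes>\<^bsub>H\<^esub> \<xi>) < r"
      using d_right[of \<xi> "\<tau> g" "inv\<^bsub>H\<^esub> \<xi>"] g \<xi>H by (simp add: commute)
    then have "rotation H \<tau> g \<xi> \<in> U" using r(2) g(1) \<xi>H by (auto simp: rotation_def)
    then show "\<exists>g\<in>carrier G. rotation H \<tau> g \<xi> \<in> U" using g(1) by blast
  qed
  moreover have "{y \<in> X. phase y = phase coded_array} = {coded_array}"
    using xX phase_fibre by (auto simp: phase_coded_array)
  ultimately show ?thesis unfolding almost_automorphic_def Let_def by blast
qed

end

section \<open>Entropy\<close>

text \<open>A nonempty finite set of bounded size that is almost invariant under a finite set \<open>B\<close> is invariant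
  under it, and then contains a copy of \<open>B\<close>.\<close>

lemma (in group) Folner_card_at_top:
  assumes "infinite (carrier G)" and Fol: "Folner_sequence G \<Phi>"
  shows "filterlim (\<lambda>n. real (card (\<Phi> n))) at_top sequentially"
  unfolding filterlim_at_top
proof
  fix Z :: real
  obtain N :: nat where N: "Z \<le> real N" using real_arch_simple by blast
  obtain B where B: "B \<subseteq> carrier G" "finite B" "card B = Suc N"
    using infinite_arbitrarily_large[OF assms(1)] by metis
  have \<Phi>: "finite (\<Phi> n)" "\<Phi> n \<noteq> {}" "\<Phi> n \<subseteq> carrier G" for n
    using Fol by (auto simp: Folner_sequence_def)
  have "\<forall>\<^sub>F n in sequentially. \<forall>b\<in>B. real (card (sym_diff (b <# \<Phi> n) (\<Phi> n))) / real (card (\<Phi> n)) < 1 / real (Suc N)"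
    using B Fol unfolding Folner_sequence_def
    by (intro eventually_ball_finite ballI order_tendstoD(2)[where y = 0]) auto
  then show "\<forall>\<^sub>F n in sequentially. Z \<le> real (card (\<Phi> n))"
  proof eventually_elim
    case (elim n)
    have "N \<le> card (\<Phi> n)"
    proof (rule ccontr)
      assume less: "\<not> N \<le> card (\<Phi> n)"
      have inv: "b <# \<Phi> n = \<Phi> n" if b: "b \<in> B" for b
      proof -
        have "0 < real (card (\<Phi> n))" using \<Phi> by (simp add: card_gt_0_iff)
        then have "real (card (sym_diff (b <# \<Phi> n) (\<Phi> n))) < real (card (\<Phi> n)) / real (Suc N)"
          using elim b by (auto simp: field_simps)
        also have "\<dots> \<le> 1" using less by simp
        finally have "card (sym_diff (b <# \<Phi> n) (\<Phi> n)) = 0" by simp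
        moreover have "finite (sym_diff (b <# \<Phi> n) (\<Phi> n))" using \<Phi>(1) by (simp add: l_coset_def)
        ultimately show ?thesis by auto
      qed
      obtain f where f: "f \<in> \<Phi> n" using \<Phi> by blast
      have "(\<lambda>b. b \<otimes> f) ` B \<subseteq> \<Phi> n" using inv f by (auto simp: l_coset_def)
      moreover have "card ((\<lambda>b. b \<otimes> f) ` B) = Suc N"
        using B f \<Phi>(3)[of n] by (subst card_image) (auto intro!: inj_onI simp: subset_iff)
      ultimately have "Suc N \<le> card (\<Phi> n)" using \<Phi>(1) by (metis card_mono)
      then show False using less by simp
    qed
    then show ?case using N by linarith
  qed
qed

context aperiodic_window
begin

lemma uniformly_constant:
  assumes "E \<noteq> {}" "s > 0"
  obtains r where "r > 0" "\<And>x y. x \<in> carrier H \<Longrightarrow> y \<in> carrier H \<Longrightarrow> s < set_dist E x \<Longrightarrow> d x y < r \<Longrightarrow>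
      x \<in> W \<longleftrightarrow> y \<in> W"
proof -
  have EH: "E \<subseteq> carrier H" using closedin_subset[OF E_closed] by simp
  have "\<exists>n. \<forall>x\<in>carrier H. \<forall>y\<in>carrier H. s < set_dist E x \<longrightarrow> d x y < 1 / real (Suc n) \<longrightarrow> (x \<in> W \<longleftrightarrow> y \<in> W)"
  proof (rule ccontr)
    assume "\<nexists>n. \<forall>x\<in>carrier H. \<forall>y\<in>carrier H. s < set_dist E x \<longrightarrow> d x y < 1 / real (Suc n) \<longrightarrow> (x \<in> W \<longleftrightarrow> y \<in> W)"
    then have "\<forall>n. \<exists>x y. x \<in> carrier H \<and> y \<in> carrier H \<and> s < set_dist E x \<and> d x y < 1 / real (Suc n) \<and> \<not> (x \<in> W \<longleftrightarrow> y \<in> W)"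
      by blast
    then obtain x y where xy: "\<And>n. x n \<in> carrier H" "\<And>n. y n \<in> carrier H" "\<And>n. s < set_dist E (x n)"
        "\<And>n. d (x n) (y n) < 1 / real (Suc n)" "\<And>n. \<not> (x n \<in> W \<longleftrightarrow> y n \<in> W)"
      by metis
    obtain \<xi> r where \<xi>: "\<xi> \<in> carrier H" and r: "strict_mono (r :: nat \<Rightarrow> nat)"
      and lim: "(\<lambda>n. d (x (r n)) \<xi>) \<longlonglongrightarrow> 0"
      using convergent_subsequence xy(1) by metis
    have "\<xi> \<notin> E"
    proof
      assume "\<xi> \<in> E"
      then have "s < d (x n) \<xi>" for n
        using xy(3)[of n] set_dist_le[of \<xi> E "x n"] by (simp add: commute)
      then show False using order_tendstoD(2)[OF lim \<open>s > 0\<close>]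
        by (auto simp: eventually_sequentially) (meson less_asym order_refl)
    qed
    then obtain e where e: "e > 0" "\<And>v. v \<in> carrier H \<Longrightarrow> d \<xi> v < e \<Longrightarrow> v \<notin> E \<and> (v \<in> W \<longleftrightarrow> \<xi> \<in> W)"
      using locally_constant[of \<xi>] \<xi> by auto
    have "\<forall>\<^sub>F n in sequentially. d (x (r n)) \<xi> < e / 2" using e(1) by (intro order_tendstoD(2)[OF lim]) simp
    moreover have "\<forall>\<^sub>F n in sequentially. 1 / real (Suc n) < e / 2" using e(1) by real_asymp
    ultimately have "\<forall>\<^sub>F n in sequentially. x (r n) \<in> W \<longleftrightarrow> y (r n) \<in> W"
    proof eventually_elim
      case (elim n)
      have "1 / real (Suc (r n)) \<le> 1 / real (Suc n)"
        using seq_suble[OF r, of n] by (intro divide_left_mono) auto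
      then have "d (x (r n)) (y (r n)) < e / 2" using xy(4)[of "r n"] elim(2) by linarith
      then have "d \<xi> (y (r n)) < e" "d \<xi> (x (r n)) < e"
        using triangle[of \<xi> "x (r n)" "y (r n)"] \<xi> xy(1,2) elim(1) e(1) by (auto simp: commute)
      then show ?case using e(2) xy(1,2) by blast
    qed
    then obtain n where "x (r n) \<in> W \<longleftrightarrow> y (r n) \<in> W"
      using eventually_happens sequentially_bot by blast
    then show False using xy(5) by blast
  qed
  then obtain n where "\<forall>x\<in>carrier H. \<forall>y\<in>carrier H. s < set_dist E x \<longrightarrow> d x y < 1 / real (Suc n) \<longrightarrow> (x \<in> W \<longleftrightarrow> y \<in> W)"
    by blast
  then show thesis by (intro that[of "1 / real (Suc n)"]) (simp, blast)
qed

lemma words_coded_array: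
  assumes "finite F" "F \<subseteq> carrier G"
  shows "words G F X = (\<lambda>g. \<lambda>a\<in>F. of_bool (\<tau> (a \<otimes>\<^bsub>G\<^esub> g) \<in> W)) ` carrier G"
  unfolding G.words_orbit_closure[OF coded_array assms]
  using assms(2) by (intro image_cong refl restrict_ext) (auto simp: coded_array_apply)

lemma finite_words: "finite F \<Longrightarrow> finite (words G F Y)"
  unfolding words_def by (rule finite_subset[OF _ finite_PiE[of F "\<lambda>_. {0, 1}"]]) auto

text \<open>Let \<open>\<tau> b\<close> be close to \<open>\<tau> g\<close>, with \<open>b\<close> in a finite net. At the times when the orbit of \<open>\<tau> b\<close> is far from
  \<open>E\<close>, the word at \<open>g\<close> agrees with that at \<open>b\<close>, so it is one of at most 2 to the power of the number
  of remaining times.\<close>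

lemma card_words_upper:
  assumes "E \<noteq> {}" and c: "upper_density E < c"
  obtains K :: real where "K > 0"
    "\<And>\<Phi>. Folner_sequence G \<Phi> \<Longrightarrow>
       \<forall>\<^sub>F n in sequentially. real (card (words G (\<Phi> n) X)) \<le> K * 2 powr (c * real (card (\<Phi> n)))"
proof -
  obtain c' where c': "upper_density E < c'" "c' < c" using dense c by blast
  obtain s where s: "s > 0" "upper_density {x \<in> carrier H. set_dist E x \<le> s} \<le> c'"
    using neighbourhood_density[OF E_closed \<open>E \<noteq> {}\<close> c'(1)] by blast
  let ?U = "{x \<in> carrier H. set_dist E x \<le> s}"
  obtain r where r: "r > 0" "\<And>x y. x \<in> carrier H \<Longrightarrow> y \<in> carrier H \<Longrightarrow> s < set_dist E x \<Longrightarrow> d x y < r \<Longrightarrow>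
      x \<in> W \<longleftrightarrow> y \<in> W"
    using uniformly_constant[OF \<open>E \<noteq> {}\<close> s(1)] by blast
  obtain B where B: "finite B" "B \<subseteq> carrier G" "\<And>\<xi>. \<xi> \<in> carrier H \<Longrightarrow> \<exists>b\<in>B. d (\<tau> b) \<xi> < r"
    using finite_net[OF r(1)] by blast
  have "B \<noteq> {}" using B(3)[OF H.one_closed] by auto
  show thesis
  proof (rule that[of "real (card B)"])
    show "0 < real (card B)" using B(1) \<open>B \<noteq> {}\<close> by (simp add: card_gt_0_iff)
    fix \<Phi> assume Fol: "Folner_sequence G \<Phi>"
    have "upper_density ?U < c" using s(2) c'(2) by simp
    from visits_uniform[OF Fol this]
    show "\<forall>\<^sub>F n in sequentially. real (card (words G (\<Phi> n) X)) \<le> real (card B) * 2 powr (c * real (card (\<Phi> n)))"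
    proof eventually_elim
      case (elim n)
      define F where "F = \<Phi> n"
      have F: "finite F" "F \<subseteq> carrier G" using Fol by (auto simp: Folner_sequence_def F_def)
      define V where "V b = {a \<in> F. \<tau> a \<otimes>\<^bsub>H\<^esub> \<tau> b \<in> ?U}" for b
      define S :: "'g \<Rightarrow> ('g \<Rightarrow> nat) set"
        where "S b = (\<Pi>\<^sub>E a\<in>F. if a \<in> V b then {0, 1} else {of_bool (\<tau> a \<otimes>\<^bsub>H\<^esub> \<tau> b \<in> W)})" for b
      have "words G F X \<subseteq> (\<Union>b\<in>B. S b)"
      proof
        fix w assume "w \<in> words G F X"
        then obtain g where g: "g \<in> carrier G" "w = (\<lambda>a\<in>F. of_bool (\<tau> (a \<otimes>\<^bsub>G\<^esub> g) \<in> W))"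
          unfolding words_coded_array[OF F] by blast
        obtain b where b: "b \<in> B" "d (\<tau> b) (\<tau> g) < r" using B(3)[of "\<tau> g"] g(1) by auto
        have bG: "b \<in> carrier G" using b B(2) by auto
        have "w a \<in> (if a \<in> V b then {0, 1} else {of_bool (\<tau> a \<otimes>\<^bsub>H\<^esub> \<tau> b \<in> W)})" if a: "a \<in> F" for a
        proof (cases "a \<in> V b")
          case False
          have aG: "a \<in> carrier G" using a F by auto
          have "s < set_dist E (\<tau> a \<otimes>\<^bsub>H\<^esub> \<tau> b)" using False a aG bG by (auto simp: V_def)
          moreover have "d (\<tau> a \<otimes>\<^bsub>H\<^esub> \<tau> b) (\<tau> a \<otimes>\<^bsub>H\<^esub> \<tau> g) < r" using b(2) aG bG g(1) by (simp add: d_left)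
          ultimately have "\<tau> a \<otimes>\<^bsub>H\<^esub> \<tau> b \<in> W \<longleftrightarrow> \<tau> a \<otimes>\<^bsub>H\<^esub> \<tau> g \<in> W"
            using aG bG g(1) by (intro r(2)) auto
          then show ?thesis using False a aG g by (simp add: tau_mult)
        qed (use a g in auto)
        then have "w \<in> S b" unfolding S_def using g(2) by (intro PiE_I) auto
        then show "w \<in> (\<Union>b\<in>B. S b)" using b(1) by blast
      qed
      moreover have finS: "finite (S b)" for b unfolding S_def using F(1) by (intro finite_PiE) auto
      ultimately have "card (words G F X) \<le> card (\<Union>b\<in>B. S b)" using B(1) by (intro card_mono) auto
      also have "\<dots> \<le> (\<Sum>b\<in>B. card (S b))" using B(1) by (rule card_UN_le)
      finally have "real (card (words G F X)) \<le> (\<Sum>b\<in>B. real (card (S b)))"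
        by (simp flip: of_nat_sum)
      also have "\<dots> \<le> (\<Sum>b\<in>B. 2 powr (c * real (card F)))"
      proof (rule sum_mono)
        fix b assume b: "b \<in> B"
        have VF: "V b \<subseteq> F" by (auto simp: V_def)
        have "card (S b) = (\<Prod>a\<in>F. if a \<in> V b then 2 else 1)"
          unfolding S_def using F(1) by (subst card_PiE) (auto intro!: prod.cong)
        also have "\<dots> = 2 ^ card (V b)"
          using F(1) VF by (simp add: prod.If_cases Int_absorb1)
        finally have "real (card (S b)) = 2 powr real (card (V b))" by (simp add: powr_realpow)
        also have "\<dots> \<le> 2 powr (c * real (card F))"
          using elim b B(2) by (intro powr_mono) (auto simp: visits_def V_def F_def)
        finally show "real (card (S b)) \<le> 2 powr (c * real (card F))" .
      qed
      also have "\<dots> = real (card B) * 2 powr (c * real (card F))" by simp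
      finally show ?case by (simp add: F_def)
    qed
  qed
qed

text \<open>Patterns on the set \<open>A\<close> of visits are distinguished by their words on \<open>F\<close>. Only the zero pattern may be
  missing, and a factor 2 accounts for it, also when \<open>A\<close> is empty.\<close>

lemma card_words_lower:
  assumes free: "\<And>A B \<xi>. finite A \<Longrightarrow> A \<subseteq> carrier G \<Longrightarrow> B \<subseteq> A \<Longrightarrow> B \<noteq> {} \<Longrightarrow> \<xi> \<in> carrier H \<Longrightarrow>
        (\<And>a. a \<in> A \<Longrightarrow> \<tau> a \<otimes>\<^bsub>H\<^esub> \<xi> \<in> D) \<Longrightarrow>
        \<exists>g\<in>carrier G. \<forall>a\<in>A. \<tau> (a \<otimes>\<^bsub>G\<^esub> g) \<in> W \<longleftrightarrow> a \<in> B"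
    and F: "finite F" "F \<subseteq> carrier G"
  shows "2 powr (upper_density D * real (card F)) / 2 \<le> real (card (words G F X))"
proof -
  obtain \<xi> where \<xi>: "\<xi> \<in> carrier H" "upper_density D * real (card F) \<le> real (visits F D \<xi>)"
    using visits_attain_density[OF F] by blast
  define A where "A = {a \<in> F. \<tau> a \<otimes>\<^bsub>H\<^esub> \<xi> \<in> D}"
  have A: "finite A" "A \<subseteq> carrier G" "A \<subseteq> F" using F by (auto simp: A_def)
  have "Pow A - {{}} \<subseteq> (\<lambda>w. {a \<in> A. w a = 1}) ` words G F X"
  proof
    fix B assume B: "B \<in> Pow A - {{}}"
    have "\<exists>g\<in>carrier G. \<forall>a\<in>A. \<tau> (a \<otimes>\<^bsub>G\<^esub> g) \<in> W \<longleftrightarrow> a \<in> B"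
    proof (rule free[OF A(1,2)])
      show "B \<subseteq> A" "B \<noteq> {}" using B by blast+
      show "\<tau> a \<otimes>\<^bsub>H\<^esub> \<xi> \<in> D" if "a \<in> A" for a using that by (simp add: A_def)
    qed (rule \<xi>(1))
    then obtain g where g: "g \<in> carrier G" "\<forall>a\<in>A. \<tau> (a \<otimes>\<^bsub>G\<^esub> g) \<in> W \<longleftrightarrow> a \<in> B" by blast
    define w :: "'g \<Rightarrow> nat" where "w = (\<lambda>a\<in>F. of_bool (\<tau> (a \<otimes>\<^bsub>G\<^esub> g) \<in> W))"
    have "w \<in> words G F X" unfolding words_coded_array[OF F] w_def using g(1) by blast
    moreover have "B = {a \<in> A. w a = 1}" using g(2) B A(3) by (auto simp: w_def)
    ultimately show "B \<in> (\<lambda>w. {a \<in> A. w a = 1}) ` words G F X" by blast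
  qed
  then have "card (Pow A - {{}}) \<le> card (words G F X)"
    by (rule surj_card_le[OF finite_words[OF F(1)]])
  then have many: "2 ^ card A - 1 \<le> card (words G F X)" using A(1) by (simp add: card_Pow)
  have "words G F X \<noteq> {}" unfolding words_coded_array[OF F] using G.one_closed by blast
  then have one: "1 \<le> card (words G F X)" using finite_words[OF F(1)] by (simp add: Suc_le_eq card_gt_0_iff)
  have "2 powr (upper_density D * real (card F)) \<le> 2 powr real (card A)"
    using \<xi>(2) by (intro powr_mono) (auto simp: visits_def A_def)
  also have "\<dots> = real (2 ^ card A)" by (simp add: powr_realpow)
  also have "\<dots> \<le> 2 * real (card (words G F X))"
  proof -
    have "2 ^ card A \<le> 2 * card (words G F X)" using many one by linarith
    then show ?thesis by (metis of_nat_le_iff of_nat_mult of_nat_numeral)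
  qed
  finally show ?thesis by simp
qed

theorem coded_array_entropy:
  assumes free: "\<And>A B \<xi>. finite A \<Longrightarrow> A \<subseteq> carrier G \<Longrightarrow> B \<subseteq> A \<Longrightarrow> B \<noteq> {} \<Longrightarrow> \<xi> \<in> carrier H \<Longrightarrow>
        (\<And>a. a \<in> A \<Longrightarrow> \<tau> a \<otimes>\<^bsub>H\<^esub> \<xi> \<in> D) \<Longrightarrow>
        \<exists>g\<in>carrier G. \<forall>a\<in>A. \<tau> (a \<otimes>\<^bsub>G\<^esub> g) \<in> W \<longleftrightarrow> a \<in> B"
    and "E \<noteq> {}" and dens: "upper_density E \<le> upper_density D"
  shows "has_topological_entropy G X (upper_density D * ln 2)"
  unfolding has_topological_entropy_def
proof (intro allI impI tendstoI)
  fix \<Phi> and e :: real assume Fol: "Folner_sequence G \<Phi>" and "e > 0"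
  define \<delta> where "\<delta> = upper_density D"
  define m where "m n = real (card (\<Phi> n))" for n
  have \<Phi>: "finite (\<Phi> n)" "\<Phi> n \<noteq> {}" "\<Phi> n \<subseteq> carrier G" for n
    using Fol by (auto simp: Folner_sequence_def)
  have m: "0 < m n" for n using \<Phi> by (simp add: m_def card_gt_0_iff)
  have m_top: "filterlim m at_top sequentially"
    unfolding m_def by (rule G.Folner_card_at_top[OF G_infinite Fol])
  have to0: "(\<lambda>n. C / m n) \<longlonglongrightarrow> 0" for C :: real
    by (intro tendsto_divide_0[OF tendsto_const] filterlim_at_top_imp_at_infinity m_top)
  have "0 < e / (2 * ln 2)" using \<open>e > 0\<close> by simp
  then have "upper_density E < \<delta> + e / (2 * ln 2)" using dens unfolding \<delta>_def by linarith
  from card_words_upper[OF \<open>E \<noteq> {}\<close> this] obtain K :: real where K0: "K > 0"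
    "\<And>\<Phi>. Folner_sequence G \<Phi> \<Longrightarrow> \<forall>\<^sub>F n in sequentially.
        real (card (words G (\<Phi> n) X)) \<le> K * 2 powr ((\<delta> + e / (2 * ln 2)) * real (card (\<Phi> n)))"
    by blast
  have K: "K > 0" "\<forall>\<^sub>F n in sequentially. real (card (words G (\<Phi> n) X)) \<le> K * 2 powr ((\<delta> + e / (2 * ln 2)) * m n)"
    using K0(1) K0(2)[OF Fol] by (simp_all add: m_def)
  have "\<forall>\<^sub>F n in sequentially. ln K / m n < e / 2" "\<forall>\<^sub>F n in sequentially. ln 2 / m n < e"
    using \<open>e > 0\<close> by (auto intro!: order_tendstoD(2)[OF to0])
  then show "\<forall>\<^sub>F n in sequentially. dist (ln (real (card (words G (\<Phi> n) X))) / real (card (\<Phi> n))) (upper_density D * ln 2) < e"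
    using K(2)
  proof eventually_elim
    case (elim n)
    let ?w = "real (card (words G (\<Phi> n) X))"
    have lower: "2 powr (\<delta> * m n) / 2 \<le> ?w"
      unfolding \<delta>_def m_def by (rule card_words_lower[OF free \<Phi>(1,3)])
    then have w: "0 < ?w" by (rule less_le_trans[rotated]) simp
    have "ln (2 powr (\<delta> * m n) / 2) \<le> ln ?w" using lower w by (subst ln_le_cancel_iff) auto
    then have "\<delta> * m n * ln 2 - ln 2 \<le> ln ?w" by (simp add: ln_div ln_powr)
    then have "(\<delta> * m n * ln 2 - ln 2) / m n \<le> ln ?w / m n" using m[of n] by (intro divide_right_mono) auto
    then have 1: "\<delta> * ln 2 - ln 2 / m n \<le> ln ?w / m n" using m[of n] by (simp add: diff_divide_distrib)
    have "ln ?w \<le> ln (K * 2 powr ((\<delta> + e / (2 * ln 2)) * m n))"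
      using elim(3) w by (subst ln_le_cancel_iff) (auto simp: K(1))
    also have "\<dots> = ln K + (\<delta> * ln 2 + e / 2) * m n"
      using K(1) by (simp add: ln_mult ln_powr field_simps)
    finally have "ln ?w / m n \<le> (ln K + (\<delta> * ln 2 + e / 2) * m n) / m n"
      using m[of n] by (intro divide_right_mono) auto
    also have "\<dots> = ln K / m n + (\<delta> * ln 2 + e / 2)" using m[of n] by (simp add: add_divide_distrib)
    finally have 2: "ln ?w / m n < \<delta> * ln 2 + e" using elim(1) by linarith
    show ?case using 1 2 elim(2) unfolding dist_real_def m_def[symmetric] \<delta>_def[symmetric] by linarith
  qed
qed

end

section \<open>Almost automorphic arrays of prescribed entropy\<close>

theorem theorem1p4:
  fixes G :: "('g, 'm) monoid_scheme"
    and H :: "('h, 'n) monoid_scheme"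
    and T :: "'h topology"
    and \<tau> :: "'g \<Rightarrow> 'h"
    and h :: real
  assumes "group G"
    and "countable (carrier G)"
    and "infinite (carrier G)"
    and "residually_finite G"
    and "amenable G"
    and "metric_group_compactification G H T \<tau>"
    and "0 \<le> h" and "h < ln 2"
  shows "\<exists>x \<in> arrays G.
           almost_automorphic G x T (rotation H \<tau>) \<and>
           has_topological_entropy G (orbit_closure G x) h"
proof -
  have mgc: "topological_group H T" "compact_space T" "metrizable_space T" "\<tau> \<in> hom G H"
      "inj_on \<tau> (carrier G)" "T closure_of (\<tau> ` carrier G) = topspace T"
    using assms(6) by (auto simp: metric_group_compactification_def)
  obtain d where d: "Metric_space (carrier H) d" "Metric_space.mtopology (carrier H) d = T"
    "\<And>a x y. \<lbrakk>a \<in> carrier H; x \<in> carrier H; y \<in> carrier H\<rbrakk> \<Longrightarrow> d (a \<otimes>\<^bsub>H\<^esub> x) (a \<otimes>\<^bsub>H\<^esub> y) = d x y"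
    "\<And>a x y. \<lbrakk>a \<in> carrier H; x \<in> carrier H; y \<in> carrier H\<rbrakk> \<Longrightarrow> d (x \<otimes>\<^bsub>H\<^esub> a) (y \<otimes>\<^bsub>H\<^esub> a) = d x y"
    using compact_group_bi_invariant_metric[OF mgc(1-3)] by metis
  have H: "group H" using mgc(1) by (simp add: topological_group_def)
  interpret compactified_group G H d \<tau>
  proof (intro compactified_group.intro compactified_group_axioms.intro)
    show "\<exists>g\<in>carrier G. d (\<tau> g) \<xi> < e" if "\<xi> \<in> carrier H" "e > 0" for \<xi> e
    proof -
      have "topspace T = carrier H" using mgc(1) by (simp add: topological_group_def)
      then have "\<xi> \<in> Metric_space.mtopology (carrier H) d closure_of (\<tau> ` carrier G)"
        using mgc(6) that(1) d(2) by simp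
      then show ?thesis
        using that(2) unfolding Metric_space.metric_closure_of[OF d(1)]
        by (auto simp: Metric_space.in_mball[OF d(1)] Metric_space.commute[OF d(1)])
    qed
  qed (use assms mgc d H in auto)
  have ln2: "0 < ln (2 :: real)" by simp
  obtain D where D: "closedin mtopology D" "D \<noteq> {}" "D \<inter> \<tau> ` carrier G = {}" "upper_density D = h / ln 2"
    using closed_set_of_density[of "h / ln 2"] assms(7,8) ln2 by (auto simp: field_simps)
  show ?thesis
  proof (rule generic_window[OF D(1-3)])
    fix W E
    assume E: "closedin mtopology E" "D \<subseteq> E" "E \<inter> \<tau> ` carrier G = {}" "upper_density E \<le> upper_density D"
      and const: "\<And>x. x \<in> carrier H - E \<Longrightarrow>
          \<exists>e>0. \<forall>y\<in>carrier H. d x y < e \<longrightarrow> y \<notin> E \<and> (y \<in> W \<longleftrightarrow> x \<in> W)"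
      and free: "\<And>A B \<xi>. finite A \<Longrightarrow> A \<subseteq> carrier G \<Longrightarrow> B \<subseteq> A \<Longrightarrow> B \<noteq> {} \<Longrightarrow> \<xi> \<in> carrier H \<Longrightarrow>
          (\<And>a. a \<in> A \<Longrightarrow> \<tau> a \<otimes>\<^bsub>H\<^esub> \<xi> \<in> D) \<Longrightarrow>
          \<exists>g\<in>carrier G. \<forall>a\<in>A. \<tau> (a \<otimes>\<^bsub>G\<^esub> g) \<in> W \<longleftrightarrow> a \<in> B"
      and aper: "\<And>\<kappa>. \<kappa> \<in> carrier H \<Longrightarrow> \<kappa> \<noteq> \<one>\<^bsub>H\<^esub> \<Longrightarrow>
          \<exists>z\<in>carrier H. z \<notin> E \<and> z \<otimes>\<^bsub>H\<^esub> \<kappa> \<notin> E \<and> (z \<in> W \<longleftrightarrow> z \<otimes>\<^bsub>H\<^esub> \<kappa> \<notin> W)"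
    interpret aperiodic_window G H d \<tau> W E
      by unfold_locales (fact E(1) E(3) const aper)+
    have "E \<noteq> {}" using D(2) E(2) by auto
    have "has_topological_entropy G X (upper_density D * ln 2)"
      by (rule coded_array_entropy[OF free \<open>E \<noteq> {}\<close> E(4)])
    then have "has_topological_entropy G X h" using D(4) ln2 by simp
    moreover have "almost_automorphic G coded_array T (rotation H \<tau>)"
      using coded_array_almost_automorphic by (simp add: d(2))
    ultimately show ?thesis using coded_array by blast
  qed
qed

end
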